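(* Let $R=\mathbb{C}[\partial]V$ be a Leibniz conformal algebra that is free as a $\mathbb{C}[\partial]$-module, and let $Q=\mathbb{C}[\partial]x$ be a free $\mathbb{C}[\partial]$-module of rank $1$. Set $E=R\oplus Q$ as a $\mathbb{C}[\partial]$-module. Then: (1) $\mathrm{CExtd}(E,R)\cong\mathcal{LH}_R^2(Q,R)\cong(\mathcal{F}_1(R)/\equiv_1)\sqcup(\mathcal{F}_2(R)/\equiv_2)$ (bijections of sets), where $\equiv_1$ is the equivalence relation on $\mathcal{F}_1(R)$ given by: $(h_\lambda(\cdot,\partial),D_\lambda,T_\lambda,Q_0(\lambda,\partial),P(\lambda,\partial))\equiv_1(h'_\lambda(\cdot,\partial),D'_\lambda,T'_\lambda,Q_0'(\lambda,\partial),P'(\lambda,\partial))$ if and only if $h_\lambda(\cdot,\partial)=h'_\lambda(\cdot,\partial)$ and there exist $u_0\in R$ and $\beta\in\mathbb{C}\setminus\{0\}$ such that for all $a\in R$ $$D_\lambda(a)=[a_\lambda u_0]+\beta D'_\lambda(a)-h_\lambda(a,\partial)u_0,\qquad T_\lambda(a)=[{u_0}_\lambda a]+\beta T'_\lambda(a),$$ $$P(\lambda,\partial)=h'_\lambda(u_0,\partial)+\beta P'(\lambda,\partial),$$ $$Q_0(\lambda,\partial)=[{u_0}_\lambda u_0]+\beta D'_\lambda(u_0)+\beta T'_\lambda(u_0)+\beta^2Q_0'(\lambda,\partial)-P(\lambda,\partial)u_0;$$ and $\equiv_2$ is the equivalence relation on $\mathcal{F}_2(R)$ given by: $(h,D,T,Q_0,P)\equiv_2(h',D',T',Q_0',P')$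 if and only if $h_\lambda(\cdot,\partial)=h'_\lambda(\cdot,\partial)$ and there exist $u_0\in R$ and $\beta\in\mathbb{C}\setminus\{0\}$ such that for all $a\in R$ $$D_\lambda(a)=[a_\lambda u_0]+\beta D'_\lambda(a)-h_\lambda(a,\partial)u_0,\qquad T_\lambda(a)=[{u_0}_\lambda a]+\beta T'_\lambda(a)+h_{-\lambda-\partial}(a,\partial)u_0,$$ $$P(\lambda,\partial)=h'_\lambda(u_0,\partial)-h'_{-\lambda-\partial}(u_0,\partial)+\beta P'(\lambda,\partial),$$ $$Q_0(\lambda,\partial)=[{u_0}_\lambda u_0]+\beta D'_\lambda(u_0)+\beta T'_\lambda(u_0)+\beta^2Q_0'(\lambda,\partial)-P(\lambda,\partial)u_0.$$ The bijection from $(\mathcal{F}_1(R)/\equiv_1)\sqcup(\mathcal{F}_2(R)/\equiv_2)$ to $\mathrm{CExtd}(E,R)$ sends the $\equiv_i$-class of $(h,D,T,Q_0,P)\in\mathcal{F}_i(R)$ to the class of $FC_i(R,\mathbb{C}[\partial]x\mid h,D,T,Q_0,P)$, $i\in\{1,2\}$. (2) $\mathrm{CExtd}'(E,R)\cong\mathcal{LH}^2(Q,R)\cong(\mathcal{F}_1(R)/\approx_1)\sqcup(\mathcal{F}_2(R)/\approx_2)$, where $\approx_i$ ($i=1,2$) is the equivalence relation on $\mathcal{F}_i(R)$ given by: $(h,D,T,Q_0,P)\approx_i(h',D',T',Q_0',P')$ if and only if $h_\lambda(\cdot,\partial)=h'_\lambda(\cdot,\partial)$ and there exists $u_0\in R$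 such that the four identities defining $\equiv_i$ in (1) hold with $\beta=1$. The bijection from $(\mathcal{F}_1(R)/\approx_1)\sqcup(\mathcal{F}_2(R)/\approx_2)$ to $\mathrm{CExtd}'(E,R)$ sends the $\approx_i$-class of $(h,D,T,Q_0,P)\in\mathcal{F}_i(R)$ to the class of $FC_i(R,\mathbb{C}[\partial]x\mid h,D,T,Q_0,P)$.
   Context: All vector spaces are over $\mathbb{C}$; $A[\lambda]$ denotes polynomials in $\lambda$ with coefficients in $A$. Maps with values in polynomials are extended coefficientwise to polynomial arguments in other indeterminates. If $D_\lambda(a)=\sum_i\lambda^i d_i$ then $D_{-\lambda-\partial}(a)=\sum_i(-\lambda-\partial)^i d_i$; similarly in $h_\lambda(a,\partial)\in\mathbb{C}[\lambda,\partial]$ one may substitute polynomials in $\lambda,\mu,\partial$ for the index and for the second slot. $R=\mathbb{C}[\partial]V$ means $R$ is the free $\mathbb{C}[\partial]$-module $\mathbb{C}[\partial]\otimes V$ on the vector space $V$. Conformal bilinear map $f_\lambda:U\times V\to W[\lambda]$: $\mathbb{C}$-bilinear with $f_\lambda(\partial u,v)=-\lambda f_\lambda(u,v)$, $f_\lambda(u,\partial v)=(\partial+\lambda)f_\lambda(u,v)$. A left conformal linear map is a $\mathbb{C}$-linear $a_\lambda:U\to V[\lambda]$ with $a_\lambda(\partial u)=-\lambda a_\lambda u$; a conformal linear map satisfies instead $a_\lambda(\partial u)=(\partial+\lambda)a_\lambda u$. Leibniz conformal algebra: $\mathbb{C}[\partial]$-module $R$ with conformal bilinear $[\cdot_\lambda\cdot]:R\times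 R\to R[\lambda]$ satisfying $[a_\lambda[b_\mu c]]=[[a_\lambda b]_{\lambda+\mu}c]+[b_\mu[a_\lambda c]]$. Flag data. Consider 5-tuples $(h_\lambda(\cdot,\partial),D_\lambda,T_\lambda,Q_0(\lambda,\partial),P(\lambda,\partial))$ with $P\in\mathbb{C}[\lambda,\partial]$, $Q_0(\lambda,\partial)\in R[\lambda]$, $h_\lambda(\cdot,\partial):R\to\mathbb{C}[\lambda,\partial]$ and $D_\lambda:R\to R[\lambda]$ left conformal linear, $T_\lambda:R\to R[\lambda]$ conformal linear. Conditions (for all $a,b\in V$): (i) $h_{\lambda+\mu}([a_\lambda b],\partial)=h_\mu(b,\lambda+\partial)h_\lambda(a,\partial)-h_\lambda(a,\mu+\partial)h_\mu(b,\partial)$; (ii) $D_{\lambda+\mu}([a_\lambda b])=[a_\lambda D_\mu(b)]+h_\mu(b,\lambda+\partial)D_\lambda(a)-[b_\mu D_\lambda(a)]-h_\lambda(a,\mu+\partial)D_\mu(b)$; (iii) $P(\mu,\lambda+\partial)D_\lambda(a)=D_{\lambda+\mu}(D_\lambda(a))+h_\lambda(a,-\lambda-\mu)Q_0(\lambda+\mu,\partial)+T_\mu(D_\lambda(a))+h_\lambda(a,\mu+\partial)Q_0(\mu,\partial)-[a_\lambda Q_0(\mu,\partial)]$; (iv) $T_\lambda(Q_0(\mu,\partial))=D_{\lambda+\mu}(Q_0(\lambda,\partial))+P(\lambda,-\lambda-\mu)Q_0(\lambda+\mu,\partial)+T_\mu(Q_0(\lambda,\partial))+P(\lambda,\mu+\partial)Q_0(\mu,\partial)-P(\mu,\lambda+\partial)Q_0(\lambda,\partial)$.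 $\mathcal{F}_1(R)$ (flag data of the first kind): tuples satisfying (i)-(iv) and $T_\mu([a_\lambda b])=[a_\lambda T_\mu(b)]-[D_\lambda(a)_{\lambda+\mu}b]-h_\lambda(a,-\lambda-\mu)T_{\lambda+\mu}(b)$; $T_\mu([a_\lambda b])=[a_\lambda T_\mu(b)]+[T_\mu(a)_{\lambda+\mu}b]$; $P(\mu,\lambda+\partial)h_\lambda(a,\partial)=h_\lambda(a,-\lambda-\mu)P(\lambda+\mu,\partial)+h_\lambda(a,\mu+\partial)P(\mu,\partial)+h_{\lambda+\mu}(D_\lambda(a),\partial)$; $D_{\lambda+\mu}(T_\mu(a))+D_{\lambda+\mu}(D_\lambda(a))+h_\lambda(a,-\lambda-\mu)Q_0(\lambda+\mu,\partial)=0$; $h_\lambda(a,-\lambda-\mu)P(\lambda+\mu,\partial)+h_{\lambda+\mu}(D_\lambda(a),\partial)+h_{\lambda+\mu}(T_\mu(a),\partial)=0$; $P(\lambda,-\lambda-\mu)T_{\lambda+\mu}(a)=T_\lambda(T_\mu(a))-[Q_0(\lambda,\partial)_{\lambda+\mu}a]-T_\mu(T_\lambda(a))$; $h_{\lambda+\mu}(Q_0(\lambda,\partial),\partial)+P(\lambda,-\lambda-\mu)P(\lambda+\mu,\partial)+P(\lambda,\mu+\partial)P(\mu,\partial)-P(\mu,\lambda+\partial)P(\lambda,\partial)=0$. $\mathcal{F}_2(R)$ (flag data of the second kind): tuples with $h_\lambda(\cdot,\partial)\ne0$ satisfying (i)-(iv) and $T_\mu([a_\lambda b])=[a_\lambda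 T_\mu(b)]-h_{-\lambda-\mu-\partial}(b,\lambda+\partial)D_\lambda(a)-[D_\lambda(a)_{\lambda+\mu}b]-h_\lambda(a,-\lambda-\mu)T_{\lambda+\mu}(b)$; $[T_\mu(a)_{\lambda+\mu}b]+[D_\lambda(a)_{\lambda+\mu}b]=0$; $P(\mu,\lambda+\partial)h_\lambda(a,\partial)=h_\lambda(a,-\lambda-\mu)P(\lambda+\mu,\partial)-h_{-\mu-\partial}(D_\lambda(a),\partial)+h_\lambda(a,\mu+\partial)P(\mu,\partial)+h_{\lambda+\mu}(D_\lambda(a),\partial)$; $D_{\lambda+\mu}(T_\mu(a))+D_{\lambda+\mu}(D_\lambda(a))=0$; $h_{\lambda+\mu}(D_\lambda(a),\partial)+h_{\lambda+\mu}(T_\mu(a),\partial)=0$; $P(\lambda,-\lambda-\mu)T_{\lambda+\mu}(a)=T_\lambda(T_\mu(a))-h_{-\lambda-\mu-\partial}(a,\lambda+\partial)Q_0(\lambda,\partial)-[Q_0(\lambda,\partial)_{\lambda+\mu}a]-T_\mu(T_\lambda(a))+h_{-\lambda-\mu-\partial}(a,\mu+\partial)Q_0(\mu,\partial)$; $P(\lambda,-\lambda-\mu)h_{-\lambda-\mu-\partial}(a,\partial)=h_{-\lambda-\partial}(T_\mu(a),\partial)+h_{-\lambda-\mu-\partial}(a,\lambda+\partial)P(\lambda,\partial)-h_{-\mu-\partial}(T_\lambda(a),\partial)-h_{-\lambda-\mu-\partial}(a,\mu+\partial)P(\mu,\partial)$; $-h_{-\lambda-\partial}(Q_0(\mu,\partial),\partial)=h_{\lambda+\mu}(Q_0(\lambda,\partial),\partial)-h_{-\mu-\partial}(Q_0(\lambda,\partial),\partial)+P(\lambda,-\lambda-\mu)P(\lambda+\mu,\partial)+P(\lambda,\mu+\partial)P(\mu,\partial)-P(\mu,\lambda+\partial)P(\lambda,\partial)$.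 For a tuple in $\mathcal{F}_1(R)$, $FC_1(R,\mathbb{C}[\partial]x\mid h,D,T,Q_0,P)$ is the Leibniz conformal algebra on $R\oplus\mathbb{C}[\partial]x$ with, for $a,b\in V$, $[(a,0)_\lambda(b,0)]=([a_\lambda b],0)$, $[(0,x)_\lambda(0,x)]=(Q_0(\lambda,\partial),P(\lambda,\partial)x)$, $[(a,0)_\lambda(0,x)]=(D_\lambda(a),h_\lambda(a,\partial)x)$, $[(0,x)_\lambda(a,0)]=(T_\lambda(a),0)$. For a tuple in $\mathcal{F}_2(R)$, $FC_2(\dots)$ is defined the same way except $[(0,x)_\lambda(a,0)]=(T_\lambda(a),-h_{-\lambda-\partial}(a,\partial)x)$. Extending datum of $R$ by $Q$: six conformal bilinear maps $\leftharpoonup_\lambda:R\times Q\to R[\lambda]$, $\rightharpoonup_\lambda:R\times Q\to Q[\lambda]$, $\lhd_\lambda:Q\times R\to Q[\lambda]$, $\rhd_\lambda:Q\times R\to R[\lambda]$, $f_\lambda:Q\times Q\to R[\lambda]$, $\{\cdot_\lambda\cdot\}:Q\times Q\to Q[\lambda]$; it is a Leibniz conformal extending structure if $R\times Q$ with $[(a,x)_\lambda(b,y)]=([a_\lambda b]+a\leftharpoonup_\lambda y+x\rhd_\lambda b+f_\lambda(x,y),\ a\rightharpoonup_\lambda y+x\lhd_\lambda b+\{x_\lambda y\})$ is a Leibniz conformal algebra. $\mathcal{TCL}(R,Q)$ is the set of these. $\Omega\equiv\Omega'$ in $\mathcal{TCL}(R,Q)$ if there are $\mathbb{C}[\partial]$-homomorphisms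 $u:Q\to R$, $v\in\mathrm{Aut}_{\mathbb{C}[\partial]}(Q)$ with $a\rightharpoonup_\lambda x=v^{-1}(a\rightharpoonup'_\lambda v(x))$, $a\leftharpoonup_\lambda x=[a_\lambda u(x)]+a\leftharpoonup'_\lambda v(x)-u(a\rightharpoonup_\lambda x)$, $x\lhd_\lambda a=v^{-1}(v(x)\lhd'_\lambda a)$, $x\rhd_\lambda a=[u(x)_\lambda a]+v(x)\rhd'_\lambda a-u(x\lhd_\lambda a)$, $\{x_\lambda y\}=v^{-1}(u(x)\rightharpoonup'_\lambda v(y)+v(x)\lhd'_\lambda u(y)+\{v(x)_\lambda v(y)\}')$, $f_\lambda(x,y)=[u(x)_\lambda u(y)]+u(x)\leftharpoonup'_\lambda v(y)+v(x)\rhd'_\lambda u(y)+f'_\lambda(v(x),v(y))-u(\{x_\lambda y\})$ for all $a\in R$, $x,y\in Q$; $\Omega\approx\Omega'$ if this holds with $v=\mathrm{Id}_Q$. $\mathcal{LH}^2_R(Q,R)=\mathcal{TCL}(R,Q)/\equiv$, $\mathcal{LH}^2(Q,R)=\mathcal{TCL}(R,Q)/\approx$. $\mathrm{CExtd}(E,R)$ (resp. $\mathrm{CExtd}'(E,R)$) is the set of Leibniz conformal algebra structures on $E$ containing $R$ as a subalgebra, modulo isomorphisms $\varphi:E\to E$ of Leibniz conformal algebras restricting to the identity on $R$ (resp. restricting to the identity on $R$ and satisfying $\pi\circ\varphi=\pi$ with $\pi:E\to Q$ the projection). *)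

theory Defs
  imports "HOL-Analysis.Product_Vector" "HOL-Computational_Algebra.Polynomial"
begin

text \<open>
  A \<open>\<complex>[\<partial>]\<close>-module is a type with a scalar action \<open>s\<close> of \<^typ>\<open>complex poly\<close> such that
  \<^term>\<open>module s\<close>; \<open>\<partial>\<close> acts as \<^term>\<open>s [:0, 1:]\<close>. The ring \<open>\<complex>[\<partial>]\<close> itself, and the free module
  \<open>Q = \<complex>[\<partial>]x\<close> of rank one with \<open>x = 1\<close>, is \<^typ>\<open>complex poly\<close> acting by multiplication.
\<close>

definition cscale :: "(complex poly \<Rightarrow> 'a \<Rightarrow> 'a) \<Rightarrow> complex \<Rightarrow> 'a \<Rightarrow> 'a" where
  "cscale s c a = s [:c:] a"

definition free_on :: "(complex poly \<Rightarrow> 'a \<Rightarrow> 'a) \<Rightarrow> 'a::ab_group_add set \<Rightarrow> bool" where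
  \<comment> \<open>the canonical map \<open>\<complex>[\<partial>] \<otimes> V \<rightarrow> R\<close>, \<open>\<partial>\<^sup>i \<otimes> v \<mapsto> \<partial>\<^sup>i v\<close>, is bijective\<close>
  "free_on s V \<longleftrightarrow> module s \<and> module.subspace (cscale s) V \<and>
     (\<forall>r. \<exists>!p :: 'a poly. (\<forall>i. coeff p i \<in> V) \<and>
        r = (\<Sum>i\<le>degree p. s (monom 1 i) (coeff p i)))"


section \<open>Polynomials with coefficients in a module\<close>

text \<open>
  \<open>A[\<lambda>]\<close> is \<^typ>\<open>'a poly\<close> and \<open>A[\<lambda>,\<mu>]\<close> is \<^typ>\<open>'a poly poly\<close>, with \<open>\<lambda>\<close> the inner and \<open>\<mu>\<close> the
  outer indeterminate. They are modules over \<open>\<complex>[\<partial>][\<lambda>]\<close> = \<^typ>\<open>complex poly poly\<close> and over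
  \<open>\<complex>[\<partial>][\<lambda>][\<mu>]\<close> = \<^typ>\<open>complex poly poly poly\<close>.
\<close>

definition poly_act ::
  "('c::comm_ring_1 \<Rightarrow> 'a::ab_group_add \<Rightarrow> 'a) \<Rightarrow> 'c poly \<Rightarrow> 'a poly \<Rightarrow> 'a poly" where
  "poly_act s p m =
     (\<Sum>i\<le>degree p. \<Sum>j\<le>degree m. monom (s (coeff p i) (coeff m j)) (i + j))"

abbreviation act1 ::
  "(complex poly \<Rightarrow> 'a::ab_group_add \<Rightarrow> 'a) \<Rightarrow> complex poly poly \<Rightarrow> 'a poly \<Rightarrow> 'a poly" where
  "act1 s \<equiv> poly_act s"

abbreviation act2 ::
  "(complex poly \<Rightarrow> 'a::ab_group_add \<Rightarrow> 'a) \<Rightarrow>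
     complex poly poly poly \<Rightarrow> 'a poly poly \<Rightarrow> 'a poly poly" where
  "act2 s \<equiv> poly_act (poly_act s)"

definition pscale :: "(complex poly \<Rightarrow> 'a \<Rightarrow> 'a) \<Rightarrow> complex \<Rightarrow> 'a::zero poly \<Rightarrow> 'a poly" where
  "pscale s c = map_poly (cscale s c)"

definition ppair :: "'a::ab_group_add poly \<Rightarrow> 'b::ab_group_add poly \<Rightarrow> ('a \<times> 'b) poly" where
  "ppair p q = map_poly (\<lambda>a. (a, 0)) p + map_poly (\<lambda>b. (0, b)) q"

text \<open>The indeterminates \<open>\<partial>\<close>, \<open>\<lambda>\<close> in \<open>\<complex>[\<partial>][\<lambda>]\<close>, and \<open>\<partial>\<close>, \<open>\<lambda>\<close>, \<open>\<mu>\<close> in \<open>\<complex>[\<partial>][\<lambda>][\<mu>]\<close>.\<close>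

definition del1 :: "complex poly poly" where "del1 = [:[:0, 1:]:]"
definition lam1 :: "complex poly poly" where "lam1 = [:0, 1:]"

definition del :: "complex poly poly poly" where "del = [:[:[:0, 1:]:]:]"
definition lam :: "complex poly poly poly" where "lam = [:[:0, 1:]:]"
definition mu :: "complex poly poly poly" where "mu = [:0, 1:]"

definition const2 :: "'a::zero \<Rightarrow> 'a poly poly" where
  "const2 a = [:[:a:]:]"

text \<open>Substitution of \<open>k \<in> \<complex>[\<partial>,\<lambda>,\<mu>]\<close> for the indeterminate of \<open>p \<in> A[\<lambda>]\<close>.\<close>

definition subst ::
  "(complex poly \<Rightarrow> 'a::ab_group_add \<Rightarrow> 'a) \<Rightarrow> 'a poly \<Rightarrow> complex poly poly poly \<Rightarrow> 'a poly poly"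
  where
  "subst s p k = (\<Sum>i\<le>degree p. act2 s (k ^ i) (const2 (coeff p i)))"

text \<open>For \<open>p(\<lambda>,\<partial>) \<in> \<complex>[\<lambda>,\<partial>]\<close>, stored as an element of \<open>\<complex>[\<partial>][\<lambda>]\<close>, the polynomial \<open>p(k,l)\<close>.\<close>

definition subst2 ::
  "complex poly poly \<Rightarrow> complex poly poly poly \<Rightarrow> complex poly poly poly \<Rightarrow>
     complex poly poly poly" where
  "subst2 p k l =
     (\<Sum>i\<le>degree p. \<Sum>j\<le>degree (coeff p i). const2 [:coeff (coeff p i) j:] * k ^ i * l ^ j)"

text \<open>Coefficientwise extension to polynomial arguments: \<open>F\<^sub>k(m)\<close> for \<open>F : U \<rightarrow> A[\<lambda>]\<close>,
  \<open>f\<^sub>k(m,n)\<close> for \<open>f : U \<times> W \<rightarrow> A[\<lambda>]\<close>, and \<open>h\<^sub>k(m,l)\<close> for \<open>h : U \<rightarrow> \<complex>[\<lambda>,\<partial>]\<close>.\<close>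

definition ext_map ::
  "(complex poly \<Rightarrow> 'a::ab_group_add \<Rightarrow> 'a) \<Rightarrow> ('u::ab_group_add \<Rightarrow> 'a poly) \<Rightarrow>
     complex poly poly poly \<Rightarrow> 'u poly poly \<Rightarrow> 'a poly poly" where
  "ext_map s F k m =
     (\<Sum>j\<le>degree m. \<Sum>i\<le>degree (coeff m j).
        act2 s (lam ^ i * mu ^ j) (subst s (F (coeff (coeff m j) i)) k))"

definition ext_bil ::
  "(complex poly \<Rightarrow> 'a::ab_group_add \<Rightarrow> 'a) \<Rightarrow>
     ('u::ab_group_add \<Rightarrow> 'w::ab_group_add \<Rightarrow> 'a poly) \<Rightarrow>
     complex poly poly poly \<Rightarrow> 'u poly poly \<Rightarrow> 'w poly poly \<Rightarrow> 'a poly poly" where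
  "ext_bil s f k m n =
     (\<Sum>j\<le>degree m. \<Sum>i\<le>degree (coeff m j).
        act2 s (lam ^ i * mu ^ j) (ext_map s (f (coeff (coeff m j) i)) k n))"

definition ext_fun ::
  "('u::ab_group_add \<Rightarrow> complex poly poly) \<Rightarrow> complex poly poly poly \<Rightarrow> 'u poly poly \<Rightarrow>
     complex poly poly poly \<Rightarrow> complex poly poly poly" where
  "ext_fun h k m l =
     (\<Sum>j\<le>degree m. \<Sum>i\<le>degree (coeff m j).
        lam ^ i * mu ^ j * subst2 (h (coeff (coeff m j) i)) k l)"


section \<open>Leibniz conformal algebras\<close>

definition conf_linear ::
  "(complex poly \<Rightarrow> 'u::ab_group_add \<Rightarrow> 'u) \<Rightarrow> (complex poly \<Rightarrow> 'a::ab_group_add \<Rightarrow> 'a) \<Rightarrow>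
     ('u \<Rightarrow> 'a poly) \<Rightarrow> bool" where
  "conf_linear sU sA F \<longleftrightarrow> Vector_Spaces.linear (cscale sU) (pscale sA) F \<and>
     (\<forall>u. F (sU [:0, 1:] u) = act1 sA (del1 + lam1) (F u))"

definition left_conf_linear ::
  "(complex poly \<Rightarrow> 'u::ab_group_add \<Rightarrow> 'u) \<Rightarrow> (complex poly \<Rightarrow> 'a::ab_group_add \<Rightarrow> 'a) \<Rightarrow>
     ('u \<Rightarrow> 'a poly) \<Rightarrow> bool" where
  "left_conf_linear sU sA F \<longleftrightarrow> Vector_Spaces.linear (cscale sU) (pscale sA) F \<and>
     (\<forall>u. F (sU [:0, 1:] u) = act1 sA (- lam1) (F u))"

definition conf_bilinear ::
  "(complex poly \<Rightarrow> 'u::ab_group_add \<Rightarrow> 'u) \<Rightarrow> (complex poly \<Rightarrow> 'w::ab_group_add \<Rightarrow> 'w) \<Rightarrow>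
     (complex poly \<Rightarrow> 'a::ab_group_add \<Rightarrow> 'a) \<Rightarrow> ('u \<Rightarrow> 'w \<Rightarrow> 'a poly) \<Rightarrow> bool" where
  "conf_bilinear sU sW sA f \<longleftrightarrow>
     (\<forall>w. left_conf_linear sU sA (\<lambda>u. f u w)) \<and> (\<forall>u. conf_linear sW sA (f u))"

definition leibniz_conformal ::
  "(complex poly \<Rightarrow> 'a::ab_group_add \<Rightarrow> 'a) \<Rightarrow> ('a \<Rightarrow> 'a \<Rightarrow> 'a poly) \<Rightarrow> bool" where
  "leibniz_conformal s br \<longleftrightarrow> module s \<and> conf_bilinear s s s br \<and>
     (let B = ext_bil s br in
      \<forall>a b c. B lam (const2 a) (B mu (const2 b) (const2 c)) =
        B (lam + mu) (B lam (const2 a) (const2 b)) (const2 c)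
        + B mu (const2 b) (B lam (const2 a) (const2 c)))"

definition leibniz_iso ::
  "(complex poly \<Rightarrow> 'a::ab_group_add \<Rightarrow> 'a) \<Rightarrow> ('a \<Rightarrow> 'a \<Rightarrow> 'a poly) \<Rightarrow> ('a \<Rightarrow> 'a \<Rightarrow> 'a poly) \<Rightarrow>
     ('a \<Rightarrow> 'a) \<Rightarrow> bool" where
  "leibniz_iso s br br' \<phi> \<longleftrightarrow> module_hom s s \<phi> \<and> bij \<phi> \<and>
     (\<forall>a b. map_poly \<phi> (br a b) = br' (\<phi> a) (\<phi> b))"


section \<open>The extending structures problem\<close>

text \<open>The module \<open>E = R \<oplus> Q\<close> is the product type with \<^const>\<open>module_prod.scale\<close>; \<open>R\<close> sits in it
  as the elements \<open>(a, 0)\<close>, and \<open>\<pi> : E \<rightarrow> Q\<close> is \<^const>\<open>snd\<close>.\<close>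

definition extensions ::
  "(complex poly \<Rightarrow> 'r::ab_group_add \<Rightarrow> 'r) \<Rightarrow> (complex poly \<Rightarrow> 'q::ab_group_add \<Rightarrow> 'q) \<Rightarrow>
     ('r \<Rightarrow> 'r \<Rightarrow> 'r poly) \<Rightarrow> ('r \<times> 'q \<Rightarrow> 'r \<times> 'q \<Rightarrow> ('r \<times> 'q) poly) set" where
  "extensions sR sQ br = {e. leibniz_conformal (module_prod.scale sR sQ) e \<and>
     (\<forall>a b. e (a, 0) (b, 0) = ppair (br a b) 0)}"

definition ext_equiv ::
  "(complex poly \<Rightarrow> 'r::ab_group_add \<Rightarrow> 'r) \<Rightarrow> (complex poly \<Rightarrow> 'q::ab_group_add \<Rightarrow> 'q) \<Rightarrow>
     ('r \<Rightarrow> 'r \<Rightarrow> 'r poly) \<Rightarrow> ('r \<times> 'q \<Rightarrow> 'r \<times> 'q \<Rightarrow> ('r \<times> 'q) poly) rel" where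
  "ext_equiv sR sQ br = {(e, e'). e \<in> extensions sR sQ br \<and> e' \<in> extensions sR sQ br \<and>
     (\<exists>\<phi>. leibniz_iso (module_prod.scale sR sQ) e e' \<phi> \<and> (\<forall>a. \<phi> (a, 0) = (a, 0)))}"

definition ext_cohom ::
  "(complex poly \<Rightarrow> 'r::ab_group_add \<Rightarrow> 'r) \<Rightarrow> (complex poly \<Rightarrow> 'q::ab_group_add \<Rightarrow> 'q) \<Rightarrow>
     ('r \<Rightarrow> 'r \<Rightarrow> 'r poly) \<Rightarrow> ('r \<times> 'q \<Rightarrow> 'r \<times> 'q \<Rightarrow> ('r \<times> 'q) poly) rel" where
  "ext_cohom sR sQ br = {(e, e'). e \<in> extensions sR sQ br \<and> e' \<in> extensions sR sQ br \<and>
     (\<exists>\<phi>. leibniz_iso (module_prod.scale sR sQ) e e' \<phi> \<and> (\<forall>a. \<phi> (a, 0) = (a, 0)) \<and>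
        snd \<circ> \<phi> = snd)}"

definition CExtd ::
  "(complex poly \<Rightarrow> 'r::ab_group_add \<Rightarrow> 'r) \<Rightarrow> (complex poly \<Rightarrow> 'q::ab_group_add \<Rightarrow> 'q) \<Rightarrow>
     ('r \<Rightarrow> 'r \<Rightarrow> 'r poly) \<Rightarrow> ('r \<times> 'q \<Rightarrow> 'r \<times> 'q \<Rightarrow> ('r \<times> 'q) poly) set set" where
  "CExtd sR sQ br = extensions sR sQ br // ext_equiv sR sQ br"

definition CExtd' ::
  "(complex poly \<Rightarrow> 'r::ab_group_add \<Rightarrow> 'r) \<Rightarrow> (complex poly \<Rightarrow> 'q::ab_group_add \<Rightarrow> 'q) \<Rightarrow>
     ('r \<Rightarrow> 'r \<Rightarrow> 'r poly) \<Rightarrow> ('r \<times> 'q \<Rightarrow> 'r \<times> 'q \<Rightarrow> ('r \<times> 'q) poly) set set" where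
  "CExtd' sR sQ br = extensions sR sQ br // ext_cohom sR sQ br"

text \<open>Extending data: \<open>lh\<close>, \<open>rh\<close> are \<open>\<leftharpoonup>\<close>, \<open>\<rightharpoonup>\<close>; \<open>lt\<close>, \<open>rt\<close> are \<open>\<lhd>\<close>, \<open>\<rhd>\<close>;
  \<open>cocyc\<close> is \<open>f\<close>; \<open>qbr\<close> is \<open>{\<cdot>\<^sub>\<lambda>\<cdot>}\<close>.\<close>

record (overloaded) ('r::zero, 'q::zero) ext_datum =
  lh :: "'r \<Rightarrow> 'q \<Rightarrow> 'r poly"
  rh :: "'r \<Rightarrow> 'q \<Rightarrow> 'q poly"
  lt :: "'q \<Rightarrow> 'r \<Rightarrow> 'q poly"
  rt :: "'q \<Rightarrow> 'r \<Rightarrow> 'r poly"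
  cocyc :: "'q \<Rightarrow> 'q \<Rightarrow> 'r poly"
  qbr :: "'q \<Rightarrow> 'q \<Rightarrow> 'q poly"

definition unified_product ::
  "('r::ab_group_add \<Rightarrow> 'r \<Rightarrow> 'r poly) \<Rightarrow> ('r, 'q::ab_group_add) ext_datum \<Rightarrow>
     'r \<times> 'q \<Rightarrow> 'r \<times> 'q \<Rightarrow> ('r \<times> 'q) poly" where
  "unified_product br \<Omega> = (\<lambda>(a, x) (b, y). ppair
     (br a b + lh \<Omega> a y + rt \<Omega> x b + cocyc \<Omega> x y)
     (rh \<Omega> a y + lt \<Omega> x b + qbr \<Omega> x y))"

definition TCL ::
  "(complex poly \<Rightarrow> 'r::ab_group_add \<Rightarrow> 'r) \<Rightarrow> (complex poly \<Rightarrow> 'q::ab_group_add \<Rightarrow> 'q) \<Rightarrow>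
     ('r \<Rightarrow> 'r \<Rightarrow> 'r poly) \<Rightarrow> ('r, 'q) ext_datum set" where
  "TCL sR sQ br = {\<Omega>.
     conf_bilinear sR sQ sR (lh \<Omega>) \<and> conf_bilinear sR sQ sQ (rh \<Omega>) \<and>
     conf_bilinear sQ sR sQ (lt \<Omega>) \<and> conf_bilinear sQ sR sR (rt \<Omega>) \<and>
     conf_bilinear sQ sQ sR (cocyc \<Omega>) \<and> conf_bilinear sQ sQ sQ (qbr \<Omega>) \<and>
     leibniz_conformal (module_prod.scale sR sQ) (unified_product br \<Omega>)}"

definition TCL_transform ::
  "('r::ab_group_add \<Rightarrow> 'r \<Rightarrow> 'r poly) \<Rightarrow> ('q::ab_group_add \<Rightarrow> 'r) \<Rightarrow> ('q \<Rightarrow> 'q) \<Rightarrow>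
     ('r, 'q) ext_datum \<Rightarrow> ('r, 'q) ext_datum \<Rightarrow> bool" where
  "TCL_transform br u v \<Omega> \<Omega>' \<longleftrightarrow> (\<forall>a x y.
     rh \<Omega> a x = map_poly (inv v) (rh \<Omega>' a (v x)) \<and>
     lh \<Omega> a x = br a (u x) + lh \<Omega>' a (v x) - map_poly u (rh \<Omega> a x) \<and>
     lt \<Omega> x a = map_poly (inv v) (lt \<Omega>' (v x) a) \<and>
     rt \<Omega> x a = br (u x) a + rt \<Omega>' (v x) a - map_poly u (lt \<Omega> x a) \<and>
     qbr \<Omega> x y =
       map_poly (inv v) (rh \<Omega>' (u x) (v y) + lt \<Omega>' (v x) (u y) + qbr \<Omega>' (v x) (v y)) \<and>
     cocyc \<Omega> x y = br (u x) (u y) + lh \<Omega>' (u x) (v y) + rt \<Omega>' (v x) (u y)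
       + cocyc \<Omega>' (v x) (v y) - map_poly u (qbr \<Omega> x y))"

definition TCL_equiv ::
  "(complex poly \<Rightarrow> 'r::ab_group_add \<Rightarrow> 'r) \<Rightarrow> (complex poly \<Rightarrow> 'q::ab_group_add \<Rightarrow> 'q) \<Rightarrow>
     ('r \<Rightarrow> 'r \<Rightarrow> 'r poly) \<Rightarrow> ('r, 'q) ext_datum rel" where
  "TCL_equiv sR sQ br = {(\<Omega>, \<Omega>'). \<Omega> \<in> TCL sR sQ br \<and> \<Omega>' \<in> TCL sR sQ br \<and>
     (\<exists>u v. module_hom sQ sR u \<and> module_hom sQ sQ v \<and> bij v \<and> TCL_transform br u v \<Omega> \<Omega>')}"

definition TCL_cohom ::
  "(complex poly \<Rightarrow> 'r::ab_group_add \<Rightarrow> 'r) \<Rightarrow> (complex poly \<Rightarrow> 'q::ab_group_add \<Rightarrow> 'q) \<Rightarrow>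
     ('r \<Rightarrow> 'r \<Rightarrow> 'r poly) \<Rightarrow> ('r, 'q) ext_datum rel" where
  "TCL_cohom sR sQ br = {(\<Omega>, \<Omega>'). \<Omega> \<in> TCL sR sQ br \<and> \<Omega>' \<in> TCL sR sQ br \<and>
     (\<exists>u. module_hom sQ sR u \<and> TCL_transform br u id \<Omega> \<Omega>')}"

text \<open>\<open>LH2_R\<close> is \<open>\<L>\<H>\<^sup>2\<^sub>R(Q,R)\<close> and \<open>LH2\<close> is \<open>\<L>\<H>\<^sup>2(Q,R)\<close>.\<close>

definition LH2_R ::
  "(complex poly \<Rightarrow> 'r::ab_group_add \<Rightarrow> 'r) \<Rightarrow> (complex poly \<Rightarrow> 'q::ab_group_add \<Rightarrow> 'q) \<Rightarrow>
     ('r \<Rightarrow> 'r \<Rightarrow> 'r poly) \<Rightarrow> ('r, 'q) ext_datum set set" where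
  "LH2_R sR sQ br = TCL sR sQ br // TCL_equiv sR sQ br"

definition LH2 ::
  "(complex poly \<Rightarrow> 'r::ab_group_add \<Rightarrow> 'r) \<Rightarrow> (complex poly \<Rightarrow> 'q::ab_group_add \<Rightarrow> 'q) \<Rightarrow>
     ('r \<Rightarrow> 'r \<Rightarrow> 'r poly) \<Rightarrow> ('r, 'q) ext_datum set set" where
  "LH2 sR sQ br = TCL sR sQ br // TCL_cohom sR sQ br"


section \<open>Flag data\<close>

record (overloaded) 'r::zero flag_datum =
  flag_h :: "'r \<Rightarrow> complex poly poly"
  flag_D :: "'r \<Rightarrow> 'r poly"
  flag_T :: "'r \<Rightarrow> 'r poly"
  flag_Q :: "'r poly"
  flag_P :: "complex poly poly"

text \<open>In the conditions below, \<open>h k a l\<close> is \<open>h\<^sub>k(a,l)\<close>, \<open>D k a\<close> is \<open>D\<^sub>k(a)\<close>, \<open>T k a\<close> is \<open>T\<^sub>k(a)\<close>,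
  \<open>Q k\<close> is \<open>Q\<^sub>0(k,\<partial>)\<close>, \<open>P k l\<close> is \<open>P(k,l)\<close> and \<open>B k a b\<close> is \<open>[a\<^sub>k b]\<close>, all with values in
  polynomials in \<open>\<lambda>\<close> and \<open>\<mu>\<close>; \<open>\<cdot>\<close> is the action of \<open>\<complex>[\<partial>,\<lambda>,\<mu>]\<close> on \<open>R[\<lambda>,\<mu>]\<close>.\<close>

definition flag_common ::
  "(complex poly \<Rightarrow> 'r::ab_group_add \<Rightarrow> 'r) \<Rightarrow> ('r \<Rightarrow> 'r \<Rightarrow> 'r poly) \<Rightarrow> 'r set \<Rightarrow>
     'r flag_datum \<Rightarrow> bool" where
  "flag_common s br V F \<longleftrightarrow>
     left_conf_linear s (*) (flag_h F) \<and> left_conf_linear s s (flag_D F) \<and>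
     conf_linear s s (flag_T F) \<and>
     (let h = ext_fun (flag_h F); D = ext_map s (flag_D F); T = ext_map s (flag_T F);
          Q = subst s (flag_Q F); P = subst2 (flag_P F); B = ext_bil s br;
          act = act2 s
      in
      (\<forall>a\<in>const2 ` V. \<forall>b\<in>const2 ` V.
         h (lam + mu) (B lam a b) del =
           h mu b (lam + del) * h lam a del - h lam a (mu + del) * h mu b del \<and>
         D (lam + mu) (B lam a b) =
           B lam a (D mu b) + act (h mu b (lam + del)) (D lam a)
           - B mu b (D lam a) - act (h lam a (mu + del)) (D mu b)) \<and>
      (\<forall>a\<in>const2 ` V.
         act (P mu (lam + del)) (D lam a) =
           D (lam + mu) (D lam a) + act (h lam a (- lam - mu)) (Q (lam + mu))
           + T mu (D lam a) + act (h lam a (mu + del)) (Q mu) - B lam a (Q mu)) \<and>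
      T lam (Q mu) =
        D (lam + mu) (Q lam) + act (P lam (- lam - mu)) (Q (lam + mu))
        + T mu (Q lam) + act (P lam (mu + del)) (Q mu) - act (P mu (lam + del)) (Q lam))"

definition flag1 ::
  "(complex poly \<Rightarrow> 'r::ab_group_add \<Rightarrow> 'r) \<Rightarrow> ('r \<Rightarrow> 'r \<Rightarrow> 'r poly) \<Rightarrow> 'r set \<Rightarrow>
     'r flag_datum set" where
  "flag1 s br V = {F. flag_common s br V F \<and>
     (let h = ext_fun (flag_h F); D = ext_map s (flag_D F); T = ext_map s (flag_T F);
          Q = subst s (flag_Q F); P = subst2 (flag_P F); B = ext_bil s br;
          act = act2 s
      in
      (\<forall>a\<in>const2 ` V. \<forall>b\<in>const2 ` V.
         T mu (B lam a b) =
           B lam a (T mu b) - B (lam + mu) (D lam a) b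
           - act (h lam a (- lam - mu)) (T (lam + mu) b) \<and>
         T mu (B lam a b) = B lam a (T mu b) + B (lam + mu) (T mu a) b) \<and>
      (\<forall>a\<in>const2 ` V.
         P mu (lam + del) * h lam a del =
           h lam a (- lam - mu) * P (lam + mu) del + h lam a (mu + del) * P mu del
           + h (lam + mu) (D lam a) del \<and>
         D (lam + mu) (T mu a) + D (lam + mu) (D lam a)
           + act (h lam a (- lam - mu)) (Q (lam + mu)) = 0 \<and>
         h lam a (- lam - mu) * P (lam + mu) del
           + h (lam + mu) (D lam a) del + h (lam + mu) (T mu a) del = 0 \<and>
         act (P lam (- lam - mu)) (T (lam + mu) a) =
           T lam (T mu a) - B (lam + mu) (Q lam) a - T mu (T lam a)) \<and>
      h (lam + mu) (Q lam) del + P lam (- lam - mu) * P (lam + mu) del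
        + P lam (mu + del) * P mu del - P mu (lam + del) * P lam del = 0)}"

definition flag2 ::
  "(complex poly \<Rightarrow> 'r::ab_group_add \<Rightarrow> 'r) \<Rightarrow> ('r \<Rightarrow> 'r \<Rightarrow> 'r poly) \<Rightarrow> 'r set \<Rightarrow>
     'r flag_datum set" where
  "flag2 s br V = {F. flag_h F \<noteq> (\<lambda>_. 0) \<and> flag_common s br V F \<and>
     (let h = ext_fun (flag_h F); D = ext_map s (flag_D F); T = ext_map s (flag_T F);
          Q = subst s (flag_Q F); P = subst2 (flag_P F); B = ext_bil s br;
          act = act2 s
      in
      (\<forall>a\<in>const2 ` V. \<forall>b\<in>const2 ` V.
         T mu (B lam a b) =
           B lam a (T mu b) - act (h (- lam - mu - del) b (lam + del)) (D lam a)
           - B (lam + mu) (D lam a) b - act (h lam a (- lam - mu)) (T (lam + mu) b) \<and>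
         B (lam + mu) (T mu a) b + B (lam + mu) (D lam a) b = 0) \<and>
      (\<forall>a\<in>const2 ` V.
         P mu (lam + del) * h lam a del =
           h lam a (- lam - mu) * P (lam + mu) del - h (- mu - del) (D lam a) del
           + h lam a (mu + del) * P mu del + h (lam + mu) (D lam a) del \<and>
         D (lam + mu) (T mu a) + D (lam + mu) (D lam a) = 0 \<and>
         h (lam + mu) (D lam a) del + h (lam + mu) (T mu a) del = 0 \<and>
         act (P lam (- lam - mu)) (T (lam + mu) a) =
           T lam (T mu a) - act (h (- lam - mu - del) a (lam + del)) (Q lam)
           - B (lam + mu) (Q lam) a - T mu (T lam a)
           + act (h (- lam - mu - del) a (mu + del)) (Q mu) \<and>
         P lam (- lam - mu) * h (- lam - mu - del) a del =
           h (- lam - del) (T mu a) del + h (- lam - mu - del) a (lam + del) * P lam del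
           - h (- mu - del) (T lam a) del - h (- lam - mu - del) a (mu + del) * P mu del) \<and>
      - h (- lam - del) (Q mu) del =
        h (lam + mu) (Q lam) del - h (- mu - del) (Q lam) del
        + P lam (- lam - mu) * P (lam + mu) del
        + P lam (mu + del) * P mu del - P mu (lam + del) * P lam del)}"

text \<open>\<open>p(-\<lambda>-\<partial>,\<partial>)\<close> for \<open>p(\<lambda>,\<partial>) \<in> \<complex>[\<partial>][\<lambda>]\<close>.\<close>

definition flip :: "complex poly poly \<Rightarrow> complex poly poly" where
  "flip p = pcompose p (- lam1 - del1)"

text \<open>The generator \<open>x\<close> of \<open>Q = \<complex>[\<partial>]x\<close> is \<open>1\<close>, so \<open>p(\<lambda>,\<partial>)x \<in> Q[\<lambda>]\<close> is \<open>p\<close> itself.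
  The bracket on \<open>E\<close> is determined by its values on \<open>V\<close> and \<open>x\<close> by conformal bilinearity.\<close>

definition FC1 ::
  "(complex poly \<Rightarrow> 'r::ab_group_add \<Rightarrow> 'r) \<Rightarrow> ('r \<Rightarrow> 'r \<Rightarrow> 'r poly) \<Rightarrow> 'r set \<Rightarrow>
     'r flag_datum \<Rightarrow> 'r \<times> complex poly \<Rightarrow> 'r \<times> complex poly \<Rightarrow> ('r \<times> complex poly) poly" where
  "FC1 s br V F = (THE e. leibniz_conformal (module_prod.scale s (*)) e \<and>
     (\<forall>a\<in>V. \<forall>b\<in>V. e (a, 0) (b, 0) = ppair (br a b) 0) \<and>
     e (0, 1) (0, 1) = ppair (flag_Q F) (flag_P F) \<and>
     (\<forall>a\<in>V. e (a, 0) (0, 1) = ppair (flag_D F a) (flag_h F a) \<and>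
        e (0, 1) (a, 0) = ppair (flag_T F a) 0))"

definition FC2 ::
  "(complex poly \<Rightarrow> 'r::ab_group_add \<Rightarrow> 'r) \<Rightarrow> ('r \<Rightarrow> 'r \<Rightarrow> 'r poly) \<Rightarrow> 'r set \<Rightarrow>
     'r flag_datum \<Rightarrow> 'r \<times> complex poly \<Rightarrow> 'r \<times> complex poly \<Rightarrow> ('r \<times> complex poly) poly" where
  "FC2 s br V F = (THE e. leibniz_conformal (module_prod.scale s (*)) e \<and>
     (\<forall>a\<in>V. \<forall>b\<in>V. e (a, 0) (b, 0) = ppair (br a b) 0) \<and>
     e (0, 1) (0, 1) = ppair (flag_Q F) (flag_P F) \<and>
     (\<forall>a\<in>V. e (a, 0) (0, 1) = ppair (flag_D F a) (flag_h F a) \<and>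
        e (0, 1) (a, 0) = ppair (flag_T F a) (- flip (flag_h F a))))"

definition flag_transform1 ::
  "(complex poly \<Rightarrow> 'r::ab_group_add \<Rightarrow> 'r) \<Rightarrow> ('r \<Rightarrow> 'r \<Rightarrow> 'r poly) \<Rightarrow> 'r \<Rightarrow> complex \<Rightarrow>
     'r flag_datum \<Rightarrow> 'r flag_datum \<Rightarrow> bool" where
  "flag_transform1 s br u0 \<beta> F F' \<longleftrightarrow>
     (\<forall>a. flag_D F a =
            br a u0 + pscale s \<beta> (flag_D F' a) - act1 s (flag_h F a) [:u0:] \<and>
          flag_T F a = br u0 a + pscale s \<beta> (flag_T F' a)) \<and>
     flag_P F = flag_h F' u0 + smult [:\<beta>:] (flag_P F') \<and>
     flag_Q F = br u0 u0 + pscale s \<beta> (flag_D F' u0) + pscale s \<beta> (flag_T F' u0)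
       + pscale s (\<beta>\<^sup>2) (flag_Q F') - act1 s (flag_P F) [:u0:]"

definition flag_transform2 ::
  "(complex poly \<Rightarrow> 'r::ab_group_add \<Rightarrow> 'r) \<Rightarrow> ('r \<Rightarrow> 'r \<Rightarrow> 'r poly) \<Rightarrow> 'r \<Rightarrow> complex \<Rightarrow>
     'r flag_datum \<Rightarrow> 'r flag_datum \<Rightarrow> bool" where
  "flag_transform2 s br u0 \<beta> F F' \<longleftrightarrow>
     (\<forall>a. flag_D F a =
            br a u0 + pscale s \<beta> (flag_D F' a) - act1 s (flag_h F a) [:u0:] \<and>
          flag_T F a =
            br u0 a + pscale s \<beta> (flag_T F' a) + act1 s (flip (flag_h F a)) [:u0:]) \<and>
     flag_P F = flag_h F' u0 - flip (flag_h F' u0) + smult [:\<beta>:] (flag_P F') \<and>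
     flag_Q F = br u0 u0 + pscale s \<beta> (flag_D F' u0) + pscale s \<beta> (flag_T F' u0)
       + pscale s (\<beta>\<^sup>2) (flag_Q F') - act1 s (flag_P F) [:u0:]"

definition flag1_equiv ::
  "(complex poly \<Rightarrow> 'r::ab_group_add \<Rightarrow> 'r) \<Rightarrow> ('r \<Rightarrow> 'r \<Rightarrow> 'r poly) \<Rightarrow> 'r set \<Rightarrow>
     'r flag_datum rel" where
  "flag1_equiv s br V = {(F, F'). F \<in> flag1 s br V \<and> F' \<in> flag1 s br V \<and>
     flag_h F = flag_h F' \<and> (\<exists>u0 \<beta>. \<beta> \<noteq> 0 \<and> flag_transform1 s br u0 \<beta> F F')}"

definition flag2_equiv ::
  "(complex poly \<Rightarrow> 'r::ab_group_add \<Rightarrow> 'r) \<Rightarrow> ('r \<Rightarrow> 'r \<Rightarrow> 'r poly) \<Rightarrow> 'r set \<Rightarrow>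
     'r flag_datum rel" where
  "flag2_equiv s br V = {(F, F'). F \<in> flag2 s br V \<and> F' \<in> flag2 s br V \<and>
     flag_h F = flag_h F' \<and> (\<exists>u0 \<beta>. \<beta> \<noteq> 0 \<and> flag_transform2 s br u0 \<beta> F F')}"

definition flag1_cohom ::
  "(complex poly \<Rightarrow> 'r::ab_group_add \<Rightarrow> 'r) \<Rightarrow> ('r \<Rightarrow> 'r \<Rightarrow> 'r poly) \<Rightarrow> 'r set \<Rightarrow>
     'r flag_datum rel" where
  "flag1_cohom s br V = {(F, F'). F \<in> flag1 s br V \<and> F' \<in> flag1 s br V \<and>
     flag_h F = flag_h F' \<and> (\<exists>u0. flag_transform1 s br u0 1 F F')}"

definition flag2_cohom ::
  "(complex poly \<Rightarrow> 'r::ab_group_add \<Rightarrow> 'r) \<Rightarrow> ('r \<Rightarrow> 'r \<Rightarrow> 'r poly) \<Rightarrow> 'r set \<Rightarrow>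
     'r flag_datum rel" where
  "flag2_cohom s br V = {(F, F'). F \<in> flag2 s br V \<and> F' \<in> flag2 s br V \<and>
     flag_h F = flag_h F' \<and> (\<exists>u0. flag_transform2 s br u0 1 F F')}"

end

theory Submission
  imports Defs
begin

text \<open>
  Since \<open>\<complex>\<close> is infinite, an element of \<open>A[\<lambda>,\<mu>]\<close> is determined by its values at
  \<open>(\<lambda>, \<mu>) = (l, m) \<in> \<complex>\<^sup>2\<close>. After evaluation the \<open>\<lambda>\<close>-bracket becomes a family of bilinear products
  indexed by \<open>l \<in> \<complex>\<close>, a substitution such as \<open>-\<lambda>-\<mu>-\<partial>\<close> becomes an element of \<open>\<complex>[\<partial>]\<close>, and the
  Leibniz identity has to be checked on generators of \<open>E\<close> only.

  An extension on \<open>R \<oplus> \<complex>[\<partial>]x\<close> is determined by \<open>h, D, T, Q\<^sub>0, P\<close> and the component \<open>k\<^sub>\<lambda>(a,\<partial>)x\<close> of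
  \<open>[x\<^sub>\<lambda> a]\<close>. Adding the identities for \<open>(a, x, b)\<close> and \<open>(x, a, b)\<close> gives
  \<open>(h\<^sub>\<lambda>(a,-\<lambda>-\<mu>) + k\<^sub>\<mu>(a,-\<lambda>-\<mu>)) k\<^bsub>\<lambda>+\<mu>\<^esub>(b,\<partial>) = 0\<close>; as polynomial rings are domains, either \<open>k = 0\<close> (first
  kind) or \<open>k\<^sub>\<lambda>(a,\<partial>) = -h\<^bsub>-\<lambda>-\<partial>\<^esub>(a,\<partial>)\<close> (second kind). An isomorphism fixing \<open>R\<close> sends \<open>x\<close> to
  \<open>u\<^sub>0 + \<beta>x\<close> with \<open>\<beta>\<close> a unit of \<open>\<complex>[\<partial>]\<close>, so \<open>\<beta> \<in> \<complex>\<close> is nonzero, and comparing the brackets on generators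
  gives the equivalences of flag data.
\<close>

section \<open>Evaluation of polynomials with coefficients in a module\<close>

text \<open>The point k lies in the acting ring. With \<complex>[\<partial>] acting, k =
  \<open>[:l:]\<close> is evaluation at a number, while a k containing \<partial> realises
  substitutions such as -\<lambda>-\<mu>-\<partial>.\<close>

definition ev :: "('c::comm_ring_1 \<Rightarrow> 'a::ab_group_add \<Rightarrow> 'a) \<Rightarrow> 'a poly \<Rightarrow> 'c \<Rightarrow> 'a" where
  "ev s p k = (\<Sum>i\<le>degree p. s (k ^ i) (coeff p i))"

context module
begin

lemma ev_degree_le: "degree p \<le> n \<Longrightarrow> ev scale p k = (\<Sum>i\<le>n. k ^ i *s coeff p i)"
  unfolding ev_def by (rule sum.mono_neutral_left) (auto simp: coeff_eq_0)

lemma ev_add [simp]: "ev scale (p + q) k = ev scale p k + ev scale q k"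
proof -
  let ?n = "max (degree p) (degree q)"
  have "ev scale (p + q) k = (\<Sum>i\<le>?n. k ^ i *s coeff (p + q) i)"
    by (intro ev_degree_le degree_add_le_max)
  then show ?thesis
    by (simp add: ev_degree_le[of p ?n] ev_degree_le[of q ?n] scale_right_distrib sum.distrib)
qed

lemma ev_0 [simp]: "ev scale 0 k = 0"
  by (simp add: ev_def)

lemma ev_minus [simp]: "ev scale (- p) k = - ev scale p k"
  by (simp add: ev_def sum_negf)

lemma ev_diff [simp]: "ev scale (p - q) k = ev scale p k - ev scale q k"
  using ev_add[of p "- q" k] by simp

lemma ev_sum: "ev scale (\<Sum>i\<in>A. f i) k = (\<Sum>i\<in>A. ev scale (f i) k)"
  by (induction A rule: infinite_finite_induct) auto

lemma ev_monom [simp]: "ev scale (monom a n) k = k ^ n *s a"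
proof -
  have "ev scale (monom a n) k = (\<Sum>i\<le>n. k ^ i *s coeff (monom a n) i)"
    by (intro ev_degree_le degree_monom_le)
  also have "\<dots> = (\<Sum>i\<le>n. if i = n then k ^ n *s a else 0)"
    by (intro sum.cong) auto
  finally show ?thesis by simp
qed

lemma ev_const [simp]: "ev scale [:a:] k = a"
  by (simp add: ev_def)

lemma ev_poly_act [simp]: "ev scale (poly_act scale q p) k = poly q k *s ev scale p k"
proof -
  have "ev scale (poly_act scale q p) k =
      (\<Sum>i\<le>degree q. \<Sum>j\<le>degree p. k ^ (i + j) *s (coeff q i *s coeff p j))"
    unfolding poly_act_def by (simp add: ev_sum)
  also have "\<dots> = (\<Sum>i\<le>degree q. \<Sum>j\<le>degree p. (coeff q i * k ^ i) *s (k ^ j *s coeff p j))"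
    by (intro sum.cong refl) (simp add: power_add ac_simps)
  also have "\<dots> = poly q k *s ev scale p k"
    unfolding ev_def poly_altdef by (simp only: scale_sum_left scale_sum_right) (rule sum.swap)
  finally show ?thesis .
qed

end

lemma module_mult: "module ((*) :: 'c::comm_ring_1 \<Rightarrow> 'c \<Rightarrow> 'c)"
  by standard (simp_all add: algebra_simps)

lemma ev_mult [simp]: "ev (*) p k = poly p k"
  by (simp add: ev_def poly_altdef mult.commute)

lemma ev_map_poly:
  assumes "module_hom s t \<phi>"
  shows "ev t (map_poly \<phi> p) k = \<phi> (ev s p k)"
proof -
  interpret module_hom s t \<phi> by fact
  have "ev t (map_poly \<phi> p) k = (\<Sum>i\<le>degree p. t (k ^ i) (coeff (map_poly \<phi> p) i))"
    by (intro m2.ev_degree_le map_poly_degree_leq)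
  then show ?thesis
    by (simp add: ev_def coeff_map_poly sum scale)
qed

text \<open>Torsion is measured over the integers because this form makes sense over any acting
  ring, holds for every \<complex>[\<partial>]-module and passes from A to A[\<lambda>].\<close>

locale torsion_free_module = module +
  assumes torsion_free: "k \<noteq> 0 \<Longrightarrow> of_int k *s a = 0 \<Longrightarrow> a = 0"
begin

text \<open>For \<open>p\<close> of degree \<open>n\<close>, the polynomial \<open>p(2x) - 2\<^sup>n p(x)\<close> has smaller degree and vanishes where \<open>p\<close> does.\<close>
lemma vandermonde:
  assumes "\<And>x::nat. (\<Sum>i<n. of_nat x ^ i *s c i) = 0" "i < n"
  shows "c i = 0"
  using assms
proof (induction n arbitrary: c i)
  case (Suc n)
  have low: "c j = 0" if j: "j < n" for j
  proof -
    have "of_int (2 ^ j - 2 ^ n) *s c j = 0"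
    proof (rule Suc.IH[where c = "\<lambda>j. of_int (2 ^ j - 2 ^ n) *s c j", OF _ j])
      fix x :: nat
      have "(\<Sum>i<n. of_nat x ^ i *s (of_int (2 ^ i - 2 ^ n) *s c i))
          = (\<Sum>i<Suc n. of_nat x ^ i *s (of_int (2 ^ i - 2 ^ n) *s c i))"
        by simp
      also have "\<dots> = (\<Sum>i<Suc n. of_nat (2 * x) ^ i *s c i - 2 ^ n *s (of_nat x ^ i *s c i))"
        by (intro sum.cong refl)
          (simp add: scale_left_diff_distrib [symmetric] right_diff_distrib power_mult_distrib mult.commute)
      also have "\<dots> = (\<Sum>i<Suc n. of_nat (2 * x) ^ i *s c i) - 2 ^ n *s (\<Sum>i<Suc n. of_nat x ^ i *s c i)"
        by (simp only: sum_subtractf scale_sum_right)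
      finally show "(\<Sum>i<n. of_nat x ^ i *s (of_int (2 ^ i - 2 ^ n) *s c i)) = 0"
        by (simp only: Suc.prems(1)) simp
    qed
    moreover have "(2::int) ^ j - 2 ^ n \<noteq> 0" using j by simp
    ultimately show ?thesis using torsion_free by blast
  qed
  \<comment> \<open>With the lower coefficients zero, the sum at x = 1 is \<open>c n\<close>
    itself.\<close>
  have "c n = 0"
    using Suc.prems(1)[of 1] low by simp
  with low Suc.prems(2) show ?case by (auto simp: less_Suc_eq)
qed simp

text \<open>By \<open>vandermonde\<close>, a polynomial vanishing at all natural numbers is zero.
  Natural numbers exist in every acting ring, so the same lemma serves over \<complex>[\<partial>]
  and over \<complex>[\<partial>][\<lambda>].\<close>

lemma ev_eqI:
  assumes "\<And>x::nat. ev scale p (of_nat x) = ev scale q (of_nat x)"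
  shows "p = q"
proof -
  let ?r = "p - q"
  have "coeff ?r i = 0" for i
  proof (cases "i \<le> degree ?r")
    case True
    show ?thesis
    proof (rule vandermonde)
      show "(\<Sum>i<Suc (degree ?r). of_nat x ^ i *s coeff ?r i) = 0" for x
        using assms[of x] ev_diff[of p q "of_nat x"] unfolding ev_def lessThan_Suc_atMost by simp
    qed (use True in simp)
  next
    case False
    then show ?thesis by (intro coeff_eq_0) simp
  qed
  then have "?r = 0" by (intro poly_eqI) simp
  then show ?thesis by simp
qed

text \<open>The module laws of A[\<lambda>] are polynomial identities and can themselves be tested
  by evaluation. With this, the outer indeterminate \<mu> is handled in the same way as
  \<lambda>.\<close>

lemma torsion_free_poly_act: "torsion_free_module (poly_act scale)"
proof
  show "a = 0" if "k \<noteq> 0" "poly_act scale (of_int k) a = 0" for k a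
  proof (rule ev_eqI)
    fix x :: nat
    have "of_int k *s ev scale a (of_nat x) = ev scale (poly_act scale (of_int k) a) (of_nat x)"
      by simp
    also have "\<dots> = 0" using that(2) by simp
    finally show "ev scale a (of_nat x) = ev scale 0 (of_nat x)"
      using torsion_free[OF that(1)] by simp
  qed
qed (rule ev_eqI; simp add: scale_left_distrib scale_right_distrib)+

end

section \<open>Evaluation of both indeterminates\<close>

definition ev2 :: "('c::comm_ring_1 \<Rightarrow> 'a::ab_group_add \<Rightarrow> 'a) \<Rightarrow> 'a poly poly \<Rightarrow> 'c \<Rightarrow> 'c \<Rightarrow> 'a" where
  "ev2 s p x y = ev s (ev (poly_act s) p [:y:]) x"

context torsion_free_module
begin

interpretation P: torsion_free_module "poly_act scale"
  by (rule torsion_free_poly_act)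

lemma ev2_add [simp]: "ev2 scale (p + q) x y = ev2 scale p x y + ev2 scale q x y"
  and ev2_minus [simp]: "ev2 scale (- p) x y = - ev2 scale p x y"
  and ev2_diff [simp]: "ev2 scale (p - q) x y = ev2 scale p x y - ev2 scale q x y"
  and ev2_0 [simp]: "ev2 scale 0 x y = 0"
  by (simp_all add: ev2_def)

lemma ev2_sum: "ev2 scale (\<Sum>i\<in>A. f i) x y = (\<Sum>i\<in>A. ev2 scale (f i) x y)"
  by (induction A rule: infinite_finite_induct) auto

lemma ev2_act [simp]:
  "ev2 scale (poly_act (poly_act scale) k n) x y = poly (poly k [:y:]) x *s ev2 scale n x y"
  by (simp add: ev2_def)

lemma ev2_const2 [simp]: "ev2 scale (const2 a) x y = a"
  by (simp add: ev2_def const2_def)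

text \<open>This double sum has the shape of \<open>ext_map\<close>, \<open>ext_bil\<close> and
  \<open>ext_fun\<close>, which is what allows those extensions to be evaluated.\<close>

lemma ev2_altdef:
  "ev2 scale m x y = (\<Sum>j\<le>degree m. \<Sum>i\<le>degree (coeff m j). (x ^ i * y ^ j) *s coeff (coeff m j) i)"
proof -
  have "ev2 scale m x y = (\<Sum>j\<le>degree m. y ^ j *s ev scale (coeff m j) x)"
    by (simp add: ev2_def ev_def[of "poly_act scale"] ev_sum)
  then show ?thesis
    by (simp add: ev_def scale_sum_right mult.commute)
qed

lemma ev2_eqI:
  assumes "\<And>a b::nat. ev2 scale p (of_nat a) (of_nat b) = ev2 scale q (of_nat a) (of_nat b)"
  shows "p = q"
proof (rule P.ev_eqI, rule ev_eqI)
  \<comment> \<open>The outer indeterminate \<mu> is evaluated first, so a is the value of \<mu> and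
    b that of \<lambda>.\<close>
  fix a b :: nat
  show "ev scale (ev (poly_act scale) p (of_nat a)) (of_nat b)
      = ev scale (ev (poly_act scale) q (of_nat a)) (of_nat b)"
    using assms[of b a] by (simp add: ev2_def of_nat_poly)
qed

end

text \<open>Nonzero integers are units of \<complex>[\<partial>], so multiplication by one of them
  is injective on any \<complex>[\<partial>]-module.\<close>

lemma torsion_free_complex_poly:
  fixes s :: "complex poly \<Rightarrow> 'a::ab_group_add \<Rightarrow> 'a"
  assumes "module s"
  shows "torsion_free_module s"
proof -
  interpret module s by fact
  show ?thesis
  proof
    fix k :: int and a
    assume k: "k \<noteq> 0" and 0: "s (of_int k) a = 0"
    have "a = s ([:1 / of_int k:] * of_int k) a"
      using k by (simp add: of_int_poly flip: one_pCons)
    also have "\<dots> = s [:1 / of_int k:] (s (of_int k) a)"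
      by simp
    also have "\<dots> = 0" by (simp only: 0 scale_zero_right)
    finally show "a = 0" .
  qed
qed

lemma ev_eq_complexI:
  fixes s :: "complex poly \<Rightarrow> 'a::ab_group_add \<Rightarrow> 'a"
  assumes "module s" "\<And>l. ev s p [:l:] = ev s q [:l:]"
  shows "p = q"
  using torsion_free_module.ev_eqI[OF torsion_free_complex_poly[OF assms(1)]] assms(2)
  by (simp add: of_nat_poly)

lemma ev2_eq_complexI:
  fixes s :: "complex poly \<Rightarrow> 'a::ab_group_add \<Rightarrow> 'a"
  assumes "module s" "\<And>l m. ev2 s p [:l:] [:m:] = ev2 s q [:l:] [:m:]"
  shows "p = q"
  using torsion_free_module.ev2_eqI[OF torsion_free_complex_poly[OF assms(1)]] assms(2)
  by (simp add: of_nat_poly)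

text \<open>The value of a scalar from \<complex>[\<partial>,\<lambda>,\<mu>] at (\<lambda>, \<mu>)
  = (l, m); \<partial> stays an indeterminate, so the result still acts on R.\<close>

definition kev :: "complex poly poly poly \<Rightarrow> complex \<Rightarrow> complex \<Rightarrow> complex poly" where
  "kev k l m = poly (poly k [:[:m:]:]) [:l:]"

lemma kev_simps [simp]:
  "kev (p + q) l m = kev p l m + kev q l m"
  "kev (p - q) l m = kev p l m - kev q l m"
  "kev (- p) l m = - kev p l m"
  "kev (p * q) l m = kev p l m * kev q l m"
  "kev (p ^ n) l m = kev p l m ^ n"
  "kev 0 l m = 0"
  "kev lam l m = [:l:]"
  "kev mu l m = [:m:]"
  "kev del l m = [:0, 1:]"
  "kev [:[:c:]:] l m = c"
  by (simp_all add: kev_def lam_def mu_def del_def)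

lemma kev_sum: "kev (\<Sum>i\<in>A. f i) l m = (\<Sum>i\<in>A. kev (f i) l m)"
  by (simp add: kev_def poly_sum)

lemma ev2_mult [simp]: "ev2 (*) k [:l:] [:m:] = kev k l m"
proof -
  \<comment> \<open>Over the ring itself the polynomial action is the ordinary product, so scalars
    fit the general evaluation scheme.\<close>
  have "poly_act (*) p q = p * q" for p q :: "complex poly poly"
    by (rule ev_eq_complexI[OF module_mult]) (simp add: module.ev_poly_act[OF module_mult] del: ev_mult, simp)
  then have "poly_act ((*) :: complex poly \<Rightarrow> _) = (*)" by (intro ext)
  then show ?thesis
    by (simp add: ev2_def kev_def)
qed

lemma kev_eqI: "(\<And>l m. kev p l m = kev q l m) \<Longrightarrow> p = q"
  by (rule ev2_eq_complexI[OF module_mult]) simp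

section \<open>Linear and conformal linear maps in evaluated form\<close>

locale ev_linear =
  sU: module sU + sA: module sA
  for sU :: "complex poly \<Rightarrow> 'u::ab_group_add \<Rightarrow> 'u"
    and sA :: "complex poly \<Rightarrow> 'a::ab_group_add \<Rightarrow> 'a" +
  fixes F :: "'u \<Rightarrow> 'a poly"
  assumes linear: "Vector_Spaces.linear (cscale sU) (pscale sA) F"
begin

lemma add: "F (u + v) = F u + F v"
  and scale: "F (sU [:c:] u) = pscale sA c (F u)"
proof -
  interpret Vector_Spaces.linear "cscale sU" "pscale sA" F by (rule linear)
  show "F (u + v) = F u + F v" by (rule add)
  show "F (sU [:c:] u) = pscale sA c (F u)" using scale[of c u] by (simp add: cscale_def)
qed

sublocale additive F by standard (rule add)

end

lemma module_hom_const:
  assumes "module (s :: complex poly \<Rightarrow> 'a::ab_group_add \<Rightarrow> 'a)"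
  shows "module_hom s s (cscale s c)"
proof -
  interpret module s by fact
  show ?thesis by standard (simp_all add: cscale_def scale_right_distrib)
qed

lemma ev_pscale:
  assumes "module s"
  shows "ev s (pscale s c p) k = s [:c:] (ev s p k)"
  unfolding pscale_def by (subst ev_map_poly[OF module_hom_const[OF assms]]) (simp add: cscale_def)

context ev_linear
begin

lemma ev_scale: "ev sA (F (sU [:c:] u)) k = sA [:c:] (ev sA (F u) k)"
  by (simp add: scale ev_pscale sA.module_axioms)

end

lemma vector_space_cscale:
  assumes "module s" shows "vector_space (cscale s)"
proof -
  interpret module s by fact
  show ?thesis
  proof
    show "cscale s (a + b) x = cscale s a x + cscale s b x" for a b x
      unfolding cscale_def by (simp add: scale_left_distrib [symmetric])
  qed (simp_all add: cscale_def scale_right_distrib mult.commute flip: one_pCons)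
qed

lemma vector_space_pscale:
  assumes "module s" shows "vector_space (pscale s)"
proof -
  interpret module s by fact
  note [simp] = ev_pscale[OF assms]
  show ?thesis
  proof
    show "pscale s (a + b) x = pscale s a x + pscale s b x" for a b x
      by (rule ev_eq_complexI[OF assms]) (simp add: scale_left_distrib [symmetric])
    show "pscale s 1 x = x" for x
      by (rule ev_eq_complexI[OF assms]) (simp flip: one_pCons)
  qed (rule ev_eq_complexI[OF assms]; simp add: scale_right_distrib mult.commute)+
qed

lemma linear_pscaleI:
  assumes "module sU" "module sA"
    and "\<And>u v. F (u + v) = F u + F v"
    and "\<And>c u l. ev sA (F (sU [:c:] u)) [:l:] = sA [:c:] (ev sA (F u) [:l:])"
  shows "Vector_Spaces.linear (cscale sU) (pscale sA) F"
  unfolding Vector_Spaces.linear_def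
proof (intro conjI vector_space_cscale vector_space_pscale assms)
  interpret u: module "cscale sU"
    using vector_space_cscale[OF assms(1)] by (simp add: vector_space_def module_def)
  interpret a: module "pscale sA"
    using vector_space_pscale[OF assms(2)] by (simp add: vector_space_def module_def)
  show "module_hom (cscale sU) (pscale sA) F"
  proof
    show "F (cscale sU c u) = pscale sA c (F u)" for c u
      by (rule ev_eq_complexI[OF assms(2)]) (simp add: ev_pscale[OF assms(2)] cscale_def assms(4))
  qed (rule assms(3))
qed

text \<open>Induction along p = c + \<partial>p': after evaluation \<partial> comes out as -l, hence
  p(\<partial>) as the number p(-l). The converse takes p = \<partial> and p constant.\<close>

lemma left_conf_linear_iff:
  assumes U: "module sU" and A: "module sA"
  shows "left_conf_linear sU sA F \<longleftrightarrow> (\<forall>u v. F (u + v) = F u + F v) \<and>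
    (\<forall>p u l. ev sA (F (sU p u)) [:l:] = sA [:poly p (- l):] (ev sA (F u) [:l:]))"
proof
  interpret sU: module sU by fact
  interpret sA: module sA by fact
  assume L: "left_conf_linear sU sA F"
  interpret ev_linear sU sA F
    using L by (auto intro!: ev_linear.intro ev_linear_axioms.intro U A simp: left_conf_linear_def)
  have D: "F (sU [:0, 1:] u) = act1 sA (- lam1) (F u)" for u
    using L by (simp add: left_conf_linear_def)
  have "ev sA (F (sU p u)) [:l:] = sA [:poly p (- l):] (ev sA (F u) [:l:])" for p u l
  proof (induction p)
    case (pCons c p)
    have "sU (pCons c p) u = sU [:c:] u + sU [:0, 1:] (sU p u)"
      by (simp flip: sU.scale_left_distrib)
    then have "F (sU (pCons c p) u) = F (sU [:c:] u) + act1 sA (- lam1) (F (sU p u))"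
      by (simp only: add D)
    then show ?case
      by (simp add: ev_scale pCons.IH lam1_def mult.commute sA.scale_left_distrib [symmetric])
  qed (simp add: zero)
  then show "(\<forall>u v. F (u + v) = F u + F v) \<and>
    (\<forall>p u l. ev sA (F (sU p u)) [:l:] = sA [:poly p (- l):] (ev sA (F u) [:l:]))"
    using add by blast
next
  interpret sA: module sA by fact
  assume R: "(\<forall>u v. F (u + v) = F u + F v) \<and>
    (\<forall>p u l. ev sA (F (sU p u)) [:l:] = sA [:poly p (- l):] (ev sA (F u) [:l:]))"
  then have "F (sU [:0, 1:] u) = act1 sA (- lam1) (F u)" for u
    by (intro ev_eq_complexI[OF A]) (simp add: lam1_def)
  then show "left_conf_linear sU sA F"
    using R by (auto simp: left_conf_linear_def intro!: linear_pscaleI U A)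
qed

text \<open>Same induction as for left conformal linear maps, but \<partial> comes out as
  \<partial>+l, which is \<open>[:l, 1:]\<close>, so the factor p(\<partial>+l) still contains
  \<partial>.\<close>

lemma conf_linear_iff:
  assumes U: "module sU" and A: "module sA"
  shows "conf_linear sU sA F \<longleftrightarrow> (\<forall>u v. F (u + v) = F u + F v) \<and>
    (\<forall>p u l. ev sA (F (sU p u)) [:l:] = sA (p \<circ>\<^sub>p [:l, 1:]) (ev sA (F u) [:l:]))"
proof
  interpret sU: module sU by fact
  interpret sA: module sA by fact
  assume L: "conf_linear sU sA F"
  interpret ev_linear sU sA F
    using L by (auto intro!: ev_linear.intro ev_linear_axioms.intro U A simp: conf_linear_def)
  have D: "F (sU [:0, 1:] u) = act1 sA (del1 + lam1) (F u)" for u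
    using L by (simp add: conf_linear_def)
  have "ev sA (F (sU p u)) [:l:] = sA (p \<circ>\<^sub>p [:l, 1:]) (ev sA (F u) [:l:])" for p u l
  proof (induction p)
    case (pCons c p)
    have "sU (pCons c p) u = sU [:c:] u + sU [:0, 1:] (sU p u)"
      by (simp flip: sU.scale_left_distrib)
    then have "F (sU (pCons c p) u) = F (sU [:c:] u) + act1 sA (del1 + lam1) (F (sU p u))"
      by (simp only: add D)
    then show ?case
      by (simp add: ev_scale pCons.IH lam1_def del1_def pcompose_pCons sA.scale_left_distrib [symmetric])
  qed (simp add: zero)
  then show "(\<forall>u v. F (u + v) = F u + F v) \<and>
    (\<forall>p u l. ev sA (F (sU p u)) [:l:] = sA (p \<circ>\<^sub>p [:l, 1:]) (ev sA (F u) [:l:]))"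
    using add by blast
next
  interpret sA: module sA by fact
  assume R: "(\<forall>u v. F (u + v) = F u + F v) \<and>
    (\<forall>p u l. ev sA (F (sU p u)) [:l:] = sA (p \<circ>\<^sub>p [:l, 1:]) (ev sA (F u) [:l:]))"
  then have "F (sU [:0, 1:] u) = act1 sA (del1 + lam1) (F u)" for u
    by (intro ev_eq_complexI[OF A]) (simp add: lam1_def del1_def pcompose_pCons)
  then show "conf_linear sU sA F"
    using R by (auto simp: conf_linear_def pcompose_pCons intro!: linear_pscaleI U A)
qed

section \<open>Evaluation of substitutions and coefficientwise extensions\<close>

lemma ev2_subst:
  assumes "module s"
  shows "ev2 s (subst s p k) [:l:] [:m:] = ev s p (kev k l m)"
proof -
  interpret torsion_free_module s by (rule torsion_free_complex_poly[OF assms])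
  show ?thesis
    by (simp add: subst_def ev2_sum ev_def[of s] flip: kev_def)
qed

context ev_linear
begin

text \<open>At numbers x and y the monomials in \<lambda> and \<mu> become complex scalars, and
  these pass through the \<complex>-linear map F. The index k may contain \<partial>, since it is
  substituted only after F is applied.\<close>

lemma ev2_ext_map:
  "ev2 sA (ext_map sA F k m) [:x:] [:y:] = ev sA (F (ev2 sU m [:x:] [:y:])) (kev k x y)"
proof -
  interpret tA: torsion_free_module sA by (rule torsion_free_complex_poly) standard
  interpret tU: torsion_free_module sU by (rule torsion_free_complex_poly) standard
  have "ev2 sA (ext_map sA F k m) [:x:] [:y:] = (\<Sum>j\<le>degree m. \<Sum>i\<le>degree (coeff m j).
       sA [:x ^ i * y ^ j:] (ev sA (F (coeff (coeff m j) i)) (kev k x y)))"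
    by (simp add: ext_map_def tA.ev2_sum ev2_subst sA.module_axioms flip: kev_def)
      (simp add: poly_const_pow mult.commute)
  also have "\<dots> = (\<Sum>j\<le>degree m. \<Sum>i\<le>degree (coeff m j).
       ev sA (F (sU [:x ^ i * y ^ j:] (coeff (coeff m j) i))) (kev k x y))"
    by (simp only: ev_scale)
  also have "\<dots> = ev sA (F (ev2 sU m [:x:] [:y:])) (kev k x y)"
    by (simp add: tU.ev2_altdef sum sA.ev_sum poly_const_pow mult.commute)
  finally show ?thesis .
qed

end

definition hev :: "complex poly poly \<Rightarrow> complex \<Rightarrow> complex \<Rightarrow> complex" where
  "hev p x y = poly (poly p [:x:]) y"

definition sub2 :: "complex poly poly \<Rightarrow> complex poly \<Rightarrow> complex poly \<Rightarrow> complex poly" where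
  "sub2 p k l = (\<Sum>i\<le>degree p. \<Sum>j\<le>degree (coeff p i). [:coeff (coeff p i) j:] * k ^ i * l ^ j)"

lemma poly_sub2 [simp]: "poly (sub2 p k l) d = hev p (poly k d) (poly l d)"
proof -
  have "hev p x y = (\<Sum>i\<le>degree p. poly (coeff p i) y * x ^ i)" for x y
    by (simp add: hev_def poly_altdef[of p] poly_sum poly_const_pow mult.commute)
  then show ?thesis
    by (simp add: sub2_def poly_sum poly_altdef[of "coeff p _"] sum_distrib_right sum_distrib_left ac_simps)
qed

lemma sub2_const: "sub2 p [:x:] k = poly p [:x:] \<circ>\<^sub>p k"
  by (rule poly_ext) (simp add: hev_def poly_pcompose)

lemma kev_subst2: "kev (subst2 p k l) x y = sub2 p (kev k x y) (kev l x y)"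
  by (simp add: subst2_def sub2_def kev_sum const2_def del: mult_pCons_left)

lemma kev_ext_fun:
  assumes "ev_linear s (*) h"
  shows "kev (ext_fun h k m l) x y = sub2 (h (ev2 s m [:x:] [:y:])) (kev k x y) (kev l x y)"
\<comment> \<open>Evaluating \<partial> at d as well turns both substituted polynomials into
  numbers, so that the \<complex>-linearity of h suffices.\<close>
proof (rule poly_ext)
  fix d
  interpret ev_linear s "(*)" h by fact
  interpret tU: torsion_free_module s by (rule torsion_free_complex_poly) standard
  let ?k = "poly (kev k x y) d" and ?l = "poly (kev l x y) d"
  have "poly (kev (ext_fun h k m l) x y) d = (\<Sum>j\<le>degree m. \<Sum>i\<le>degree (coeff m j).
       (x ^ i * y ^ j) * hev (h (coeff (coeff m j) i)) ?k ?l)"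
    by (simp add: ext_fun_def kev_sum kev_subst2 poly_sum)
  also have "\<dots> = (\<Sum>j\<le>degree m. \<Sum>i\<le>degree (coeff m j).
       hev (h (s [:x ^ i * y ^ j:] (coeff (coeff m j) i))) ?k ?l)"
    using ev_scale by (simp add: hev_def)
  also have "\<dots> = hev (h (ev2 s m [:x:] [:y:])) ?k ?l"
    by (simp add: tU.ev2_altdef sum poly_sum hev_def poly_const_pow mult.commute)
  finally show "poly (kev (ext_fun h k m l) x y) d
     = poly (sub2 (h (ev2 s m [:x:] [:y:])) (kev k x y) (kev l x y)) d" by simp
qed

lemma ev2_ext_bil:
  assumes "module sU" "module sW" "module sA" "conf_bilinear sU sW sA f"
  shows "ev2 sA (ext_bil sA f k m n) [:x:] [:y:]
    = ev sA (f (ev2 sU m [:x:] [:y:]) (ev2 sW n [:x:] [:y:])) (kev k x y)"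
proof -
  interpret sU: torsion_free_module sU by (rule torsion_free_complex_poly[OF assms(1)])
  interpret sW: torsion_free_module sW by (rule torsion_free_complex_poly[OF assms(2)])
  interpret sA: torsion_free_module sA by (rule torsion_free_complex_poly[OF assms(3)])
  interpret r: ev_linear sW sA "f u" for u
    using assms by (auto intro!: ev_linear.intro ev_linear_axioms.intro
        simp: conf_bilinear_def conf_linear_def)
  interpret l: ev_linear sU sA "\<lambda>u. f u w" for w
    using assms by (auto intro!: ev_linear.intro ev_linear_axioms.intro
        simp: conf_bilinear_def left_conf_linear_def)
  let ?w = "ev2 sW n [:x:] [:y:]"
  have "ev2 sA (ext_bil sA f k m n) [:x:] [:y:] = (\<Sum>j\<le>degree m. \<Sum>i\<le>degree (coeff m j).
       sA [:x ^ i * y ^ j:] (ev sA (f (coeff (coeff m j) i) ?w) (kev k x y)))"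
    by (simp add: ext_bil_def sA.ev2_sum r.ev2_ext_map flip: kev_def)
      (simp add: poly_const_pow mult.commute)
  also have "\<dots> = (\<Sum>j\<le>degree m. \<Sum>i\<le>degree (coeff m j).
       ev sA (f (sU [:x ^ i * y ^ j:] (coeff (coeff m j) i)) ?w) (kev k x y))"
    by (simp only: l.ev_scale)
  also have "\<dots> = ev sA (f (ev2 sU m [:x:] [:y:]) ?w) (kev k x y)"
    by (simp add: sU.ev2_altdef l.sum sA.ev_sum poly_const_pow mult.commute)
  finally show ?thesis .
qed

section \<open>Conformal bilinear maps and the Leibniz identity on generators\<close>

locale conf_bil =
  sU: module sU + sW: module sW + sA: module sA
  for sU :: "complex poly \<Rightarrow> 'u::ab_group_add \<Rightarrow> 'u"
    and sW :: "complex poly \<Rightarrow> 'w::ab_group_add \<Rightarrow> 'w"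
    and sA :: "complex poly \<Rightarrow> 'a::ab_group_add \<Rightarrow> 'a" +
  fixes f :: "'u \<Rightarrow> 'w \<Rightarrow> 'a poly"
  assumes conf_bilinear: "conf_bilinear sU sW sA f"
begin

lemma left: "left_conf_linear sU sA (\<lambda>u. f u w)" and right: "conf_linear sW sA (f u)"
  using conf_bilinear by (auto simp: conf_bilinear_def)

lemma add_left: "f (u + v) w = f u w + f v w"
  and scale_left: "ev sA (f (sU p u) w) [:l:] = sA [:poly p (- l):] (ev sA (f u w) [:l:])"
  using left[of w] by (simp_all add: left_conf_linear_iff sU.module_axioms sA.module_axioms)

lemma add_right: "f u (v + w) = f u v + f u w"
  and scale_right: "ev sA (f u (sW p w)) [:l:] = sA (p \<circ>\<^sub>p [:l, 1:]) (ev sA (f u w) [:l:])"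
  using right[of u] by (simp_all add: conf_linear_iff sW.module_axioms sA.module_axioms)

lemma zero_left [simp]: "f 0 w = 0" and zero_right [simp]: "f u 0 = 0"
  using add_left[of 0 0 w] add_right[of u 0 0] by simp_all

end

lemma conf_bilinearI:
  assumes "module sU" "module sW" "module sA"
    and "\<And>u v w. f (u + v) w = f u w + f v w" "\<And>u v w. f u (v + w) = f u v + f u w"
    and "\<And>p u w l. ev sA (f (sU p u) w) [:l:] = sA [:poly p (- l):] (ev sA (f u w) [:l:])"
    and "\<And>p u w l. ev sA (f u (sW p w)) [:l:] = sA (p \<circ>\<^sub>p [:l, 1:]) (ev sA (f u w) [:l:])"
  shows "conf_bilinear sU sW sA f"
  using assms by (simp add: conf_bilinear_def left_conf_linear_iff conf_linear_iff)

text \<open>Serves to show that both sides of a homomorphism condition are conformal bilinear, so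
  that it can be tested on generators, and that the components of a bracket on E are conformal
  bilinear.\<close>

lemma conf_bil_compose:
  assumes "conf_bil sU sW sA f" and i: "module_hom sU' sU i" and j: "module_hom sW' sW j"
    and \<phi>: "module_hom sA sA' \<phi>"
  shows "conf_bil sU' sW' sA' (\<lambda>u w. map_poly \<phi> (f (i u) (j w)))"
proof -
  interpret conf_bil sU sW sA f by fact
  interpret i: module_hom sU' sU i by fact
  interpret j: module_hom sW' sW j by fact
  interpret \<phi>: module_hom sA sA' \<phi> by fact
  have map_add: "map_poly \<phi> (p + q) = map_poly \<phi> p + map_poly \<phi> q" for p q
    by (simp add: poly_eq_iff coeff_map_poly \<phi>.add)
  show ?thesis
    by (intro conf_bil.intro conf_bil_axioms.intro i.m1.module_axioms j.m1.module_axioms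
        \<phi>.m2.module_axioms conf_bilinearI)
      (simp_all add: add_left add_right scale_left scale_right i.add i.scale j.add j.scale
        map_add ev_map_poly[OF \<phi>] \<phi>.scale)
qed

text \<open>Evaluating \<open>ext_bil\<close> leaves nested brackets at numbers, where the index
  \<lambda>+\<mu> becomes l + m. The Leibniz identity is used in this form below.\<close>

lemma leibniz_conformal_iff:
  "leibniz_conformal s br \<longleftrightarrow> module s \<and> conf_bilinear s s s br \<and>
    (\<forall>a b c l m. ev s (br a (ev s (br b c) [:m:])) [:l:] =
       ev s (br (ev s (br a b) [:l:]) c) [:l + m:] + ev s (br b (ev s (br a c) [:l:])) [:m:])"
proof (cases "module s \<and> conf_bilinear s s s br")
  case True
  then have s: "module s" and br: "conf_bilinear s s s br" by auto
  interpret torsion_free_module s by (rule torsion_free_complex_poly[OF s])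
  have eq: "x = y \<longleftrightarrow> (\<forall>l m. ev2 s x [:l:] [:m:] = ev2 s y [:l:] [:m:])" for x y
    using ev2_eq_complexI[OF s] by blast
  show ?thesis
    using True by (auto simp: leibniz_conformal_def eq Let_def ev2_ext_bil[OF s s s br])
qed (auto simp: leibniz_conformal_def)

text \<open>Scalars come out of f and of g by the same factor, so in each argument the elements on
  which the two maps agree form a submodule.\<close>

lemma conf_bilinear_eq_on_span:
  assumes "conf_bil sU sW sA f" "conf_bil sU sW sA g"
    and G: "module.span sU G = UNIV" "module.span sW G' = UNIV"
    and eq: "\<And>u w. u \<in> G \<Longrightarrow> w \<in> G' \<Longrightarrow> f u w = g u w"
  shows "f = g"
proof (intro ext)
  fix u w
  interpret f: conf_bil sU sW sA f by fact
  interpret g: conf_bil sU sW sA g by fact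
  note evI = ev_eq_complexI[OF f.sA.module_axioms]
  have 1: "f u w = g u w" if "w \<in> G'" for u w
  proof (rule f.sU.span_induct[where S = G and P = "\<lambda>u. f u w = g u w"])
    show "f.sU.subspace {u. f u w = g u w}"
      by (rule f.sU.subspaceI)
        (auto simp: f.add_left g.add_left intro!: evI, simp add: f.scale_left g.scale_left)
  qed (use G eq that in auto)
  show "f u w = g u w"
  proof (rule f.sW.span_induct[where S = G' and P = "\<lambda>w. f u w = g u w"])
    show "f.sW.subspace {w. f u w = g u w}"
      by (rule f.sW.subspaceI)
        (auto simp: f.add_right g.add_right intro!: evI, simp add: f.scale_right g.scale_right)
  qed (use G 1 in auto)
qed

lemma pcompose_const_right: "q \<circ>\<^sub>p [:x:] = [:poly q x:]" for q :: "complex poly"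
  by (rule poly_ext) (simp add: poly_pcompose)

lemma pcompose_shift_shift:
  "p \<circ>\<^sub>p [:l, 1:] \<circ>\<^sub>p [:m, 1:] = p \<circ>\<^sub>p [:l + m, 1:]" for p :: "complex poly"
  by (rule poly_ext) (simp add: poly_pcompose add.commute add.left_commute)

text \<open>The defect J of the Leibniz identity is additive in each argument, and p(\<partial>)
  comes out of the three arguments as p(-l), p(-m) and p(\<partial>+l+m). Hence its zeros form a
  submodule in each argument separately.\<close>

lemma leibniz_conformal_on_span:
  assumes "conf_bil s s s br" and G: "module.span s G = UNIV"
    and "\<And>a b c l m. a \<in> G \<Longrightarrow> b \<in> G \<Longrightarrow> c \<in> G \<Longrightarrow>
      ev s (br a (ev s (br b c) [:m:])) [:l:] =
       ev s (br (ev s (br a b) [:l:]) c) [:l + m:] + ev s (br b (ev s (br a c) [:l:])) [:m:]"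
  shows "leibniz_conformal s br"
proof -
  interpret conf_bil s s s br by fact
  define J where "J a b c l m = ev s (br a (ev s (br b c) [:m:])) [:l:] -
    ev s (br (ev s (br a b) [:l:]) c) [:l + m:] - ev s (br b (ev s (br a c) [:l:])) [:m:]" for a b c l m
  have add: "J (a + a') b c l m = J a b c l m + J a' b c l m"
    "J a (b + b') c l m = J a b c l m + J a b' c l m"
    "J a b (c + c') l m = J a b c l m + J a b c' l m" for a a' b b' c c' l m
    by (simp_all add: J_def add_left add_right)
  \<comment> \<open>For the middle argument, p(\<partial>+l) leaves the inner bracket of the second
    term and is evaluated at -(l+m) by the outer one. This gives p(-m), as in the other two
    terms.\<close>
  have scale: "J (s p a) b c l m = s [:poly p (- l):] (J a b c l m)"
    "J a (s p b) c l m = s [:poly p (- m):] (J a b c l m)"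
    "J a b (s p c) l m = s (p \<circ>\<^sub>p [:l + m, 1:]) (J a b c l m)" for a b c p l m
    by (simp_all add: J_def scale_left scale_right pcompose_shift_shift pcompose_const_right sU.scale_right_diff_distrib
        poly_pcompose add.commute[of m l])
  have zero: "J 0 b c l m = 0" "J a 0 c l m = 0" "J a b 0 l m = 0" for a b c l m
    by (simp_all add: J_def)
  have base: "J a b c l m = 0" if "a \<in> G" "b \<in> G" "c \<in> G" for a b c l m
    unfolding J_def by (subst assms(3)[OF that]) simp
  have c: "J a b c l m = 0" if "a \<in> G" "b \<in> G" for a b c l m
  proof (rule sU.span_induct[where S = G and P = "\<lambda>c. J a b c l m = 0"])
    show "sU.subspace {c. J a b c l m = 0}"
      by (rule sU.subspaceI) (simp_all add: add scale zero)
  qed (use G base that in simp_all)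
  have b: "J a b c l m = 0" if "a \<in> G" for a b c l m
  proof (rule sU.span_induct[where S = G and P = "\<lambda>b. J a b c l m = 0"])
    show "sU.subspace {b. J a b c l m = 0}"
      by (rule sU.subspaceI) (simp_all add: add scale zero)
  qed (use G c that in simp_all)
  have "J a b c l m = 0" for a b c l m
  proof (rule sU.span_induct[where S = G and P = "\<lambda>a. J a b c l m = 0"])
    show "sU.subspace {a. J a b c l m = 0}"
      by (rule sU.subspaceI) (simp_all add: add scale zero)
  qed (use G b in simp_all)
  then show ?thesis
    unfolding leibniz_conformal_iff J_def diff_diff_eq eq_iff_diff_eq_0[symmetric]
    using sU.module_axioms conf_bilinear by blast
qed

lemma free_on_span:
  assumes "free_on s V" shows "module.span s V = UNIV"
proof -
  interpret module s using assms by (simp add: free_on_def)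
  have "r \<in> span V" for r
  proof -
    obtain p where "\<And>i. coeff p i \<in> V" and r: "r = (\<Sum>i\<le>degree p. s (monom 1 i) (coeff p i))"
      using assms unfolding free_on_def by blast
    then show ?thesis
      unfolding r by (intro span_sum span_scale span_base)
  qed
  then show ?thesis by auto
qed

section \<open>Polynomials over a direct sum of modules\<close>

lemma coeff_ppair: "coeff (ppair p q) n = (coeff p n, coeff q n)"
  by (simp add: ppair_def coeff_map_poly zero_prod_def)

lemma ppair_eq_iff [simp]: "ppair p q = ppair p' q' \<longleftrightarrow> p = p' \<and> q = q'"
  by (auto simp: poly_eq_iff coeff_ppair)

lemma ppair_fst_snd: "ppair (map_poly fst e) (map_poly snd e) = e"
  by (simp add: poly_eq_iff coeff_ppair coeff_map_poly)

lemma map_poly_fst_ppair [simp]: "map_poly fst (ppair p q) = p"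
  and map_poly_snd_ppair [simp]: "map_poly snd (ppair p q) = q"
  by (simp_all add: poly_eq_iff coeff_ppair coeff_map_poly)

context module_prod
begin

lemma ev_ppair [simp]: "ev scale (ppair p q) k = (ev s1 p k, ev s2 q k)"
  using ev_map_poly[OF module_hom_fst, of "ppair p q" k] ev_map_poly[OF module_hom_snd, of "ppair p q" k]
  by (simp add: prod_eq_iff)

lemma span_prod:
  assumes "m1.span G = UNIV" "m2.span G' = UNIV"
  shows "p.span (G \<times> {0} \<union> {0} \<times> G') = UNIV"
proof -
  have "(a, 0) \<in> p.span (G \<times> {0} \<union> {0} \<times> G')" for a
  proof (rule m1.span_induct[where S = G and P = "\<lambda>a. (a, 0) \<in> p.span (G \<times> {0} \<union> {0} \<times> G')"])
    let ?S = "p.span (G \<times> {0} \<union> {0} \<times> G')"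
    show "m1.subspace {a. (a, 0) \<in> ?S}"
    proof (rule m1.subspaceI)
      show "x + y \<in> {a. (a, 0) \<in> ?S}" if "x \<in> {a. (a, 0) \<in> ?S}" "y \<in> {a. (a, 0) \<in> ?S}" for x y
        using p.span_add[of "(x, 0)" _ "(y, 0)"] that by simp
      show "s1 c x \<in> {a. (a, 0) \<in> ?S}" if "x \<in> {a. (a, 0) \<in> ?S}" for c x
        using p.span_scale[of "(x, 0)" _ c] that by (simp add: scale_prod)
    qed (use p.span_zero[of "G \<times> {0} \<union> {0} \<times> G'"] in \<open>simp only: zero_prod_def mem_Collect_eq\<close>)
  qed (use assms in \<open>auto intro: p.span_base\<close>)
  moreover have "(0, b) \<in> p.span (G \<times> {0} \<union> {0} \<times> G')" for b
  proof (rule m2.span_induct[where S = G' and P = "\<lambda>a. (0, a) \<in> p.span (G \<times> {0} \<union> {0} \<times> G')"])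
    let ?S = "p.span (G \<times> {0} \<union> {0} \<times> G')"
    show "m2.subspace {a. (0, a) \<in> ?S}"
    proof (rule m2.subspaceI)
      show "x + y \<in> {a. (0, a) \<in> ?S}" if "x \<in> {a. (0, a) \<in> ?S}" "y \<in> {a. (0, a) \<in> ?S}" for x y
        using p.span_add[of "(0, x)" _ "(0, y)"] that by simp
      show "s2 c x \<in> {a. (0, a) \<in> ?S}" if "x \<in> {a. (0, a) \<in> ?S}" for c x
        using p.span_scale[of "(0, x)" _ c] that by (simp add: scale_prod)
    qed (use p.span_zero[of "G \<times> {0} \<union> {0} \<times> G'"] in \<open>simp only: zero_prod_def mem_Collect_eq\<close>)
  qed (use assms in \<open>auto intro: p.span_base\<close>)
  ultimately have "(a, 0) + (0, b) \<in> p.span (G \<times> {0} \<union> {0} \<times> G')" for a b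
    by (intro p.span_add)
  then have "x \<in> p.span (G \<times> {0} \<union> {0} \<times> G')" for x
    by (cases x) simp
  then show ?thesis by auto
qed

end

section \<open>Brackets given by flag data\<close>

text \<open>This is p(k) for p in \<complex>[\<partial>] and k in \<complex>[\<partial>][\<lambda>]:
  the indeterminate \<partial> of p is replaced, so the coefficients are embedded as
  constants.\<close>

definition lift :: "complex poly \<Rightarrow> complex poly poly \<Rightarrow> complex poly poly" where
  "lift p k = poly (map_poly (\<lambda>c. [:[:c:]:]) p) k"

lemma poly_lift [simp]: "poly (lift p k) x = p \<circ>\<^sub>p poly k x"
  by (induction p) (simp_all add: lift_def map_poly_pCons pcompose_pCons)

lemma pcompose_X [simp]: "q \<circ>\<^sub>p [:0, 1:] = q" for q :: "complex poly"
  by (rule poly_ext) (simp add: poly_pcompose)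

lemma pcompose_add_complex: "(p + q) \<circ>\<^sub>p r = p \<circ>\<^sub>p r + q \<circ>\<^sub>p r"
  and pcompose_mult_complex: "(p * q) \<circ>\<^sub>p r = p \<circ>\<^sub>p r * (q \<circ>\<^sub>p r)" for p q r :: "complex poly"
  by (rule poly_ext, simp add: poly_pcompose)+

text \<open>The formula forced by conformal bilinearity: p(\<partial>)x on the left contributes
  p(-\<lambda>) and q(\<partial>)x on the right q(\<partial>+\<lambda>). The Q-component k of the
  bracket of x with R is a free parameter, so that both kinds of flag data are treated
  together.\<close>

definition flag_bracket ::
  "(complex poly \<Rightarrow> 'r::ab_group_add \<Rightarrow> 'r) \<Rightarrow> ('r \<Rightarrow> 'r \<Rightarrow> 'r poly) \<Rightarrow> 'r flag_datum \<Rightarrow>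
     ('r \<Rightarrow> complex poly poly) \<Rightarrow> 'r \<times> complex poly \<Rightarrow> 'r \<times> complex poly \<Rightarrow> ('r \<times> complex poly) poly"
  where "flag_bracket s br F k = (\<lambda>(a, p) (b, q).
    ppair (br a b + act1 s (lift q (del1 + lam1)) (flag_D F a) + act1 s (lift p (- lam1)) (flag_T F b)
            + act1 s (lift p (- lam1) * lift q (del1 + lam1)) (flag_Q F))
      (lift q (del1 + lam1) * flag_h F a + lift p (- lam1) * k b
            + lift p (- lam1) * lift q (del1 + lam1) * flag_P F))"

locale leibniz_alg =
  fixes s :: "complex poly \<Rightarrow> 'r::ab_group_add \<Rightarrow> 'r"
    and br :: "'r \<Rightarrow> 'r \<Rightarrow> 'r poly"
  assumes leibniz: "leibniz_conformal s br"
begin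

sublocale module s
  using leibniz by (simp add: leibniz_conformal_iff)

sublocale br: conf_bil s s s br
  using leibniz by (intro conf_bil.intro conf_bil_axioms.intro) (auto simp: leibniz_conformal_iff)

sublocale Q: module "(*) :: complex poly \<Rightarrow> _"
  by (rule module_mult)

sublocale E: module_prod s "(*)"
  by standard

lemma scale_const_add: "s [:a + b:] x = s [:a:] x + s [:b:] x"
  by (simp flip: scale_left_distrib)

text \<open>Over the ring itself this rule is associativity to the left and would loop with \<open>ac_simps\<close>.\<close>
declare Q.scale_scale [simp del]

definition conf_flag :: "'r flag_datum \<Rightarrow> ('r \<Rightarrow> complex poly poly) \<Rightarrow> bool" where
  "conf_flag F k \<longleftrightarrow> left_conf_linear s (*) (flag_h F) \<and> left_conf_linear s s (flag_D F) \<and>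
     conf_linear s s (flag_T F) \<and> conf_linear s (*) k"

definition leibniz_at :: "('r \<times> complex poly \<Rightarrow> 'r \<times> complex poly \<Rightarrow> ('r \<times> complex poly) poly) \<Rightarrow>
    'r \<times> complex poly \<Rightarrow> 'r \<times> complex poly \<Rightarrow> 'r \<times> complex poly \<Rightarrow> bool" where
  "leibniz_at e a b c \<longleftrightarrow> (\<forall>l m. ev E.scale (e a (ev E.scale (e b c) [:m:])) [:l:] =
     ev E.scale (e (ev E.scale (e a b) [:l:]) c) [:l + m:] + ev E.scale (e b (ev E.scale (e a c) [:l:])) [:m:])"

definition gens :: "'r set \<Rightarrow> ('r \<times> complex poly) set" where
  "gens V = V \<times> {0} \<union> {0} \<times> {1}"

lemma span_gens:
  assumes "span V = UNIV"
  shows "E.p.span (gens V) = UNIV"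
proof -
  have "p \<in> Q.span {1}" for p
    using Q.span_scale[OF Q.span_base, of 1 "{1}" p] by simp
  then show ?thesis
    unfolding gens_def by (intro E.span_prod assms) auto
qed

lemma ev_flag_bracket:
  "ev E.scale (flag_bracket s br F k (a, p) (b, q)) [:l:] =
    (ev s (br a b) [:l:] + s (q \<circ>\<^sub>p [:l, 1:]) (ev s (flag_D F a) [:l:])
       + s [:poly p (- l):] (ev s (flag_T F b) [:l:])
       + s ([:poly p (- l):] * (q \<circ>\<^sub>p [:l, 1:])) (ev s (flag_Q F) [:l:]),
     q \<circ>\<^sub>p [:l, 1:] * poly (flag_h F a) [:l:] + [:poly p (- l):] * poly (k b) [:l:]
       + [:poly p (- l):] * (q \<circ>\<^sub>p [:l, 1:]) * poly (flag_P F) [:l:])"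
  by (simp add: flag_bracket_def del1_def lam1_def pcompose_const_right)

context
  fixes F k assumes conf: "conf_flag F k"
begin

lemma add_simps:
  "flag_h F (u + v) = flag_h F u + flag_h F v"
  "flag_D F (u + v) = flag_D F u + flag_D F v"
  "flag_T F (u + v) = flag_T F u + flag_T F v"
  "k (u + v) = k u + k v"
  using conf unfolding conf_flag_def
  by (simp_all add: left_conf_linear_iff conf_linear_iff module_axioms Q.module_axioms)

lemma zero_simps: "flag_h F 0 = 0" "flag_D F 0 = 0" "flag_T F 0 = 0" "k 0 = 0"
  using add_simps[of 0 0] by simp_all

lemma scale_simps:
  "poly (flag_h F (s p u)) [:l:] = [:poly p (- l):] * poly (flag_h F u) [:l:]"
  "ev s (flag_D F (s p u)) [:l:] = s [:poly p (- l):] (ev s (flag_D F u) [:l:])"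
  "ev s (flag_T F (s p u)) [:l:] = s (p \<circ>\<^sub>p [:l, 1:]) (ev s (flag_T F u) [:l:])"
  "poly (k (s p u)) [:l:] = (p \<circ>\<^sub>p [:l, 1:]) * poly (k u) [:l:]"
  using conf unfolding conf_flag_def
  by (simp_all add: left_conf_linear_iff conf_linear_iff module_axioms Q.module_axioms)

lemma conf_bil_flag_bracket: "conf_bil E.scale E.scale E.scale (flag_bracket s br F k)"
proof (intro conf_bil.intro conf_bil_axioms.intro E.p.module_axioms conf_bilinearI)
  show "flag_bracket s br F k (u + v) w = flag_bracket s br F k u w + flag_bracket s br F k v w" for u v w
    by (cases u; cases v; cases w) (rule ev_eq_complexI[OF E.p.module_axioms],
      simp add: ev_flag_bracket add_simps br.add_left pcompose_add_complex scale_const_add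
        smult_add_left algebra_simps)
  show "flag_bracket s br F k u (v + w) = flag_bracket s br F k u v + flag_bracket s br F k u w" for u v w
    by (cases u; cases v; cases w) (rule ev_eq_complexI[OF E.p.module_axioms],
      simp add: ev_flag_bracket add_simps br.add_right pcompose_add_complex scale_const_add
        smult_add_left algebra_simps)
  show "ev E.scale (flag_bracket s br F k (E.scale p u) w) [:l:] =
      E.scale [:poly p (- l):] (ev E.scale (flag_bracket s br F k u w) [:l:])" for p u w l
    by (cases u; cases w) (simp add: E.scale_prod ev_flag_bracket scale_simps br.scale_left
      pcompose_mult_complex algebra_simps)
  show "ev E.scale (flag_bracket s br F k u (E.scale p w)) [:l:] =
      E.scale (p \<circ>\<^sub>p [:l, 1:]) (ev E.scale (flag_bracket s br F k u w) [:l:])" for p u w l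
    by (cases u; cases w) (simp add: E.scale_prod ev_flag_bracket scale_simps br.scale_right
      pcompose_mult_complex algebra_simps)
qed

end

end

section \<open>The substitution of -\<lambda>-\<partial> for the index\<close>

lemma poly_poly_eval: "poly (poly p k) d = poly (poly p [:poly k d:]) d" for p :: "complex poly poly"
  by (induction p) auto

lemma poly_flip [simp]: "poly (poly (flip p) [:x:]) d = poly (poly p [:- x - d:]) d"
  by (simp add: flip_def poly_pcompose lam1_def del1_def, subst poly_poly_eval) simp

text \<open>The substitution is an involution, as -(-\<lambda>-\<partial>)-\<partial> = \<lambda>;
  so h and k = -flip h determine each other.\<close>

lemma flip_flip [simp]: "flip (flip p) = p"
proof (rule ev_eq_complexI[OF module_mult], rule poly_ext)
  show "poly (ev (*) (flip (flip p)) [:l:]) x = poly (ev (*) p [:l:]) x" for l x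
    by simp
qed

lemma flip_0 [simp]: "flip 0 = 0"
  by (simp add: flip_def)

text \<open>Shifting \<partial> to \<partial>+l turns the index -m-\<partial> into -l-m-\<partial>.
  This is the origin of the terms \<open>h (- lam - mu - del) b (lam + del)\<close> in the flag data
  of the second kind.\<close>

lemma flip_shift: "poly (flip p) [:m:] \<circ>\<^sub>p [:l, 1:] = sub2 p [:- l - m, - 1:] [:l, 1:]"
proof (rule poly_ext)
  fix x
  have "- m - (l + x) = - l - m - x" by simp
  then have "poly (poly p [:- m - (l + x):]) (l + x) = poly (poly p [:- l - m - x:]) (l + x)"
    by (simp only:)
  then show "poly (poly (flip p) [:m:] \<circ>\<^sub>p [:l, 1:]) x = poly (sub2 p [:- l - m, - 1:] [:l, 1:]) x"
    by (simp add: poly_pcompose hev_def)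
qed

lemma pcompose_1_complex [simp]: "1 \<circ>\<^sub>p q = (1 :: complex poly)"
  by (rule poly_ext) (simp add: poly_pcompose)

lemma flip_sub2: "sub2 p [:- m, - 1:] [:0, 1:] = poly (flip p) [:m:]"
  by (rule poly_ext) (simp add: hev_def)

section \<open>The Leibniz identities of a flag bracket\<close>

context leibniz_alg
begin

text \<open>The identities for (a, b, c) and (b, a, c) contain the same two right-nested terms on
  opposite sides. Adding them leaves only the condition that the brackets of a with b and of b with
  a add up to something annihilating c from the left.\<close>

lemma leib_swap:
  assumes "conf_bil E.scale E.scale E.scale e" "leibniz_at e a b c"
  shows "leibniz_at e b a c \<longleftrightarrow> (\<forall>l m. ev E.scale (e (ev E.scale (e a b) [:l:]) c) [:l + m:]
     + ev E.scale (e (ev E.scale (e b a) [:m:]) c) [:l + m:] = 0)"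
proof -
  have iff: "u = C + y \<longleftrightarrow> A + C = 0" if "y = A + u" for u y A C :: "'r \<times> complex poly"
    unfolding that using add_right_cancel[of u 0 "A + C"] by (auto simp: ac_simps)
  \<comment> \<open>Exchanging the names l and m gives a and b the same indices as in the identity
    for (a, b, c).\<close>
  have "leibniz_at e b a c \<longleftrightarrow> (\<forall>l m. ev E.scale (e b (ev E.scale (e a c) [:l:])) [:m:] =
      ev E.scale (e (ev E.scale (e b a) [:m:]) c) [:l + m:] + ev E.scale (e a (ev E.scale (e b c) [:m:])) [:l:])"
    unfolding leibniz_at_def by (subst all_comm) (simp only: add.commute)
  also have "\<dots> \<longleftrightarrow> (\<forall>l m. ev E.scale (e (ev E.scale (e a b) [:l:]) c) [:l + m:]
     + ev E.scale (e (ev E.scale (e b a) [:m:]) c) [:l + m:] = 0)"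
    using assms(2) unfolding leibniz_at_def by (intro all_cong1 iff) blast
  finally show ?thesis .
qed

lemma leib_R:
  assumes "\<And>a b. e (a, 0) (b, 0) = ppair (br a b) 0"
  shows "leibniz_at e (a, 0) (b, 0) (c, 0)"
proof -
  have "leibniz_at e (a, 0) (b, 0) (c, 0) \<longleftrightarrow> (\<forall>l m. ev s (br a (ev s (br b c) [:m:])) [:l:] =
      ev s (br (ev s (br a b) [:l:]) c) [:l + m:] + ev s (br b (ev s (br a c) [:l:])) [:m:])"
    by (simp add: leibniz_at_def assms)
  then show ?thesis
    using leibniz unfolding leibniz_conformal_iff by blast
qed

abbreviation "bra l a b \<equiv> ev s (br a b) [:l:]"
abbreviation "evD F l a \<equiv> ev s (flag_D F a) [:l:]"
abbreviation "evT F l a \<equiv> ev s (flag_T F a) [:l:]"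
abbreviation "evQ F l \<equiv> ev s (flag_Q F) [:l:]"
abbreviation "evh F l a \<equiv> poly (flag_h F a) [:l:]"
abbreviation "evP F l \<equiv> poly (flag_P F) [:l:]"
abbreviation "evk k l a \<equiv> poly (k a) [:l:]"

text \<open>
  The Leibniz identities of the flag bracket on generators, evaluated at \<open>\<lambda> = l\<close>, \<open>\<mu> = m\<close> and split
  into components: triples with two, one and no entries from \<open>R\<close>. For the triples \<open>(x, a, _)\<close> the
  identity is replaced by its sum with that of \<open>(a, x, _)\<close>, in which only the left annihilator
  condition remains.
\<close>

definition pair_ids where "pair_ids F k a b \<longleftrightarrow> (\<forall>l m.
  bra l a (evD F m b) + s (evh F m b \<circ>\<^sub>p [:l, 1:]) (evD F l a) =
    evD F (l + m) (bra l a b) + bra m b (evD F l a) + s (evh F l a \<circ>\<^sub>p [:m, 1:]) (evD F m b) \<and>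
  evh F m b \<circ>\<^sub>p [:l, 1:] * evh F l a =
    evh F (l + m) (bra l a b) + evh F l a \<circ>\<^sub>p [:m, 1:] * evh F m b \<and>
  bra l a (evT F m b) + s (evk k m b \<circ>\<^sub>p [:l, 1:]) (evD F l a) =
    bra (l + m) (evD F l a) b + s [:poly (evh F l a) (- l - m):] (evT F (l + m) b) + evT F m (bra l a b) \<and>
  evk k m b \<circ>\<^sub>p [:l, 1:] * evh F l a =
    smult (poly (evh F l a) (- l - m)) (evk k (l + m) b) + evk k m (bra l a b) \<and>
  bra (l + m) (evD F l a) b + s [:poly (evh F l a) (- l - m):] (evT F (l + m) b)
    + bra (l + m) (evT F m a) b + s [:poly (evk k m a) (- l - m):] (evT F (l + m) b) = 0 \<and>
  smult (poly (evh F l a) (- l - m)) (evk k (l + m) b)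
    + smult (poly (evk k m a) (- l - m)) (evk k (l + m) b) = 0)"

definition single_ids where "single_ids F k a \<longleftrightarrow> (\<forall>l m.
  bra l a (evQ F m) + s (evP F m \<circ>\<^sub>p [:l, 1:]) (evD F l a) =
    evD F (l + m) (evD F l a) + s [:poly (evh F l a) (- l - m):] (evQ F (l + m))
    + evT F m (evD F l a) + s (evh F l a \<circ>\<^sub>p [:m, 1:]) (evQ F m) \<and>
  evP F m \<circ>\<^sub>p [:l, 1:] * evh F l a =
    evh F (l + m) (evD F l a) + smult (poly (evh F l a) (- l - m)) (evP F (l + m))
    + evk k m (evD F l a) + evh F l a \<circ>\<^sub>p [:m, 1:] * evP F m \<and>
  evD F (l + m) (evD F l a) + s [:poly (evh F l a) (- l - m):] (evQ F (l + m))
    + evD F (l + m) (evT F m a) + s [:poly (evk k m a) (- l - m):] (evQ F (l + m)) = 0 \<and>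
  evh F (l + m) (evD F l a) + smult (poly (evh F l a) (- l - m)) (evP F (l + m))
    + evh F (l + m) (evT F m a) + smult (poly (evk k m a) (- l - m)) (evP F (l + m)) = 0 \<and>
  evT F l (evT F m a) + s (evk k m a \<circ>\<^sub>p [:l, 1:]) (evQ F l) =
    bra (l + m) (evQ F l) a + s [:poly (evP F l) (- l - m):] (evT F (l + m) a)
    + evT F m (evT F l a) + s (evk k l a \<circ>\<^sub>p [:m, 1:]) (evQ F m) \<and>
  evk k l (evT F m a) + evk k m a \<circ>\<^sub>p [:l, 1:] * evP F l =
    smult (poly (evP F l) (- l - m)) (evk k (l + m) a) + evk k m (evT F l a)
    + evk k l a \<circ>\<^sub>p [:m, 1:] * evP F m)"

definition gen_ids where "gen_ids F k \<longleftrightarrow> (\<forall>l m.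
  evT F l (evQ F m) + s (evP F m \<circ>\<^sub>p [:l, 1:]) (evQ F l) =
    evD F (l + m) (evQ F l) + s [:poly (evP F l) (- l - m):] (evQ F (l + m))
    + evT F m (evQ F l) + s (evP F l \<circ>\<^sub>p [:m, 1:]) (evQ F m) \<and>
  evk k l (evQ F m) + evP F m \<circ>\<^sub>p [:l, 1:] * evP F l =
    evh F (l + m) (evQ F l) + smult (poly (evP F l) (- l - m)) (evP F (l + m))
    + evk k m (evQ F l) + evP F l \<circ>\<^sub>p [:m, 1:] * evP F m)"

definition flag_ids where
  "flag_ids V F k \<longleftrightarrow> (\<forall>a\<in>V. \<forall>b\<in>V. pair_ids F k a b) \<and> (\<forall>a\<in>V. single_ids F k a) \<and> gen_ids F k"

context
  fixes F k assumes conf: "conf_flag F k"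
begin

interpretation fb: conf_bil E.scale E.scale E.scale "flag_bracket s br F k"
  by (rule conf_bil_flag_bracket[OF conf])

lemmas fb_eval = leibniz_at_def ev_flag_bracket zero_simps[OF conf] fb.add_left fb.add_right
  pcompose_const_right zero_prod_def one_pCons [symmetric]

lemma flag_bracket_R: "flag_bracket s br F k (a, 0) (b, 0) = ppair (br a b) 0"
  by (rule ev_eq_complexI[OF E.p.module_axioms]) (simp add: ev_flag_bracket)

lemma pair_ids_iff: "pair_ids F k a b \<longleftrightarrow> leibniz_at (flag_bracket s br F k) (a, 0) (b, 0) (0, 1) \<and>
    leibniz_at (flag_bracket s br F k) (a, 0) (0, 1) (b, 0) \<and> leibniz_at (flag_bracket s br F k) (0, 1) (a, 0) (b, 0)"
proof -
  have 1: "leibniz_at (flag_bracket s br F k) (a, 0) (b, 0) (0, 1) \<longleftrightarrow> (\<forall>l m.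
    bra l a (evD F m b) + s (evh F m b \<circ>\<^sub>p [:l, 1:]) (evD F l a) =
      evD F (l + m) (bra l a b) + bra m b (evD F l a) + s (evh F l a \<circ>\<^sub>p [:m, 1:]) (evD F m b) \<and>
    evh F m b \<circ>\<^sub>p [:l, 1:] * evh F l a =
      evh F (l + m) (bra l a b) + evh F l a \<circ>\<^sub>p [:m, 1:] * evh F m b)"
    by (simp add: fb_eval add.assoc)
  have 2: "leibniz_at (flag_bracket s br F k) (a, 0) (0, 1) (b, 0) \<longleftrightarrow> (\<forall>l m.
    bra l a (evT F m b) + s (evk k m b \<circ>\<^sub>p [:l, 1:]) (evD F l a) =
      bra (l + m) (evD F l a) b + s [:poly (evh F l a) (- l - m):] (evT F (l + m) b) + evT F m (bra l a b) \<and>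
    evk k m b \<circ>\<^sub>p [:l, 1:] * evh F l a =
      smult (poly (evh F l a) (- l - m)) (evk k (l + m) b) + evk k m (bra l a b))"
    by (simp add: fb_eval add.assoc)
  \<comment> \<open>The identity for (x, a, b) reduces to the annihilator condition only in the
    presence of the one for (a, x, b), hence the premise.\<close>
  have 3: "leibniz_at (flag_bracket s br F k) (0, 1) (a, 0) (b, 0) \<longleftrightarrow> (\<forall>l m.
    bra (l + m) (evD F l a) b + s [:poly (evh F l a) (- l - m):] (evT F (l + m) b)
      + bra (l + m) (evT F m a) b + s [:poly (evk k m a) (- l - m):] (evT F (l + m) b) = 0 \<and>
    smult (poly (evh F l a) (- l - m)) (evk k (l + m) b)
      + smult (poly (evk k m a) (- l - m)) (evk k (l + m) b) = 0)"
    if "leibniz_at (flag_bracket s br F k) (a, 0) (0, 1) (b, 0)"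
    unfolding leib_swap[OF fb.conf_bil_axioms that] by (simp add: fb_eval add.assoc)
  show ?thesis
    using 1 2 3 unfolding pair_ids_def by blast
qed

lemma single_ids_iff: "single_ids F k a \<longleftrightarrow> leibniz_at (flag_bracket s br F k) (a, 0) (0, 1) (0, 1) \<and>
    leibniz_at (flag_bracket s br F k) (0, 1) (a, 0) (0, 1) \<and> leibniz_at (flag_bracket s br F k) (0, 1) (0, 1) (a, 0)"
proof -
  have 1: "leibniz_at (flag_bracket s br F k) (a, 0) (0, 1) (0, 1) \<longleftrightarrow> (\<forall>l m.
    bra l a (evQ F m) + s (evP F m \<circ>\<^sub>p [:l, 1:]) (evD F l a) =
      evD F (l + m) (evD F l a) + s [:poly (evh F l a) (- l - m):] (evQ F (l + m))
      + evT F m (evD F l a) + s (evh F l a \<circ>\<^sub>p [:m, 1:]) (evQ F m) \<and>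
    evP F m \<circ>\<^sub>p [:l, 1:] * evh F l a =
      evh F (l + m) (evD F l a) + smult (poly (evh F l a) (- l - m)) (evP F (l + m))
      + evk k m (evD F l a) + evh F l a \<circ>\<^sub>p [:m, 1:] * evP F m)"
    by (simp add: fb_eval ac_simps)
  have 2: "leibniz_at (flag_bracket s br F k) (0, 1) (a, 0) (0, 1) \<longleftrightarrow> (\<forall>l m.
    evD F (l + m) (evD F l a) + s [:poly (evh F l a) (- l - m):] (evQ F (l + m))
      + evD F (l + m) (evT F m a) + s [:poly (evk k m a) (- l - m):] (evQ F (l + m)) = 0 \<and>
    evh F (l + m) (evD F l a) + smult (poly (evh F l a) (- l - m)) (evP F (l + m))
      + evh F (l + m) (evT F m a) + smult (poly (evk k m a) (- l - m)) (evP F (l + m)) = 0)"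
    if "leibniz_at (flag_bracket s br F k) (a, 0) (0, 1) (0, 1)"
    unfolding leib_swap[OF fb.conf_bil_axioms that] by (simp add: fb_eval add.assoc)
  have 3: "leibniz_at (flag_bracket s br F k) (0, 1) (0, 1) (a, 0) \<longleftrightarrow> (\<forall>l m.
    evT F l (evT F m a) + s (evk k m a \<circ>\<^sub>p [:l, 1:]) (evQ F l) =
      bra (l + m) (evQ F l) a + s [:poly (evP F l) (- l - m):] (evT F (l + m) a)
      + evT F m (evT F l a) + s (evk k l a \<circ>\<^sub>p [:m, 1:]) (evQ F m) \<and>
    evk k l (evT F m a) + evk k m a \<circ>\<^sub>p [:l, 1:] * evP F l =
      smult (poly (evP F l) (- l - m)) (evk k (l + m) a) + evk k m (evT F l a)
      + evk k l a \<circ>\<^sub>p [:m, 1:] * evP F m)"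
    by (simp add: fb_eval ac_simps)
  show ?thesis
    using 1 2 3 unfolding single_ids_def by blast
qed

lemma gen_ids_iff: "gen_ids F k \<longleftrightarrow> leibniz_at (flag_bracket s br F k) (0, 1) (0, 1) (0, 1)"
  unfolding gen_ids_def by (simp add: fb_eval ac_simps)

text \<open>Of the eight types of triples of generators, the one inside R holds by the Leibniz
  identity of R. The other seven are recorded by \<open>flag_ids\<close>: three with two entries
  from R, three with one, and (x, x, x).\<close>

lemma leibniz_flag_bracket_iff:
  assumes V: "span V = UNIV"
  shows "leibniz_conformal E.scale (flag_bracket s br F k) \<longleftrightarrow> flag_ids V F k"
proof
  assume "leibniz_conformal E.scale (flag_bracket s br F k)"
  then have "leibniz_at (flag_bracket s br F k) a b c" for a b c
    unfolding leibniz_at_def leibniz_conformal_iff by blast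
  then show "flag_ids V F k"
    unfolding flag_ids_def gen_ids_iff single_ids_iff pair_ids_iff by blast
next
  assume *: "flag_ids V F k"
  have "leibniz_at (flag_bracket s br F k) a b c" if "a \<in> gens V" "b \<in> gens V" "c \<in> gens V" for a b c
    using that * leib_R[OF flag_bracket_R]
    unfolding flag_ids_def gen_ids_iff single_ids_iff pair_ids_iff gens_def by auto
  then show "leibniz_conformal E.scale (flag_bracket s br F k)"
    by (intro leibniz_conformal_on_span[OF fb.conf_bil_axioms span_gens[OF V]])
      (unfold leibniz_at_def, blast)
qed

end

end

section \<open>The flag data conditions\<close>

context leibniz_alg
begin

definition conf_flag0 :: "'r flag_datum \<Rightarrow> bool" where
  "conf_flag0 F \<longleftrightarrow> left_conf_linear s (*) (flag_h F) \<and> left_conf_linear s s (flag_D F) \<and>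
     conf_linear s s (flag_T F)"

lemma eq_ev2: "x = y \<longleftrightarrow> (\<forall>l m. ev2 s x [:l:] [:m:] = ev2 s y [:l:] [:m:])"
  using ev2_eq_complexI[OF module_axioms] by blast

lemma eq_kev: "p = q \<longleftrightarrow> (\<forall>l m. kev p l m = kev q l m)"
  using kev_eqI by blast

interpretation tf: torsion_free_module s
  by (rule torsion_free_complex_poly) (rule module_axioms)

lemma ev2_act_kev:
  "ev2 s (poly_act (poly_act s) k n) [:l:] [:m:] = s (kev k l m) (ev2 s n [:l:] [:m:])"
  by (simp add: kev_def)

lemma kev_ext_fun_h:
  assumes "conf_flag0 F"
  shows "kev (ext_fun (flag_h F) k m l) x y =
    sub2 (flag_h F (ev2 s m [:x:] [:y:])) (kev k x y) (kev l x y)"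
  using assms module_axioms Q.module_axioms
  by (intro kev_ext_fun ev_linear.intro ev_linear_axioms.intro)
    (auto simp: conf_flag0_def left_conf_linear_def)

lemma ev2_ext_map_D:
  assumes "conf_flag0 F"
  shows "ev2 s (ext_map s (flag_D F) k m) [:x:] [:y:] =
    ev s (flag_D F (ev2 s m [:x:] [:y:])) (kev k x y)"
  using assms module_axioms
  by (intro ev_linear.ev2_ext_map ev_linear.intro ev_linear_axioms.intro)
    (auto simp: conf_flag0_def left_conf_linear_def)

lemma ev2_ext_map_T:
  assumes "conf_flag0 F"
  shows "ev2 s (ext_map s (flag_T F) k m) [:x:] [:y:] =
    ev s (flag_T F (ev2 s m [:x:] [:y:])) (kev k x y)"
  using assms module_axioms
  by (intro ev_linear.ev2_ext_map ev_linear.intro ev_linear_axioms.intro)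
    (auto simp: conf_flag0_def conf_linear_def)

lemmas flag_eval = kev_ext_fun_h ev2_ext_map_D ev2_ext_map_T ev2_act_kev
  ev2_ext_bil[OF module_axioms module_axioms module_axioms br.conf_bilinear]
  ev2_subst[OF module_axioms] kev_subst2 sub2_const pcompose_const_right

text \<open>In the evaluated conditions the second slots \<lambda>+\<partial> and \<mu>+\<partial>
  become compositions with \<open>[:l, 1:]\<close> and \<open>[:m, 1:]\<close>, and the slot
  -\<lambda>-\<mu> becomes evaluation of \<partial> at -l-m.\<close>

lemma flag_common_iff:
  "flag_common s br V F \<longleftrightarrow> conf_flag0 F \<and>
    (\<forall>a\<in>V. \<forall>b\<in>V. \<forall>l m.
      evh F (l + m) (bra l a b) =
        evh F m b \<circ>\<^sub>p [:l, 1:] * evh F l a - evh F l a \<circ>\<^sub>p [:m, 1:] * evh F m b \<and>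
      evD F (l + m) (bra l a b) = bra l a (evD F m b) + s (evh F m b \<circ>\<^sub>p [:l, 1:]) (evD F l a)
        - bra m b (evD F l a) - s (evh F l a \<circ>\<^sub>p [:m, 1:]) (evD F m b)) \<and>
    (\<forall>a\<in>V. \<forall>l m.
      s (evP F m \<circ>\<^sub>p [:l, 1:]) (evD F l a) =
        evD F (l + m) (evD F l a) + s [:poly (evh F l a) (- l - m):] (evQ F (l + m))
        + evT F m (evD F l a) + s (evh F l a \<circ>\<^sub>p [:m, 1:]) (evQ F m) - bra l a (evQ F m)) \<and>
    (\<forall>l m. evT F l (evQ F m) =
      evD F (l + m) (evQ F l) + s [:poly (evP F l) (- l - m):] (evQ F (l + m))
      + evT F m (evQ F l) + s (evP F l \<circ>\<^sub>p [:m, 1:]) (evQ F m) - s (evP F m \<circ>\<^sub>p [:l, 1:]) (evQ F l))"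
proof (cases "conf_flag0 F")
  case True
  then have "left_conf_linear s (*) (flag_h F)" "left_conf_linear s s (flag_D F)" "conf_linear s s (flag_T F)"
    by (simp_all add: conf_flag0_def)
  with True show ?thesis
    unfolding flag_common_def Let_def
    by (simp add: flag_eval eq_ev2 eq_kev ball_conj_distrib all_conj_distrib del: tf.ev2_act)
qed (auto simp: flag_common_def conf_flag0_def)


lemma flip_sub2': "sub2 p [:- l - m, - 1:] [:0, 1:] = poly (flip p) [:l + m:]"
  using flip_sub2[of p "l + m"] by simp

text \<open>The remaining conditions of the first kind at \<lambda> = l and \<mu> = m are split by
  the number of elements of V they involve: two here, one in \<open>flag1_eqs1\<close>, none in
  \<open>flag1_eqs0\<close>.\<close>

definition flag1_eqs where "flag1_eqs F a b l m \<longleftrightarrow>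
  evT F m (bra l a b) = bra l a (evT F m b) - bra (l + m) (evD F l a) b
    - s [:poly (evh F l a) (- l - m):] (evT F (l + m) b) \<and>
  evT F m (bra l a b) = bra l a (evT F m b) + bra (l + m) (evT F m a) b"

definition flag1_eqs1 where "flag1_eqs1 F a l m \<longleftrightarrow>
  evP F m \<circ>\<^sub>p [:l, 1:] * evh F l a = smult (poly (evh F l a) (- l - m)) (evP F (l + m))
    + evh F l a \<circ>\<^sub>p [:m, 1:] * evP F m + evh F (l + m) (evD F l a) \<and>
  evD F (l + m) (evT F m a) + evD F (l + m) (evD F l a)
    + s [:poly (evh F l a) (- l - m):] (evQ F (l + m)) = 0 \<and>
  smult (poly (evh F l a) (- l - m)) (evP F (l + m)) + evh F (l + m) (evD F l a)
    + evh F (l + m) (evT F m a) = 0 \<and>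
  s [:poly (evP F l) (- l - m):] (evT F (l + m) a) =
    evT F l (evT F m a) - bra (l + m) (evQ F l) a - evT F m (evT F l a)"

definition flag1_eqs0 where "flag1_eqs0 F l m \<longleftrightarrow>
  evh F (l + m) (evQ F l) + smult (poly (evP F l) (- l - m)) (evP F (l + m))
    + evP F l \<circ>\<^sub>p [:m, 1:] * evP F m - evP F m \<circ>\<^sub>p [:l, 1:] * evP F l = 0"

lemma flag1_iff:
  "F \<in> flag1 s br V \<longleftrightarrow> flag_common s br V F \<and>
    (\<forall>a\<in>V. \<forall>b\<in>V. \<forall>l m. flag1_eqs F a b l m) \<and>
    (\<forall>a\<in>V. \<forall>l m. flag1_eqs1 F a l m) \<and> (\<forall>l m. flag1_eqs0 F l m)"
proof (cases "conf_flag0 F")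
  case True
  then show ?thesis
    unfolding flag1_def Let_def flag1_eqs_def flag1_eqs1_def flag1_eqs0_def
    by (simp add: flag_eval eq_ev2 eq_kev ball_conj_distrib all_conj_distrib del: tf.ev2_act)
qed (auto simp: flag_common_iff flag1_def)

text \<open>The index -\<lambda>-\<mu>-\<partial> becomes \<open>[:- l - m, - 1:]\<close>. It still
  contains \<partial>, so a substitution in both slots of h remains; where the second slot is
  \<partial>, it is a \<open>flip\<close>.\<close>

definition flag2_eqs where "flag2_eqs F a b l m \<longleftrightarrow>
  evT F m (bra l a b) = bra l a (evT F m b) - s (sub2 (flag_h F b) [:- l - m, - 1:] [:l, 1:]) (evD F l a)
    - bra (l + m) (evD F l a) b - s [:poly (evh F l a) (- l - m):] (evT F (l + m) b) \<and>
  bra (l + m) (evT F m a) b + bra (l + m) (evD F l a) b = 0"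

definition flag2_eqs1 where "flag2_eqs1 F a l m \<longleftrightarrow>
  evP F m \<circ>\<^sub>p [:l, 1:] * evh F l a = smult (poly (evh F l a) (- l - m)) (evP F (l + m))
    - poly (flip (flag_h F (evD F l a))) [:m:]
    + evh F l a \<circ>\<^sub>p [:m, 1:] * evP F m + evh F (l + m) (evD F l a) \<and>
  evD F (l + m) (evT F m a) + evD F (l + m) (evD F l a) = 0 \<and>
  evh F (l + m) (evD F l a) + evh F (l + m) (evT F m a) = 0 \<and>
  s [:poly (evP F l) (- l - m):] (evT F (l + m) a) =
    evT F l (evT F m a) - s (sub2 (flag_h F a) [:- l - m, - 1:] [:l, 1:]) (evQ F l)
    - bra (l + m) (evQ F l) a - evT F m (evT F l a)
    + s (sub2 (flag_h F a) [:- l - m, - 1:] [:m, 1:]) (evQ F m) \<and>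
  smult (poly (evP F l) (- l - m)) (poly (flip (flag_h F a)) [:l + m:]) =
    poly (flip (flag_h F (evT F m a))) [:l:] + sub2 (flag_h F a) [:- l - m, - 1:] [:l, 1:] * evP F l
    - poly (flip (flag_h F (evT F l a))) [:m:] - sub2 (flag_h F a) [:- l - m, - 1:] [:m, 1:] * evP F m"

definition flag2_eqs0 where "flag2_eqs0 F l m \<longleftrightarrow>
  - poly (flip (flag_h F (evQ F m))) [:l:] =
    evh F (l + m) (evQ F l) - poly (flip (flag_h F (evQ F l))) [:m:]
    + smult (poly (evP F l) (- l - m)) (evP F (l + m))
    + evP F l \<circ>\<^sub>p [:m, 1:] * evP F m - evP F m \<circ>\<^sub>p [:l, 1:] * evP F l"

lemma flag2_iff:
  "F \<in> flag2 s br V \<longleftrightarrow> flag_h F \<noteq> (\<lambda>_. 0) \<and> flag_common s br V F \<and>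
    (\<forall>a\<in>V. \<forall>b\<in>V. \<forall>l m. flag2_eqs F a b l m) \<and>
    (\<forall>a\<in>V. \<forall>l m. flag2_eqs1 F a l m) \<and> (\<forall>l m. flag2_eqs0 F l m)"
proof (cases "conf_flag0 F")
  case True
  then show ?thesis
    unfolding flag2_def Let_def flag2_eqs_def flag2_eqs1_def flag2_eqs0_def
    by (simp add: flag_eval flip_sub2 flip_sub2' eq_ev2 eq_kev ball_conj_distrib all_conj_distrib del: tf.ev2_act)
qed (auto simp: flag_common_iff flag2_def)

lemma conf_flag_zero: "conf_flag F (\<lambda>_. 0) \<longleftrightarrow> conf_flag0 F"
  by (simp add: conf_flag_def conf_flag0_def conf_linear_iff module_axioms Q.module_axioms)

text \<open>For k = 0 the Leibniz identities on generators become the flag conditions after moving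
  terms across. The second condition on T arises from the first together with the annihilator
  condition for (a, x, b).\<close>

lemma flag1_iff_ids: "F \<in> flag1 s br V \<longleftrightarrow> conf_flag F (\<lambda>_. 0) \<and> flag_ids V F (\<lambda>_. 0)"
proof -
  have 2: "pair_ids F (\<lambda>_. 0) a b \<longleftrightarrow> (\<forall>l m. flag1_eqs F a b l m \<and>
     evh F (l + m) (bra l a b) =
        evh F m b \<circ>\<^sub>p [:l, 1:] * evh F l a - evh F l a \<circ>\<^sub>p [:m, 1:] * evh F m b \<and>
      evD F (l + m) (bra l a b) = bra l a (evD F m b) + s (evh F m b \<circ>\<^sub>p [:l, 1:]) (evD F l a)
        - bra m b (evD F l a) - s (evh F l a \<circ>\<^sub>p [:m, 1:]) (evD F m b))" for a b
    unfolding pair_ids_def flag1_eqs_def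
    by (intro all_cong1 iffI; elim conjE; intro conjI; simp add: algebra_simps)
  have 1: "single_ids F (\<lambda>_. 0) a \<longleftrightarrow> (\<forall>l m. flag1_eqs1 F a l m \<and>
      s (evP F m \<circ>\<^sub>p [:l, 1:]) (evD F l a) =
        evD F (l + m) (evD F l a) + s [:poly (evh F l a) (- l - m):] (evQ F (l + m))
        + evT F m (evD F l a) + s (evh F l a \<circ>\<^sub>p [:m, 1:]) (evQ F m) - bra l a (evQ F m))" for a
    unfolding single_ids_def flag1_eqs1_def
    by (intro all_cong1) (auto simp: algebra_simps)
  have 0: "gen_ids F (\<lambda>_. 0) \<longleftrightarrow> (\<forall>l m. flag1_eqs0 F l m \<and> evT F l (evQ F m) =
      evD F (l + m) (evQ F l) + s [:poly (evP F l) (- l - m):] (evQ F (l + m))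
      + evT F m (evQ F l) + s (evP F l \<circ>\<^sub>p [:m, 1:]) (evQ F m) - s (evP F m \<circ>\<^sub>p [:l, 1:]) (evQ F l))"
    unfolding gen_ids_def flag1_eqs0_def
    by (intro all_cong1) (auto simp: algebra_simps)
  show ?thesis
    unfolding flag1_iff flag_common_iff conf_flag_zero flag_ids_def 0 1 2 by blast
qed

lemma scale_const_minus: "s [:- c:] x = - s [:c:] x"
  by (simp flip: scale_minus_left)

text \<open>Under \<lambda> \<mapsto> -\<lambda>-\<partial> the factor -\<lambda> of a left
  conformal linear map becomes \<lambda>+\<partial>, the factor of a conformal linear one.\<close>

lemma conf_flag_flip: "conf_flag F (\<lambda>a. - flip (flag_h F a)) \<longleftrightarrow> conf_flag0 F"
proof -
  have "conf_linear s (*) (\<lambda>a. - flip (flag_h F a))" if "left_conf_linear s (*) (flag_h F)"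
  proof -
    have add: "flag_h F (u + v) = flag_h F u + flag_h F v"
      and scale: "poly (flag_h F (s p u)) [:l:] = [:poly p (- l):] * poly (flag_h F u) [:l:]" for u v p l
      using that by (simp_all add: left_conf_linear_iff module_axioms Q.module_axioms)
    have "poly (- flip (flag_h F (s p u))) [:l:] = (p \<circ>\<^sub>p [:l, 1:]) * poly (- flip (flag_h F u)) [:l:]" for p u l
      by (rule poly_ext) (simp add: scale poly_pcompose add.commute)
    then show ?thesis
      by (simp add: conf_linear_iff module_axioms Q.module_axioms add flip_def pcompose_add)
  qed
  then show ?thesis by (auto simp: conf_flag_def conf_flag0_def)
qed

text \<open>For k = -flip h the scalars h_l(a,-l-m) and k_m(a,-l-m) cancel, since -m-(-l-m) = l.
  Their terms therefore disappear from the annihilator conditions.\<close>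

lemma flag2_iff_ids: "F \<in> flag2 s br V \<longleftrightarrow> flag_h F \<noteq> (\<lambda>_. 0) \<and>
  conf_flag F (\<lambda>a. - flip (flag_h F a)) \<and> flag_ids V F (\<lambda>a. - flip (flag_h F a))"
proof -
  let ?k = "\<lambda>a. - flip (flag_h F a)"
  \<comment> \<open>The Q-component of the identity for (a, x, b) is not listed among the flag
    conditions. It is condition (i) with -l-m-d for \<mu>, read at \<partial> = d.\<close>
  have axb: "evk ?k m b \<circ>\<^sub>p [:l, 1:] * evh F l a =
      smult (poly (evh F l a) (- l - m)) (evk ?k (l + m) b) + evk ?k m (bra l a b)"
    if "\<And>l m. evh F (l + m) (bra l a b) =
      evh F m b \<circ>\<^sub>p [:l, 1:] * evh F l a - evh F l a \<circ>\<^sub>p [:m, 1:] * evh F m b" for a b l m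
  proof (rule poly_ext)
    fix d
    have e: "- m - (l + d) = - l - m - d" "l + (- l - m - d) = - m - d" "- l - m - d + d = - l - m"
      by simp_all
    show "poly (evk ?k m b \<circ>\<^sub>p [:l, 1:] * evh F l a) d =
        poly (smult (poly (evh F l a) (- l - m)) (evk ?k (l + m) b) + evk ?k m (bra l a b)) d"
      using arg_cong[OF that[of l "- l - m - d"], of "\<lambda>p. poly p d"]
      by (simp add: poly_pcompose e mult.commute)
  qed
  have 2: "pair_ids F ?k a b \<longleftrightarrow> (\<forall>l m. flag2_eqs F a b l m \<and>
     evh F (l + m) (bra l a b) =
        evh F m b \<circ>\<^sub>p [:l, 1:] * evh F l a - evh F l a \<circ>\<^sub>p [:m, 1:] * evh F m b \<and>
      evD F (l + m) (bra l a b) = bra l a (evD F m b) + s (evh F m b \<circ>\<^sub>p [:l, 1:]) (evD F l a)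
        - bra m b (evD F l a) - s (evh F l a \<circ>\<^sub>p [:m, 1:]) (evD F m b))" (is "_ \<longleftrightarrow> (\<forall>l m. ?E l m)") for a b
  proof
    assume *: "pair_ids F ?k a b"
    then show "\<forall>l m. ?E l m"
      unfolding pair_ids_def flag2_eqs_def
      by (simp add: pcompose_uminus flip_shift scale_const_minus) (simp add: algebra_simps)
  next
    assume *: "\<forall>l m. ?E l m"
    then show "pair_ids F ?k a b"
      using axb[of a b]
      unfolding pair_ids_def flag2_eqs_def
      by (simp add: pcompose_uminus flip_shift scale_const_minus) (simp add: algebra_simps)
  qed
  have 1: "single_ids F ?k a \<longleftrightarrow> (\<forall>l m. flag2_eqs1 F a l m \<and>
      s (evP F m \<circ>\<^sub>p [:l, 1:]) (evD F l a) =
        evD F (l + m) (evD F l a) + s [:poly (evh F l a) (- l - m):] (evQ F (l + m))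
        + evT F m (evD F l a) + s (evh F l a \<circ>\<^sub>p [:m, 1:]) (evQ F m) - bra l a (evQ F m))" for a
    unfolding single_ids_def flag2_eqs1_def
    by (intro all_cong1 iffI; elim conjE; intro conjI; 
      simp add: pcompose_uminus flip_shift minus_diff_commute scale_const_minus; simp add: algebra_simps)
  have 0: "gen_ids F ?k \<longleftrightarrow> (\<forall>l m. flag2_eqs0 F l m \<and> evT F l (evQ F m) =
      evD F (l + m) (evQ F l) + s [:poly (evP F l) (- l - m):] (evQ F (l + m))
      + evT F m (evQ F l) + s (evP F l \<circ>\<^sub>p [:m, 1:]) (evQ F m) - s (evP F m \<circ>\<^sub>p [:l, 1:]) (evQ F l))"
    unfolding gen_ids_def flag2_eqs0_def
    by (intro all_cong1) (auto simp: algebra_simps)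
  show ?thesis
    unfolding flag2_iff flag_common_iff conf_flag_flip flag_ids_def 0 1 2 by blast
qed

end

section \<open>Extensions and their isomorphisms\<close>

context leibniz_alg
begin

lemma eq_ev: "p = q \<longleftrightarrow> (\<forall>l. ev s p [:l:] = ev s q [:l:])"
  using ev_eq_complexI[OF module_axioms] by blast

lemma eq_evQ: "p = q \<longleftrightarrow> (\<forall>l. poly p [:l:] = poly q [:l:])" for p q :: "complex poly poly"
  using ev_eq_complexI[OF Q.module_axioms, of p q] by auto

text \<open>The data are read off from the brackets with x = (0, 1) and inherit conformal linearity
  from e. The flag bracket built from them agrees with e on R and x, which generate E.\<close>

lemma extension_decompose:
  assumes "e \<in> extensions s (*) br"
  obtains F k where "conf_flag F k" "e = flag_bracket s br F k"
proof -
  have L: "leibniz_conformal E.scale e" and R: "e (a, 0) (b, 0) = ppair (br a b) 0" for a b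
    using assms by (auto simp: extensions_def)
  interpret e: conf_bil E.scale E.scale E.scale e
    using L by (intro conf_bil.intro conf_bil_axioms.intro E.p.module_axioms) (simp add: leibniz_conformal_iff)
  define F where "F = \<lparr>flag_h = \<lambda>a. map_poly snd (e (a, 0) (0, 1)),
    flag_D = \<lambda>a. map_poly fst (e (a, 0) (0, 1)), flag_T = \<lambda>a. map_poly fst (e (0, 1) (a, 0)),
    flag_Q = map_poly fst (e (0, 1) (0, 1)), flag_P = map_poly snd (e (0, 1) (0, 1))\<rparr>"
  define k where "k = (\<lambda>a. map_poly snd (e (0, 1) (a, 0)))"
  have add: "map_poly fst (p + q) = map_poly fst p + map_poly fst q"
    "map_poly snd (p + q) = map_poly snd p + map_poly snd q" for p q :: "('r \<times> complex poly) poly"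
    by (simp_all add: poly_eq_iff coeff_map_poly)
  have fst: "ev s (map_poly fst p) x = fst (ev E.scale p x)"
    and snd: "poly (map_poly snd p) x = snd (ev E.scale p x)" for p x
    using ev_map_poly[OF E.module_hom_fst] ev_map_poly[OF E.module_hom_snd, of p x] by simp_all
  have e_add: "e (a + a', 0) y = e (a, 0) y + e (a', 0) y" "e y (a + a', 0) = e y (a, 0) + e y (a', 0)" for a a' y
    using e.add_left[of "(a, 0)" "(a', 0)" y] e.add_right[of y "(a, 0)" "(a', 0)"] by simp_all
  have e_scale: "ev E.scale (e (s p a, 0) y) [:l:] = E.scale [:poly p (- l):] (ev E.scale (e (a, 0) y) [:l:])"
    "ev E.scale (e y (s p a, 0)) [:l:] = E.scale (p \<circ>\<^sub>p [:l, 1:]) (ev E.scale (e y (a, 0)) [:l:])" for a p y l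
    using e.scale_left[of p "(a, 0)" y l] e.scale_right[of y p "(a, 0)" l] by (simp_all add: E.scale_prod)
  have conf: "conf_flag F k"
    unfolding conf_flag_def F_def k_def
    by (simp add: left_conf_linear_iff conf_linear_iff module_axioms Q.module_axioms add e_add
        fst snd e_scale E.scale_def)
  have fb: "conf_bil E.scale E.scale E.scale (flag_bracket s br F k)"
    by (rule conf_bil_flag_bracket[OF conf])
  have sp: "E.p.span (gens UNIV) = UNIV"
    by (rule span_gens) simp
  have "e = flag_bracket s br F k"
  proof (rule conf_bilinear_eq_on_span[OF e.conf_bil_axioms fb sp sp], rule ev_eq_complexI[OF E.p.module_axioms])
    fix u w l
    assume "u \<in> gens UNIV" "w \<in> gens UNIV"
    then show "ev E.scale (e u w) [:l:] = ev E.scale (flag_bracket s br F k u w) [:l:]"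
      by (auto simp: gens_def ev_flag_bracket R zero_simps[OF conf])
        (auto simp: F_def k_def fst snd one_pCons [symmetric])
  qed
  with conf show thesis by (rule that)
qed

text \<open>The last annihilator condition says that a product vanishes. If some k b is nonzero, its
  values vanish at finitely many numbers only, so the other factor vanishes at cofinitely many
  points and hence identically.\<close>

lemma flag_ids_dichotomy:
  assumes "flag_ids UNIV F k"
  shows "k = (\<lambda>_. 0) \<or> k = (\<lambda>a. - flip (flag_h F a))"
proof (cases "k = (\<lambda>_. 0)")
  case False
  then obtain b where b: "k b \<noteq> 0" by auto
  have prod: "poly (evh F l a) (- l - m) + poly (evk k m a) (- l - m) = 0"
    if "evk k (l + m) b \<noteq> 0" for a l m
  proof -
    have "smult (poly (evh F l a) (- l - m)) (evk k (l + m) b)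
      + smult (poly (evk k m a) (- l - m)) (evk k (l + m) b) = 0"
      using assms unfolding flag_ids_def pair_ids_def by blast
    then have "smult (poly (evh F l a) (- l - m) + poly (evk k m a) (- l - m)) (evk k (l + m) b) = 0"
      by (simp add: smult_add_left)
    then show ?thesis using that by (simp only: smult_eq_0_iff, blast)
  qed
  \<comment> \<open>Over the domain \<complex>[\<partial>] the nonzero polynomial k b in \<lambda>
    has finitely many roots, and distinct numbers are distinct points of
    \<complex>[\<partial>].\<close>
  have "(\<lambda>n. [:n:]) ` {n. evk k n b = 0} \<subseteq> {x. poly (k b) x = 0}" by auto
  then have "finite ((\<lambda>n. [:n:]) ` {n. evk k n b = 0})"
    using poly_roots_finite[OF b] by (rule finite_subset)
  then have fin: "finite {n. evk k n b = 0}"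
    by (rule finite_imageD) (auto simp: inj_on_def)
  have "k = (\<lambda>a. - flip (flag_h F a))"
  proof
    fix a
    have "evh F l a + poly (flip (k a)) [:l:] = 0" for l
    proof (rule ccontr)
      assume "evh F l a + poly (flip (k a)) [:l:] \<noteq> 0"
      then have "finite {y. poly (evh F l a + poly (flip (k a)) [:l:]) y = 0}"
        by (rule poly_roots_finite)
      moreover have "uminus ` (- {n. evk k n b = 0}) \<subseteq> {y. poly (evh F l a + poly (flip (k a)) [:l:]) y = 0}"
      proof
        fix y assume "y \<in> uminus ` (- {n. evk k n b = 0})"
        \<comment> \<open>The choice m = -l-y gives l+m = -y, where k b is nonzero, and -l-m = y,
          where the other factor is evaluated.\<close>
        then have "evk k (l + (- l - y)) b \<noteq> 0" by auto
        from prod[OF this, of a] show "y \<in> {y. poly (evh F l a + poly (flip (k a)) [:l:]) y = 0}"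
          by simp
      qed
      ultimately have "finite (uminus ` (- {n. evk k n b = 0}))"
        by (rule rev_finite_subset)
      then have "finite (- {n. evk k n b = 0})"
        by (rule finite_imageD) (auto simp: inj_on_def)
      with fin have "finite (UNIV :: complex set)"
        by (metis finite_compl)
      then show False by (simp add: infinite_UNIV_char_0)
    qed
    then have "flag_h F a + flip (k a) = 0"
      by (intro ev_eq_complexI[OF Q.module_axioms]) simp
    then have "flip (flag_h F a + flip (k a)) = 0" by simp
    then have "flip (flag_h F a) + k a = 0"
      using flip_flip[of "k a"] by (simp add: flip_def pcompose_add)
    then show "k a = - flip (flag_h F a)"
      by (simp add: add_eq_0_iff)
  qed
  then show ?thesis ..
qed simp

section \<open>Automorphisms of E fixing R and the relation they induce on flag data\<close>

definition shear :: "'r \<Rightarrow> complex \<Rightarrow> 'r \<times> complex poly \<Rightarrow> 'r \<times> complex poly" where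
  "shear u \<beta> = (\<lambda>(a, p). (a + s p u, smult \<beta> p))"

lemma module_hom_shear: "module_hom E.scale E.scale (shear u \<beta>)"
  by (rule module_hom.intro[OF E.p.module_axioms E.p.module_axioms], standard)
    (auto simp: shear_def E.scale_prod scale_left_distrib scale_right_distrib smult_add_right)

lemma bij_shear: "\<beta> \<noteq> 0 \<Longrightarrow> bij (shear u \<beta>)"
  by (rule bij_betw_byWitness[where f' = "\<lambda>(a, p). (a - s (smult (1 / \<beta>) p) u, smult (1 / \<beta>) p)"])
    (auto simp: shear_def)

lemma shear_eqI:
  assumes hom: "module_hom E.scale E.scale \<phi>" and "bij \<phi>" and R: "\<And>a. \<phi> (a, 0) = (a, 0)"
  obtains u \<beta> where "\<beta> \<noteq> 0" "\<phi> = shear u \<beta>"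
proof -
  interpret module_hom E.scale E.scale \<phi> by fact
  obtain u w where uw: "\<phi> (0, 1) = (u, w)" by force
  have \<phi>: "\<phi> (a, p) = (a + s p u, p * w)" for a p
  proof -
    \<comment> \<open>The image of x determines \<phi>, as R is fixed and E is generated by R and
      x.\<close>
    have "(a, p) = (a, 0) + E.scale p (0, 1)" by (simp add: E.scale_prod)
    then have "\<phi> (a, p) = \<phi> (a, 0) + E.scale p (\<phi> (0, 1))" by (simp only: add scale)
    then show ?thesis by (simp add: R uw E.scale_prod)
  qed
  obtain a p where "\<phi> (a, p) = (0, 1)"
    using \<open>bij \<phi>\<close> by (metis bij_pointE surj_pair)
  \<comment> \<open>The Q-component of a preimage of x reads p w = 1, so w is a unit of
    \<complex>[\<partial>], that is, a nonzero constant.\<close>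
  then have "w dvd 1" by (simp add: \<phi>) (metis dvd_triv_right)
  then obtain \<beta> where "w = [:\<beta>:]" "\<beta> \<noteq> 0"
    using is_unit_polyE by (metis not_is_unit_0 pCons_0_0)
  then show thesis
    by (intro that[of \<beta> u]) (auto simp: shear_def \<phi> fun_eq_iff)
qed

text \<open>A common form of the two relations on flag data: k = 0 yields
  \<open>flag_transform1\<close> and k = -flip h yields \<open>flag_transform2\<close>.\<close>

definition flag_rel where
  "flag_rel u \<beta> F k F' k' \<longleftrightarrow> flag_h F = flag_h F' \<and> k = k' \<and>
     (\<forall>a. flag_D F a = br a u + pscale s \<beta> (flag_D F' a) - act1 s (flag_h F a) [:u:] \<and>
          flag_T F a = br u a + pscale s \<beta> (flag_T F' a) - act1 s (k a) [:u:]) \<and>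
     flag_P F = flag_h F' u + k' u + smult [:\<beta>:] (flag_P F') \<and>
     flag_Q F = br u u + pscale s \<beta> (flag_D F' u) + pscale s \<beta> (flag_T F' u)
       + pscale s (\<beta>\<^sup>2) (flag_Q F') - act1 s (flag_P F) [:u:]"

text \<open>Both sides of the homomorphism condition are conformal bilinear, so generators suffice.
  Pairs from R are trivial; (a, x) gives the equations for D and h, (x, a) those for T and k, and
  (x, x) those for Q and P.\<close>

lemma shear_iso_iff:
  assumes F: "conf_flag F k" and F': "conf_flag F' k'" and \<beta>: "\<beta> \<noteq> 0"
  shows "leibniz_iso E.scale (flag_bracket s br F k) (flag_bracket s br F' k') (shear u \<beta>) \<longleftrightarrow>
    flag_rel u \<beta> F k F' k'"
proof -
  let ?e = "flag_bracket s br F k" and ?e' = "flag_bracket s br F' k'" and ?\<phi> = "shear u \<beta>"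
  interpret e: conf_bil E.scale E.scale E.scale ?e by (rule conf_bil_flag_bracket[OF F])
  interpret e': conf_bil E.scale E.scale E.scale ?e' by (rule conf_bil_flag_bracket[OF F'])
  note ev_\<phi> = ev_map_poly[OF module_hom_shear]
  have id: "module_hom E.scale E.scale id" by (rule E.p.module_hom_id)
  have 1: "conf_bil E.scale E.scale E.scale (\<lambda>x y. map_poly ?\<phi> (?e x y))"
    using conf_bil_compose[OF e.conf_bil_axioms id id module_hom_shear] by simp
  have 2: "conf_bil E.scale E.scale E.scale (\<lambda>x y. ?e' (?\<phi> x) (?\<phi> y))"
    using conf_bil_compose[OF e'.conf_bil_axioms module_hom_shear module_hom_shear id] by simp
  have sp: "E.p.span (gens UNIV) = UNIV"
    by (rule span_gens) simp
  have "leibniz_iso E.scale ?e ?e' ?\<phi> \<longleftrightarrow> (\<forall>x\<in>gens UNIV. \<forall>y\<in>gens UNIV. map_poly ?\<phi> (?e x y) = ?e' (?\<phi> x) (?\<phi> y))"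
    (is "?L \<longleftrightarrow> ?R")
  proof
    assume ?R
    then have "(\<lambda>x y. map_poly ?\<phi> (?e x y)) = (\<lambda>x y. ?e' (?\<phi> x) (?\<phi> y))"
      by (intro conf_bilinear_eq_on_span[OF 1 2 sp sp]) auto
    then show ?L
      using module_hom_shear bij_shear[OF \<beta>] by (simp add: leibniz_iso_def fun_eq_iff)
  qed (unfold leibniz_iso_def, blast)
  also have "\<dots> \<longleftrightarrow> (\<forall>x\<in>gens UNIV. \<forall>y\<in>gens UNIV. \<forall>l.
      ?\<phi> (ev E.scale (?e x y) [:l:]) = ev E.scale (?e' (?\<phi> x) (?\<phi> y)) [:l:])"
    using ev_eq_complexI[OF E.p.module_axioms] by (metis ev_\<phi>)
  also have "\<dots> \<longleftrightarrow>
      (\<forall>a. \<forall>l. evD F l a + s (evh F l a) u = bra l a u + s [:\<beta>:] (evD F' l a) \<and>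
        smult \<beta> (evh F l a) = smult \<beta> (evh F' l a)) \<and>
      (\<forall>a. \<forall>l. evT F l a + s (evk k l a) u = bra l u a + s [:\<beta>:] (evT F' l a) \<and>
        smult \<beta> (evk k l a) = smult \<beta> (evk k' l a)) \<and>
      (\<forall>l. evQ F l + s (evP F l) u = bra l u u + s [:\<beta>:] (evD F' l u) + s [:\<beta>:] (evT F' l u) + s [:\<beta>\<^sup>2:] (evQ F' l) \<and>
        smult \<beta> (evP F l) = smult \<beta> (evh F' l u) + smult \<beta> (evk k' l u) + smult (\<beta>\<^sup>2) (evP F' l))"
    by (simp add: gens_def ball_Un ev_flag_bracket shear_def zero_simps[OF F] zero_simps[OF F']
        one_pCons [symmetric] power2_eq_square)
      (rule iffI; elim conjE; intro conjI; assumption)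
  also have "\<dots> \<longleftrightarrow> flag_rel u \<beta> F k F' k'"
  proof -
    \<comment> \<open>Every Q-component carries a factor \<beta>, because the shear sends x to u +
      \<beta>x; as \<beta> is nonzero, this factor can be cancelled.\<close>
    have cancel: "smult \<beta> p = smult \<beta> q \<longleftrightarrow> p = q" for p q :: "complex poly"
      using \<beta> by (metis smult_eq_0_iff smult_diff_right eq_iff_diff_eq_0)
    have D: "flag_D F a = br a u + pscale s \<beta> (flag_D F' a) - act1 s (flag_h F a) [:u:] \<longleftrightarrow>
        (\<forall>l. evD F l a + s (evh F l a) u = bra l a u + s [:\<beta>:] (evD F' l a))"
      and T: "flag_T F a = br u a + pscale s \<beta> (flag_T F' a) - act1 s (k a) [:u:] \<longleftrightarrow>
        (\<forall>l. evT F l a + s (evk k l a) u = bra l u a + s [:\<beta>:] (evT F' l a))"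
      and Q: "flag_Q F = br u u + pscale s \<beta> (flag_D F' u) + pscale s \<beta> (flag_T F' u)
         + pscale s (\<beta>\<^sup>2) (flag_Q F') - act1 s (flag_P F) [:u:] \<longleftrightarrow>
        (\<forall>l. evQ F l + s (evP F l) u = bra l u u + s [:\<beta>:] (evD F' l u) + s [:\<beta>:] (evT F' l u) + s [:\<beta>\<^sup>2:] (evQ F' l))" for a
      by (simp_all add: eq_ev ev_pscale[OF module_axioms] algebra_simps)
    have h: "flag_h F = flag_h F' \<longleftrightarrow> (\<forall>a l. smult \<beta> (evh F l a) = smult \<beta> (evh F' l a))"
      and k: "k = k' \<longleftrightarrow> (\<forall>a l. smult \<beta> (evk k l a) = smult \<beta> (evk k' l a))"
      by (simp_all add: fun_eq_iff eq_evQ cancel)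
    have "smult \<beta> (evP F l) = smult \<beta> (evh F' l u) + smult \<beta> (evk k' l u) + smult (\<beta>\<^sup>2) (evP F' l) \<longleftrightarrow>
        evP F l = evh F' l u + evk k' l u + smult \<beta> (evP F' l)" for l
    proof -
      have "smult \<beta> (evh F' l u) + smult \<beta> (evk k' l u) + smult (\<beta>\<^sup>2) (evP F' l) =
          smult \<beta> (evh F' l u + evk k' l u + smult \<beta> (evP F' l))"
        by (simp add: smult_add_right power2_eq_square)
      then show ?thesis by (simp add: cancel)
    qed
    then have P: "flag_P F = flag_h F' u + k' u + smult [:\<beta>:] (flag_P F') \<longleftrightarrow>
        (\<forall>l. smult \<beta> (evP F l) = smult \<beta> (evh F' l u) + smult \<beta> (evk k' l u) + smult (\<beta>\<^sup>2) (evP F' l))"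
      by (simp add: eq_evQ)
    show ?thesis
      unfolding flag_rel_def D T Q h k P by blast
  qed
  finally show ?thesis .
qed

end

section \<open>Quotients by pulled back equivalence relations\<close>

text \<open>For a class X of the pulled back relation this is a single r'-class; saturating the
  image avoids choosing a representative.\<close>

definition class_map :: "'b rel \<Rightarrow> ('a \<Rightarrow> 'b) \<Rightarrow> 'a set \<Rightarrow> 'b set" where
  "class_map r' \<Phi> X = r' `` (\<Phi> ` X)"

definition pullback_rel :: "'a set \<Rightarrow> ('a \<Rightarrow> 'b) \<Rightarrow> 'b rel \<Rightarrow> 'a rel" where
  "pullback_rel A \<Phi> r' = {(a, b). a \<in> A \<and> b \<in> A \<and> (\<Phi> a, \<Phi> b) \<in> r'}"

context
  fixes A :: "'a set" and B :: "'b set" and \<Phi> :: "'a \<Rightarrow> 'b" and r'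
  assumes r': "equiv B r'" and \<Phi>: "\<Phi> ` A \<subseteq> B"
begin

text \<open>This is how the relations on extending structures and on flag data are seen to be
  equivalences: they are pulled back from isomorphism of extensions.\<close>

lemma equiv_pullback: "equiv A (pullback_rel A \<Phi> r')"
proof (rule equivI)
  show "refl_on A (pullback_rel A \<Phi> r')"
    using \<Phi> equiv_class_self[OF r'] by (auto simp: refl_on_def pullback_rel_def)
  show "sym (pullback_rel A \<Phi> r')"
    using r' by (auto simp: sym_def pullback_rel_def equiv_def)
  show "trans (pullback_rel A \<Phi> r')"
    using r' unfolding trans_def pullback_rel_def equiv_def by blast
qed (auto simp: pullback_rel_def)

lemma class_map_class: "a \<in> A \<Longrightarrow> class_map r' \<Phi> (pullback_rel A \<Phi> r' `` {a}) = r' `` {\<Phi> a}"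
  using \<Phi> r' unfolding class_map_def pullback_rel_def equiv_def refl_on_def trans_def sym_def by blast

lemma class_map_inj: "inj_on (class_map r' \<Phi>) (A // pullback_rel A \<Phi> r')"
proof (rule inj_onI, elim quotientE)
  fix X Y a b
  assume a: "a \<in> A" "X = pullback_rel A \<Phi> r' `` {a}" and b: "b \<in> A" "Y = pullback_rel A \<Phi> r' `` {b}"
    and "class_map r' \<Phi> X = class_map r' \<Phi> Y"
  then have "r' `` {\<Phi> a} = r' `` {\<Phi> b}"
    by (simp add: class_map_class)
  then have "(\<Phi> a, \<Phi> b) \<in> r'"
    using eq_equiv_class[OF _ r'] \<Phi> b(1) by blast
  then have "(a, b) \<in> pullback_rel A \<Phi> r'"
    using a b by (simp add: pullback_rel_def)
  then show "X = Y"
    unfolding a b by (rule equiv_class_eq[OF equiv_pullback])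
qed

lemma class_map_image: "class_map r' \<Phi> ` (A // pullback_rel A \<Phi> r') = (\<lambda>a. r' `` {\<Phi> a}) ` A"
proof -
  have "A // pullback_rel A \<Phi> r' = (\<lambda>a. pullback_rel A \<Phi> r' `` {a}) ` A"
    by (auto simp: quotient_def)
  then show ?thesis by (simp add: image_image class_map_class)
qed

end

text \<open>The surjection \<Phi> induces f. The maps \<Phi>1 and \<Phi>2 are jointly onto and never
  meet in a class, so they induce a bijection from the sum of their quotients. Below, B consists of
  the extensions, A of the extending structures, A1 and A2 of the two kinds of flag data.\<close>

lemma classification:
  assumes r': "equiv B r'"
    and \<Phi>: "\<Phi> ` A = B" and \<Phi>1: "\<Phi>1 ` A1 \<subseteq> B" and \<Phi>2: "\<Phi>2 ` A2 \<subseteq> B"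
    and cover: "B \<subseteq> \<Phi>1 ` A1 \<union> \<Phi>2 ` A2"
    and disj: "\<And>a b. a \<in> A1 \<Longrightarrow> b \<in> A2 \<Longrightarrow> (\<Phi>1 a, \<Phi>2 b) \<notin> r'"
    and r: "r = pullback_rel A \<Phi> r'" and r1: "r1 = pullback_rel A1 \<Phi>1 r'" and r2: "r2 = pullback_rel A2 \<Phi>2 r'"
  shows "equiv A1 r1 \<and> equiv A2 r2 \<and> equiv A r \<and> equiv B r' \<and>
    (\<exists>f g. bij_betw f (A // r) (B // r') \<and> (\<forall>x\<in>A. f (r `` {x}) = r' `` {\<Phi> x}) \<and>
      bij_betw g (A1 // r1 <+> A2 // r2) (A // r) \<and>
      (\<forall>x\<in>A1. f (g (Inl (r1 `` {x}))) = r' `` {\<Phi>1 x}) \<and>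
      (\<forall>x\<in>A2. f (g (Inr (r2 `` {x}))) = r' `` {\<Phi>2 x}))"
proof -
  have \<Phi>0: "\<Phi> ` A \<subseteq> B" using \<Phi> by simp
  have quot: "B // r' = (\<lambda>b. r' `` {b}) ` B" by (auto simp: quotient_def)
  define f where "f = class_map r' \<Phi>"
  define h where "h = case_sum (class_map r' \<Phi>1) (class_map r' \<Phi>2)"
  have "(\<lambda>a. r' `` {\<Phi> a}) ` A = B // r'"
    unfolding quot unfolding \<Phi>[symmetric] by (rule image_image[symmetric])
  then have f: "bij_betw f (A // r) (B // r')"
    unfolding bij_betw_def f_def r class_map_image[OF r' \<Phi>0] using class_map_inj[OF r' \<Phi>0] by blast
  have im1: "class_map r' \<Phi>1 ` (A1 // r1) = (\<lambda>b. r' `` {b}) ` (\<Phi>1 ` A1)"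
    and im2: "class_map r' \<Phi>2 ` (A2 // r2) = (\<lambda>b. r' `` {b}) ` (\<Phi>2 ` A2)"
    unfolding r1 r2 by (simp_all add: class_map_image[OF r' \<Phi>1] class_map_image[OF r' \<Phi>2] image_image)
  have "bij_betw h (A1 // r1 <+> A2 // r2) (B // r')"
    unfolding bij_betw_def
  proof
    have ne: "class_map r' \<Phi>1 X \<noteq> class_map r' \<Phi>2 Y" if "X \<in> A1 // r1" "Y \<in> A2 // r2" for X Y
    proof
      assume *: "class_map r' \<Phi>1 X = class_map r' \<Phi>2 Y"
      have "class_map r' \<Phi>1 X \<in> (\<lambda>b. r' `` {b}) ` (\<Phi>1 ` A1)"
        "class_map r' \<Phi>2 Y \<in> (\<lambda>b. r' `` {b}) ` (\<Phi>2 ` A2)"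
        unfolding im1[symmetric] im2[symmetric] by (simp_all add: that)
      then obtain a b where a: "a \<in> A1" "class_map r' \<Phi>1 X = r' `` {\<Phi>1 a}"
        and b: "b \<in> A2" "class_map r' \<Phi>2 Y = r' `` {\<Phi>2 b}"
        by (elim imageE) simp
      have "(\<Phi>1 a, \<Phi>2 b) \<in> r'"
        using * a b \<Phi>2 by (intro eq_equiv_class[OF _ r']) (simp_all add: image_subset_iff)
      with disj a b show False by blast
    qed
    have inj: "inj_on (class_map r' \<Phi>1) (A1 // r1)" "inj_on (class_map r' \<Phi>2) (A2 // r2)"
      unfolding r1 r2 by (rule class_map_inj[OF r' \<Phi>1] class_map_inj[OF r' \<Phi>2])+
    show "inj_on h (A1 // r1 <+> A2 // r2)"
    proof (rule inj_onI)
      fix X Y assume "X \<in> A1 // r1 <+> A2 // r2" "Y \<in> A1 // r1 <+> A2 // r2" "h X = h Y"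
      then show "X = Y"
        by (elim PlusE; hypsubst)
          (simp_all add: h_def inj_on_eq_iff[OF inj(1)] inj_on_eq_iff[OF inj(2)] ne ne[symmetric])
    qed
    have "h ` (A1 // r1 <+> A2 // r2) = class_map r' \<Phi>1 ` (A1 // r1) \<union> class_map r' \<Phi>2 ` (A2 // r2)"
      by (simp add: h_def Plus_def image_Un image_image)
    also have "\<dots> = B // r'"
      unfolding im1 im2 quot image_Un[symmetric] using cover \<Phi>1 \<Phi>2 by (simp add: subset_antisym[OF _ cover])
    finally show "h ` (A1 // r1 <+> A2 // r2) = B // r'" .
  qed
  \<comment> \<open>The map g passes through the classes of B and returns along the inverse of f, so
    f after g is h and has the prescribed values.\<close>
  then have g: "bij_betw (inv_into (A // r) f \<circ> h) (A1 // r1 <+> A2 // r2) (A // r)"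
    using bij_betw_inv_into[OF f] by (rule bij_betw_trans)
  have fg: "f (inv_into (A // r) f y) = y" if "y \<in> B // r'" for y
    using f_inv_into_f[of y f "A // r"] f that by (simp add: bij_betw_def)
  have "\<forall>x\<in>A. f (r `` {x}) = r' `` {\<Phi> x}"
    unfolding f_def r by (simp add: class_map_class[OF r' \<Phi>0])
  moreover have "\<forall>x\<in>A1. f ((inv_into (A // r) f \<circ> h) (Inl (r1 `` {x}))) = r' `` {\<Phi>1 x}"
    using \<Phi>1 by (auto simp: h_def r1 class_map_class[OF r' \<Phi>1] quot intro!: fg)
  moreover have "\<forall>x\<in>A2. f ((inv_into (A // r) f \<circ> h) (Inr (r2 `` {x}))) = r' `` {\<Phi>2 x}"
    using \<Phi>2 by (auto simp: h_def r2 class_map_class[OF r' \<Phi>2] quot intro!: fg)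
  ultimately show ?thesis
    using f g r' equiv_pullback[OF r' \<Phi>0] equiv_pullback[OF r' \<Phi>1] equiv_pullback[OF r' \<Phi>2]
    unfolding r[symmetric] r1[symmetric] r2[symmetric] by blast
qed

section \<open>Isomorphism of extensions as an equivalence relation\<close>

lemma map_poly_inv:
  assumes "module_hom s t \<phi>" "bij \<phi>"
  shows "map_poly (inv \<phi>) (map_poly \<phi> p) = p" "map_poly \<phi> (map_poly (inv \<phi>) q) = q"
proof -
  interpret module_hom s t \<phi> by fact
  \<comment> \<open>Applying maps to coefficients is compatible with composition for maps preserving
    0.\<close>
  have "inv \<phi> 0 = 0" using assms(2) zero by (metis bij_inv_eq_iff)
  then show "map_poly (inv \<phi>) (map_poly \<phi> p) = p" "map_poly \<phi> (map_poly (inv \<phi>) q) = q"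
    using assms(2) by (simp_all add: map_poly_map_poly zero o_def bij_is_inj bij_is_surj surj_f_inv_f)
qed

lemma module_hom_inv:
  assumes "module_hom s t \<phi>" "bij \<phi>"
  shows "module_hom t s (inv \<phi>)"
proof -
  interpret module_hom s t \<phi> by fact
  show ?thesis
    by standard (metis add scale assms(2) bij_inv_eq_iff)+
qed

lemma leibniz_iso_inv:
  assumes "leibniz_iso s e e' \<phi>"
  shows "leibniz_iso s e' e (inv \<phi>)"
proof -
  have \<phi>: "module_hom s s \<phi>" "bij \<phi>" and e: "map_poly \<phi> (e a b) = e' (\<phi> a) (\<phi> b)" for a b
    using assms by (auto simp: leibniz_iso_def)
  have "map_poly (inv \<phi>) (e' a b) = e (inv \<phi> a) (inv \<phi> b)" for a b
    using e[of "inv \<phi> a" "inv \<phi> b"] \<phi> map_poly_inv(1)[OF \<phi>, of "e (inv \<phi> a) (inv \<phi> b)"]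
    by (simp add: bij_is_surj surj_f_inv_f)
  then show ?thesis
    using \<phi> by (simp add: leibniz_iso_def module_hom_inv bij_imp_bij_inv)
qed

lemma leibniz_iso_comp:
  assumes "leibniz_iso s e e' \<phi>" "leibniz_iso s e' e'' \<psi>"
  shows "leibniz_iso s e e'' (\<psi> \<circ> \<phi>)"
proof -
  interpret \<phi>: module_hom s s \<phi> using assms(1) by (simp add: leibniz_iso_def)
  interpret \<psi>: module_hom s s \<psi> using assms(2) by (simp add: leibniz_iso_def)
  have "map_poly (\<psi> \<circ> \<phi>) p = map_poly \<psi> (map_poly \<phi> p)" for p
    by (simp add: map_poly_map_poly \<phi>.zero \<psi>.zero)
  moreover have "module_hom s s (\<psi> \<circ> \<phi>)"
    by (rule module_hom_compose) standard
  ultimately show ?thesis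
    using assms by (auto simp: leibniz_iso_def bij_comp)
qed

lemma leibniz_iso_id: "module s \<Longrightarrow> leibniz_iso s e e id"
  by (simp add: leibniz_iso_def module.module_hom_id)

lemma extensions_modules:
  assumes "e \<in> extensions sR sQ br"
  shows "module (module_prod.scale sR sQ)"
  using assms by (simp add: extensions_def leibniz_conformal_def)

lemma equiv_ext_equiv: "equiv (extensions sR sQ br) (ext_equiv sR sQ br)"
proof (rule equivI)
  show "refl_on (extensions sR sQ br) (ext_equiv sR sQ br)"
    using leibniz_iso_id[OF extensions_modules]
    by (fastforce simp: refl_on_def ext_equiv_def)
  show "sym (ext_equiv sR sQ br)"
  proof (rule symI)
    fix e e' assume "(e, e') \<in> ext_equiv sR sQ br"
    then obtain \<phi> where e: "e \<in> extensions sR sQ br" "e' \<in> extensions sR sQ br"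
      and \<phi>: "leibniz_iso (module_prod.scale sR sQ) e e' \<phi>" "\<And>a. \<phi> (a, 0) = (a, 0)"
      unfolding ext_equiv_def by blast
    have "inv \<phi> (a, 0) = (a, 0)" for a
      using \<phi> by (metis leibniz_iso_def bij_inv_eq_iff)
    with leibniz_iso_inv[OF \<phi>(1)] e show "(e', e) \<in> ext_equiv sR sQ br"
      unfolding ext_equiv_def by blast
  qed
  show "trans (ext_equiv sR sQ br)"
  proof (rule transI)
    fix e e' e'' assume "(e, e') \<in> ext_equiv sR sQ br" "(e', e'') \<in> ext_equiv sR sQ br"
    then obtain \<phi> \<psi> where e: "e \<in> extensions sR sQ br" "e'' \<in> extensions sR sQ br"
      and \<phi>: "leibniz_iso (module_prod.scale sR sQ) e e' \<phi>" "\<And>a. \<phi> (a, 0) = (a, 0)"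
      and \<psi>: "leibniz_iso (module_prod.scale sR sQ) e' e'' \<psi>" "\<And>a. \<psi> (a, 0) = (a, 0)"
      unfolding ext_equiv_def by blast
    have "(\<psi> \<circ> \<phi>) (a, 0) = (a, 0)" for a by (simp add: \<phi> \<psi>)
    with leibniz_iso_comp[OF \<phi>(1) \<psi>(1)] e show "(e, e'') \<in> ext_equiv sR sQ br"
      unfolding ext_equiv_def by blast
  qed
qed (auto simp: ext_equiv_def)

lemma equiv_ext_cohom: "equiv (extensions sR sQ br) (ext_cohom sR sQ br)"
proof (rule equivI)
  show "refl_on (extensions sR sQ br) (ext_cohom sR sQ br)"
    using leibniz_iso_id[OF extensions_modules]
    by (fastforce simp: refl_on_def ext_cohom_def)
  show "sym (ext_cohom sR sQ br)"
  proof (rule symI)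
    fix e e' assume "(e, e') \<in> ext_cohom sR sQ br"
    then obtain \<phi> where e: "e \<in> extensions sR sQ br" "e' \<in> extensions sR sQ br"
      and \<phi>: "leibniz_iso (module_prod.scale sR sQ) e e' \<phi>" "\<And>a. \<phi> (a, 0) = (a, 0)" "snd \<circ> \<phi> = snd"
      unfolding ext_cohom_def by blast
    have bij: "bij \<phi>" using \<phi>(1) by (simp add: leibniz_iso_def)
    have "inv \<phi> (a, 0) = (a, 0)" for a
      using \<phi> bij by (metis bij_inv_eq_iff)
    moreover have "snd \<circ> inv \<phi> = snd"
      using \<phi>(3) bij by (metis comp_assoc comp_id surj_iff bij_is_surj)
    ultimately show "(e', e) \<in> ext_cohom sR sQ br"
      using leibniz_iso_inv[OF \<phi>(1)] e unfolding ext_cohom_def by blast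
  qed
  show "trans (ext_cohom sR sQ br)"
  proof (rule transI)
    fix e e' e'' assume "(e, e') \<in> ext_cohom sR sQ br" "(e', e'') \<in> ext_cohom sR sQ br"
    then obtain \<phi> \<psi> where e: "e \<in> extensions sR sQ br" "e'' \<in> extensions sR sQ br"
      and \<phi>: "leibniz_iso (module_prod.scale sR sQ) e e' \<phi>" "\<And>a. \<phi> (a, 0) = (a, 0)" "snd \<circ> \<phi> = snd"
      and \<psi>: "leibniz_iso (module_prod.scale sR sQ) e' e'' \<psi>" "\<And>a. \<psi> (a, 0) = (a, 0)" "snd \<circ> \<psi> = snd"
      unfolding ext_cohom_def by blast
    have "(\<psi> \<circ> \<phi>) (a, 0) = (a, 0)" for a by (simp add: \<phi> \<psi>)
    moreover have "snd \<circ> (\<psi> \<circ> \<phi>) = snd" by (simp add: comp_assoc[symmetric] \<phi> \<psi>)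
    ultimately show "(e, e'') \<in> ext_cohom sR sQ br"
      using leibniz_iso_comp[OF \<phi>(1) \<psi>(1)] e unfolding ext_cohom_def by blast
  qed
qed (auto simp: ext_cohom_def)

section \<open>Extending data\<close>

text \<open>Here Q is an arbitrary \<complex>[\<partial>]-module; it becomes \<complex>[\<partial>]x
  only in the classification.\<close>

locale extension_pair =
  sR: module sR + sQ: module sQ
  for sR :: "complex poly \<Rightarrow> 'r::ab_group_add \<Rightarrow> 'r"
    and sQ :: "complex poly \<Rightarrow> 'q::ab_group_add \<Rightarrow> 'q" +
  fixes br :: "'r \<Rightarrow> 'r \<Rightarrow> 'r poly"
  assumes leibniz: "leibniz_conformal sR br"
begin

sublocale E: module_prod sR sQ
  by standard

lemma conf_bil_br: "conf_bil sR sR sR br"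
  using leibniz by (intro conf_bil.intro conf_bil_axioms.intro sR.module_axioms) (simp add: leibniz_conformal_iff)

lemma module_hom_inl: "module_hom sR E.scale (\<lambda>a. (a, 0))"
  and module_hom_inr: "module_hom sQ E.scale (\<lambda>x. (0, x))"
  by (unfold_locales; simp add: E.scale_prod)+

lemma conf_bil_unified_product:
  assumes "\<Omega> \<in> TCL sR sQ br"
  shows "conf_bil E.scale E.scale E.scale (unified_product br \<Omega>)"
  using assms
  by (intro conf_bil.intro conf_bil_axioms.intro E.p.module_axioms)
    (simp add: TCL_def leibniz_conformal_iff)

text \<open>Conformal bilinear maps vanish when an argument is 0, so each pair of summands isolates
  two components of the datum.\<close>

lemma unified_product_gens:
  assumes "\<Omega> \<in> TCL sR sQ br"
  shows "unified_product br \<Omega> (a, 0) (b, 0) = ppair (br a b) 0"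
    "unified_product br \<Omega> (a, 0) (0, y) = ppair (lh \<Omega> a y) (rh \<Omega> a y)"
    "unified_product br \<Omega> (0, x) (b, 0) = ppair (rt \<Omega> x b) (lt \<Omega> x b)"
    "unified_product br \<Omega> (0, x) (0, y) = ppair (cocyc \<Omega> x y) (qbr \<Omega> x y)"
    "unified_product br \<Omega> (a, 0) (b, y) = ppair (br a b + lh \<Omega> a y) (rh \<Omega> a y)"
    "unified_product br \<Omega> (a, x) (b, 0) = ppair (br a b + rt \<Omega> x b) (lt \<Omega> x b)"
proof -
  interpret br: conf_bil sR sR sR br by (rule conf_bil_br)
  interpret lh: conf_bil sR sQ sR "lh \<Omega>"
    using assms by unfold_locales (simp add: TCL_def)
  interpret rh: conf_bil sR sQ sQ "rh \<Omega>"
    using assms by unfold_locales (simp add: TCL_def)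
  interpret lt: conf_bil sQ sR sQ "lt \<Omega>"
    using assms by unfold_locales (simp add: TCL_def)
  interpret rt: conf_bil sQ sR sR "rt \<Omega>"
    using assms by unfold_locales (simp add: TCL_def)
  interpret cocyc: conf_bil sQ sQ sR "cocyc \<Omega>"
    using assms by unfold_locales (simp add: TCL_def)
  interpret qbr: conf_bil sQ sQ sQ "qbr \<Omega>"
    using assms by unfold_locales (simp add: TCL_def)
  show "unified_product br \<Omega> (a, 0) (b, 0) = ppair (br a b) 0"
    "unified_product br \<Omega> (a, 0) (0, y) = ppair (lh \<Omega> a y) (rh \<Omega> a y)"
    "unified_product br \<Omega> (0, x) (b, 0) = ppair (rt \<Omega> x b) (lt \<Omega> x b)"
    "unified_product br \<Omega> (0, x) (0, y) = ppair (cocyc \<Omega> x y) (qbr \<Omega> x y)"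
    "unified_product br \<Omega> (a, 0) (b, y) = ppair (br a b + lh \<Omega> a y) (rh \<Omega> a y)"
    "unified_product br \<Omega> (a, x) (b, 0) = ppair (br a b + rt \<Omega> x b) (lt \<Omega> x b)"
    by (simp_all add: unified_product_def)
qed

lemma span_summands: "E.p.span (UNIV \<times> {0} \<union> {0} \<times> UNIV) = UNIV"
  by (rule E.span_prod) simp_all

text \<open>Conversely to forming the product, an extension yields a datum through its R- and
  Q-components on the pairs of summands other than (R, R), where the bracket is already
  fixed.\<close>

lemma unified_product_image: "unified_product br ` TCL sR sQ br = extensions sR sQ br"
proof (intro equalityI subsetI)
  fix e assume "e \<in> unified_product br ` TCL sR sQ br"
  then show "e \<in> extensions sR sQ br"
    by (auto simp: extensions_def unified_product_gens(1)) (simp add: TCL_def)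
next
  fix e assume "e \<in> extensions sR sQ br"
  then have L: "leibniz_conformal E.scale e" and R: "e (a, 0) (b, 0) = ppair (br a b) 0" for a b
    by (auto simp: extensions_def)
  have e: "conf_bil E.scale E.scale E.scale e"
    using L by (intro conf_bil.intro conf_bil_axioms.intro E.p.module_axioms) (simp add: leibniz_conformal_iff)
  interpret e: conf_bil E.scale E.scale E.scale e by fact
  note [intro!] = conf_bil.conf_bilinear conf_bil_compose[OF e] module_hom_inl module_hom_inr
    E.module_hom_fst E.module_hom_snd
  define \<Omega> where "\<Omega> = \<lparr>lh = \<lambda>a y. map_poly fst (e (a, 0) (0, y)),
    rh = \<lambda>a y. map_poly snd (e (a, 0) (0, y)), lt = \<lambda>x b. map_poly snd (e (0, x) (b, 0)),
    rt = \<lambda>x b. map_poly fst (e (0, x) (b, 0)), cocyc = \<lambda>x y. map_poly fst (e (0, x) (0, y)),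
    qbr = \<lambda>x y. map_poly snd (e (0, x) (0, y))\<rparr>"
  have "unified_product br \<Omega> (a, x) (b, y) = e (a, x) (b, y)" for a x b y
  proof -
    have "e (a, x) (b, y) = e (a, 0) (b, 0) + e (a, 0) (0, y) + e (0, x) (b, 0) + e (0, x) (0, y)"
      using e.add_left[of "(a, 0)" "(0, x)"] e.add_right[of _ "(b, 0)" "(0, y)"]
      by (simp add: add.assoc)
    also have "\<dots> = ppair (map_poly fst \<dots>) (map_poly snd \<dots>)"
      by (rule ppair_fst_snd [symmetric])
    finally show ?thesis
      by (simp add: unified_product_def \<Omega>_def R poly_eq_iff coeff_ppair coeff_map_poly)
  qed
  then have up: "unified_product br \<Omega> = e" by (simp add: fun_eq_iff)
  have "\<Omega> \<in> TCL sR sQ br"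
    unfolding TCL_def mem_Collect_eq up using L by (auto simp: \<Omega>_def)
  with up show "e \<in> unified_product br ` TCL sR sQ br" by blast
qed

section \<open>Automorphisms fixing R and equivalence of extending structures\<close>

definition tshear :: "('q \<Rightarrow> 'r) \<Rightarrow> ('q \<Rightarrow> 'q) \<Rightarrow> 'r \<times> 'q \<Rightarrow> 'r \<times> 'q" where
  "tshear u v = (\<lambda>(a, x). (a + u x, v x))"

lemma module_hom_tshear:
  assumes "module_hom sQ sR u" "module_hom sQ sQ v"
  shows "module_hom E.scale E.scale (tshear u v)"
proof -
  interpret u: module_hom sQ sR u by fact
  interpret v: module_hom sQ sQ v by fact
  show ?thesis
    by (rule module_hom.intro[OF E.p.module_axioms E.p.module_axioms], standard)
      (auto simp: tshear_def E.scale_prod u.add u.scale v.add v.scale sR.scale_right_distrib)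
qed

lemma bij_tshear:
  assumes "module_hom sQ sR u" "module_hom sQ sQ v"
  shows "bij (tshear u v) \<longleftrightarrow> bij v"
proof
  assume "bij v"
  then show "bij (tshear u v)"
    by (intro bij_betw_byWitness[where f' = "\<lambda>(a, x). (a - u (inv v x), inv v x)"])
      (auto simp: tshear_def bij_is_inj bij_is_surj surj_f_inv_f)
next
  interpret u: module_hom sQ sR u by fact
  interpret v: module_hom sQ sQ v by fact
  assume bij: "bij (tshear u v)"
  have "inj v"
  proof (rule injI)
    fix x y assume "v x = v y"
    \<comment> \<open>The R-component -u x cancels u x, so that only the values of v are
      compared.\<close>
    then have "tshear u v (- u x, x) = tshear u v (- u y, y)" by (simp add: tshear_def)
    then show "x = y" using bij by (metis Pair_inject bij_is_inj injD)
  qed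
  moreover have "surj v"
  proof -
    have "\<exists>x. y = v x" for y
    proof -
      obtain z where "tshear u v z = (0, y)" using bij by (metis bij_pointE)
      then show ?thesis by (auto simp: tshear_def split: prod.splits)
    qed
    then show ?thesis by (auto simp: surj_def)
  qed
  ultimately show "bij v" by (simp add: bij_def)
qed

text \<open>As R is fixed, \<phi> is determined by its restriction to Q; u and v are the two
  components of that restriction.\<close>

lemma tshear_eqE:
  assumes \<phi>: "module_hom E.scale E.scale \<phi>" and R: "\<And>a. \<phi> (a, 0) = (a, 0)"
  obtains u v where "\<phi> = tshear u v" "module_hom sQ sR u" "module_hom sQ sQ v"
proof
  interpret \<phi>: module_hom E.scale E.scale \<phi> by fact
  show "\<phi> = tshear (\<lambda>x. fst (\<phi> (0, x))) (\<lambda>x. snd (\<phi> (0, x)))"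
  proof
    fix z :: "'r \<times> 'q"
    show "\<phi> z = tshear (\<lambda>x. fst (\<phi> (0, x))) (\<lambda>x. snd (\<phi> (0, x))) z"
      using \<phi>.add[of "(fst z, 0)" "(0, snd z)"] by (simp add: tshear_def case_prod_unfold R prod_eq_iff)
  qed
  show "module_hom sQ sR (\<lambda>x. fst (\<phi> (0, x)))" "module_hom sQ sQ (\<lambda>x. snd (\<phi> (0, x)))"
    using module_hom_compose[OF module_hom_compose[OF module_hom_inr \<phi>] E.module_hom_fst]
      module_hom_compose[OF module_hom_compose[OF module_hom_inr \<phi>] E.module_hom_snd]
    by (simp_all add: o_def)
qed

lemma tshear_R: "module_hom sQ sR u \<Longrightarrow> module_hom sQ sQ v \<Longrightarrow> tshear u v (a, 0) = (a, 0)"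
  by (simp add: tshear_def module_hom.zero)

text \<open>The condition is tested on the summands. Pairs from R hold since R is fixed; the types
  (a, y), (x, a) and (x, y) give two components each, which are the six identities of
  \<open>TCL_transform\<close>.\<close>

lemma tshear_iso_iff:
  assumes \<Omega>: "\<Omega> \<in> TCL sR sQ br" and \<Omega>': "\<Omega>' \<in> TCL sR sQ br"
    and u: "module_hom sQ sR u" and v: "module_hom sQ sQ v" "bij v"
  shows "leibniz_iso E.scale (unified_product br \<Omega>) (unified_product br \<Omega>') (tshear u v) \<longleftrightarrow>
    TCL_transform br u v \<Omega> \<Omega>'"
proof -
  let ?e = "unified_product br \<Omega>" and ?e' = "unified_product br \<Omega>'" and ?\<phi> = "tshear u v"
  interpret u: module_hom sQ sR u by fact
  interpret v: module_hom sQ sQ v by fact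
  have \<phi>: "module_hom E.scale E.scale ?\<phi>" by (rule module_hom_tshear[OF u v(1)])
  interpret \<phi>: module_hom E.scale E.scale ?\<phi> by (rule \<phi>)
  let ?G = "UNIV \<times> {0} \<union> {0} \<times> UNIV :: ('r \<times> 'q) set"
  have id: "module_hom E.scale E.scale id" by (rule E.p.module_hom_id)
  have 1: "conf_bil E.scale E.scale E.scale (\<lambda>x y. map_poly ?\<phi> (?e x y))"
    using conf_bil_compose[OF conf_bil_unified_product[OF \<Omega>] id id \<phi>] by simp
  have 2: "conf_bil E.scale E.scale E.scale (\<lambda>x y. ?e' (?\<phi> x) (?\<phi> y))"
    using conf_bil_compose[OF conf_bil_unified_product[OF \<Omega>'] \<phi> \<phi> id] by simp
  have map_\<phi>: "map_poly ?\<phi> (ppair p q) = ppair (p + map_poly u q) (map_poly v q)" for p q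
    by (simp add: poly_eq_iff coeff_ppair coeff_map_poly tshear_def u.zero v.zero zero_prod_def)
  have "leibniz_iso E.scale ?e ?e' ?\<phi> \<longleftrightarrow> (\<forall>x\<in>?G. \<forall>y\<in>?G. map_poly ?\<phi> (?e x y) = ?e' (?\<phi> x) (?\<phi> y))"
    (is "?L \<longleftrightarrow> ?R")
  proof
    assume ?R
    then have "(\<lambda>x y. map_poly ?\<phi> (?e x y)) = (\<lambda>x y. ?e' (?\<phi> x) (?\<phi> y))"
      by (intro conf_bilinear_eq_on_span[OF 1 2 span_summands span_summands]) blast
    then show ?L
      using \<phi> v u by (simp add: leibniz_iso_def bij_tshear fun_eq_iff)
  qed (unfold leibniz_iso_def, blast)
  also have "\<dots> \<longleftrightarrow>
     (\<forall>a y. map_poly v (rh \<Omega> a y) = rh \<Omega>' a (v y) \<and>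
        lh \<Omega> a y + map_poly u (rh \<Omega> a y) = br a (u y) + lh \<Omega>' a (v y)) \<and>
     (\<forall>x a. map_poly v (lt \<Omega> x a) = lt \<Omega>' (v x) a \<and>
        rt \<Omega> x a + map_poly u (lt \<Omega> x a) = br (u x) a + rt \<Omega>' (v x) a) \<and>
     (\<forall>x y. map_poly v (qbr \<Omega> x y) = rh \<Omega>' (u x) (v y) + lt \<Omega>' (v x) (u y) + qbr \<Omega>' (v x) (v y) \<and>
        cocyc \<Omega> x y + map_poly u (qbr \<Omega> x y) =
          br (u x) (u y) + lh \<Omega>' (u x) (v y) + rt \<Omega>' (v x) (u y) + cocyc \<Omega>' (v x) (v y))"
  proof -
    have \<phi>l: "?\<phi> (a, 0) = (a, 0)" and \<phi>r: "?\<phi> (0, x) = (u x, v x)" for a x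
      by (simp_all add: tshear_def u.zero v.zero)
    have e': "?e' (a, 0) (u y, v y) = ppair (br a (u y) + lh \<Omega>' a (v y)) (rh \<Omega>' a (v y))"
      "?e' (u x, v x) (a, 0) = ppair (br (u x) a + rt \<Omega>' (v x) a) (lt \<Omega>' (v x) a)"
      "?e' (u x, v x) (u y, v y) =
         ppair (br (u x) (u y) + lh \<Omega>' (u x) (v y) + rt \<Omega>' (v x) (u y) + cocyc \<Omega>' (v x) (v y))
           (rh \<Omega>' (u x) (v y) + lt \<Omega>' (v x) (u y) + qbr \<Omega>' (v x) (v y))" for a x y
      by (simp_all only: unified_product_gens(5,6)[OF \<Omega>']) (simp add: unified_product_def)
    have ball: "(\<forall>x\<in>?G. \<forall>y\<in>?G. P x y) \<longleftrightarrow> (\<forall>a b. P (a, 0) (b, 0)) \<and> (\<forall>a y. P (a, 0) (0, y)) \<and>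
      (\<forall>x b. P (0, x) (b, 0)) \<and> (\<forall>x y. P (0, x) (0, y))" for P
      by auto
    show ?thesis
      unfolding ball \<phi>l \<phi>r unified_product_gens(1-4)[OF \<Omega>] unified_product_gens(1)[OF \<Omega>'] map_\<phi> e' ppair_eq_iff
      by auto
  qed
  also have "\<dots> \<longleftrightarrow> TCL_transform br u v \<Omega> \<Omega>'"
  proof -
    \<comment> \<open>The homomorphism condition has v on the left; the definition has its inverse
      on the right.\<close>
    have "map_poly v p = q \<longleftrightarrow> p = map_poly (inv v) q" for p q
      using map_poly_inv[OF v] by auto
    then show ?thesis
      unfolding TCL_transform_def by (simp add: eq_diff_eq) blast
  qed
  finally show ?thesis .
qed

text \<open>Isomorphisms fixing R are exactly the maps \<open>tshear u v\<close> satisfying the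
  transformation rules with v bijective.\<close>

lemma TCL_equiv_pullback:
  "TCL_equiv sR sQ br = pullback_rel (TCL sR sQ br) (unified_product br) (ext_equiv sR sQ br)"
proof -
  have "(\<exists>u v. module_hom sQ sR u \<and> module_hom sQ sQ v \<and> bij v \<and> TCL_transform br u v \<Omega> \<Omega>') \<longleftrightarrow>
      (unified_product br \<Omega>, unified_product br \<Omega>') \<in> ext_equiv sR sQ br"
    if \<Omega>: "\<Omega> \<in> TCL sR sQ br" "\<Omega>' \<in> TCL sR sQ br" for \<Omega> \<Omega>'
  proof -
    have ext: "unified_product br \<Omega> \<in> extensions sR sQ br" "unified_product br \<Omega>' \<in> extensions sR sQ br"
      using that unified_product_image by auto
    show ?thesis
    proof
      assume "\<exists>u v. module_hom sQ sR u \<and> module_hom sQ sQ v \<and> bij v \<and> TCL_transform br u v \<Omega> \<Omega>'"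
      then obtain u v where uv: "module_hom sQ sR u" "module_hom sQ sQ v" "bij v" "TCL_transform br u v \<Omega> \<Omega>'"
        by blast
      then have "leibniz_iso E.scale (unified_product br \<Omega>) (unified_product br \<Omega>') (tshear u v)"
        using tshear_iso_iff[OF \<Omega>] by blast
      moreover have "tshear u v (a, 0) = (a, 0)" for a
        using uv by (simp add: tshear_R)
      ultimately show "(unified_product br \<Omega>, unified_product br \<Omega>') \<in> ext_equiv sR sQ br"
        using ext unfolding ext_equiv_def by blast
    next
      assume "(unified_product br \<Omega>, unified_product br \<Omega>') \<in> ext_equiv sR sQ br"
      then obtain \<phi> where iso: "leibniz_iso E.scale (unified_product br \<Omega>) (unified_product br \<Omega>') \<phi>"
        and R: "\<And>a. \<phi> (a, 0) = (a, 0)"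
        unfolding ext_equiv_def by blast
      have "module_hom E.scale E.scale \<phi>" "bij \<phi>" using iso by (simp_all add: leibniz_iso_def)
      then obtain u v where \<phi>: "\<phi> = tshear u v" and uv: "module_hom sQ sR u" "module_hom sQ sQ v"
        using tshear_eqE R by metis
      have "bij v" using \<open>bij \<phi>\<close> unfolding \<phi> bij_tshear[OF uv] .
      then show "\<exists>u v. module_hom sQ sR u \<and> module_hom sQ sQ v \<and> bij v \<and> TCL_transform br u v \<Omega> \<Omega>'"
        using uv tshear_iso_iff[OF \<Omega> uv] iso unfolding \<phi> by blast
    qed
  qed
  then show ?thesis
    unfolding TCL_equiv_def pullback_rel_def by blast
qed

lemma TCL_cohom_pullback:
  "TCL_cohom sR sQ br = pullback_rel (TCL sR sQ br) (unified_product br) (ext_cohom sR sQ br)"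
proof -
  have "(\<exists>u. module_hom sQ sR u \<and> TCL_transform br u id \<Omega> \<Omega>') \<longleftrightarrow>
      (unified_product br \<Omega>, unified_product br \<Omega>') \<in> ext_cohom sR sQ br"
    if \<Omega>: "\<Omega> \<in> TCL sR sQ br" "\<Omega>' \<in> TCL sR sQ br" for \<Omega> \<Omega>'
  proof -
    have ext: "unified_product br \<Omega> \<in> extensions sR sQ br" "unified_product br \<Omega>' \<in> extensions sR sQ br"
      using that unified_product_image by auto
    have id: "module_hom sQ sQ id" by (rule sQ.module_hom_id)
    show ?thesis
    proof
      assume "\<exists>u. module_hom sQ sR u \<and> TCL_transform br u id \<Omega> \<Omega>'"
      then obtain u where u: "module_hom sQ sR u" "TCL_transform br u id \<Omega> \<Omega>'"
        by blast
      then have "leibniz_iso E.scale (unified_product br \<Omega>) (unified_product br \<Omega>') (tshear u id)"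
        using tshear_iso_iff[OF \<Omega> u(1) id] by simp
      moreover have "tshear u id (a, 0) = (a, 0)" for a
        using u id by (simp add: tshear_R)
      moreover have "snd \<circ> tshear u id = snd" by (auto simp: tshear_def)
      ultimately show "(unified_product br \<Omega>, unified_product br \<Omega>') \<in> ext_cohom sR sQ br"
        using ext unfolding ext_cohom_def by blast
    next
      assume "(unified_product br \<Omega>, unified_product br \<Omega>') \<in> ext_cohom sR sQ br"
      then obtain \<phi> where iso: "leibniz_iso E.scale (unified_product br \<Omega>) (unified_product br \<Omega>') \<phi>"
        and R: "\<And>a. \<phi> (a, 0) = (a, 0)" and snd: "snd \<circ> \<phi> = snd"
        unfolding ext_cohom_def by blast
      have "module_hom E.scale E.scale \<phi>" using iso by (simp add: leibniz_iso_def)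
      then obtain u v where \<phi>: "\<phi> = tshear u v" and uv: "module_hom sQ sR u" "module_hom sQ sQ v"
        using tshear_eqE R by metis
      \<comment> \<open>Compatibility with the projection to Q, read at (0, x), forces v to be the
        identity.\<close>
      have "v x = x" for x
        using fun_cong[OF snd, of "(0, x)"] by (simp add: \<phi> tshear_def)
      then have "v = id" by (simp add: fun_eq_iff)
      then show "\<exists>u. module_hom sQ sR u \<and> TCL_transform br u id \<Omega> \<Omega>'"
        using uv(1) tshear_iso_iff[OF \<Omega> uv(1) id bij_id] iso unfolding \<phi> by blast
    qed
  qed
  then show ?thesis
    unfolding TCL_cohom_def pullback_rel_def by blast
qed

end

section \<open>The classification\<close>

context leibniz_alg
begin

abbreviation "fb1 F \<equiv> flag_bracket s br F (\<lambda>_. 0)"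
abbreviation "fb2 F \<equiv> flag_bracket s br F (\<lambda>a. - flip (flag_h F a))"

context
  fixes V assumes V: "span V = UNIV"
begin

lemma flag_bracket_extension:
  assumes "conf_flag F k" "flag_ids V F k"
  shows "flag_bracket s br F k \<in> extensions s (*) br"
  using assms V by (simp add: extensions_def leibniz_flag_bracket_iff flag_bracket_R)

lemma fb1_extension: "F \<in> flag1 s br V \<Longrightarrow> fb1 F \<in> extensions s (*) br"
  and fb2_extension: "F \<in> flag2 s br V \<Longrightarrow> fb2 F \<in> extensions s (*) br"
  by (simp_all add: flag1_iff_ids flag2_iff_ids flag_bracket_extension)

lemma extension_cases:
  assumes "e \<in> extensions s (*) br"
  shows "e \<in> fb1 ` flag1 s br V \<union> fb2 ` flag2 s br V"
proof -
  obtain F k where conf: "conf_flag F k" and e: "e = flag_bracket s br F k"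
    using extension_decompose[OF assms] .
  have L: "leibniz_conformal E.scale (flag_bracket s br F k)"
    using assms by (simp add: e extensions_def)
  \<comment> \<open>Membership in the flag data refers to V, while the dichotomy determines k on all
    of R; hence the criterion is used for both generating sets.\<close>
  have V': "flag_ids V F k" and U: "flag_ids UNIV F k"
    using L leibniz_flag_bracket_iff[OF conf V] leibniz_flag_bracket_iff[OF conf, of UNIV] by simp_all
  show ?thesis
  proof (cases "k = (\<lambda>_. 0)")
    case True
    then have "F \<in> flag1 s br V" using conf V' by (simp add: flag1_iff_ids)
    then show ?thesis by (auto simp: e True)
  next
    case False
    then have k: "k = (\<lambda>a. - flip (flag_h F a))" using flag_ids_dichotomy[OF U] by blast
    \<comment> \<open>This supplies the nonvanishing of h demanded in the second kind, and so
      separates the two kinds.\<close>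
    with False have "flag_h F \<noteq> (\<lambda>_. 0)" by auto
    then have "F \<in> flag2 s br V" using conf V' by (simp add: flag2_iff_ids k)
    then show ?thesis by (auto simp: e k)
  qed
qed

text \<open>Provides the uniqueness behind the definite descriptions \<open>FC1\<close> and
  \<open>FC2\<close>.\<close>

lemma extension_eq_on_gens:
  assumes "leibniz_conformal E.scale e" "leibniz_conformal E.scale e'"
    and "\<And>x y. x \<in> gens V \<Longrightarrow> y \<in> gens V \<Longrightarrow> e x y = e' x y"
  shows "e = e'"
  using assms span_gens[OF V]
  by (intro conf_bilinear_eq_on_span[of _ _ _ _ _ "gens V" "gens V"] conf_bil.intro conf_bil_axioms.intro
      E.p.module_axioms) (auto simp: leibniz_conformal_def)

lemma flag_bracket_gens:
  assumes "conf_flag F k"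
  shows "flag_bracket s br F k (a, 0) (b, 0) = ppair (br a b) 0"
    "flag_bracket s br F k (a, 0) (0, 1) = ppair (flag_D F a) (flag_h F a)"
    "flag_bracket s br F k (0, 1) (a, 0) = ppair (flag_T F a) (k a)"
    "flag_bracket s br F k (0, 1) (0, 1) = ppair (flag_Q F) (flag_P F)"
  by (rule ev_eq_complexI[OF E.p.module_axioms],
      simp add: ev_flag_bracket zero_simps[OF assms] one_pCons [symmetric])+

lemma FC1_eq:
  assumes "F \<in> flag1 s br V"
  shows "FC1 s br V F = fb1 F"
proof -
  have F: "conf_flag F (\<lambda>_. 0)" using assms by (simp add: flag1_iff_ids)
  have L: "leibniz_conformal E.scale (fb1 F)"
    using fb1_extension[OF assms] by (simp add: extensions_def)
  show ?thesis
    unfolding FC1_def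
  proof (rule the_equality)
    fix e assume "leibniz_conformal E.scale e \<and>
     (\<forall>a\<in>V. \<forall>b\<in>V. e (a, 0) (b, 0) = ppair (br a b) 0) \<and>
     e (0, 1) (0, 1) = ppair (flag_Q F) (flag_P F) \<and>
     (\<forall>a\<in>V. e (a, 0) (0, 1) = ppair (flag_D F a) (flag_h F a) \<and> e (0, 1) (a, 0) = ppair (flag_T F a) 0)"
    then show "e = fb1 F"
      by (intro extension_eq_on_gens L) (auto simp: gens_def flag_bracket_gens[OF F])
  qed (simp add: L flag_bracket_gens[OF F])
qed

lemma FC2_eq:
  assumes "F \<in> flag2 s br V"
  shows "FC2 s br V F = fb2 F"
proof -
  have F: "conf_flag F (\<lambda>a. - flip (flag_h F a))" using assms by (simp add: flag2_iff_ids)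
  have L: "leibniz_conformal E.scale (fb2 F)"
    using fb2_extension[OF assms] by (simp add: extensions_def)
  show ?thesis
    unfolding FC2_def
  proof (rule the_equality)
    fix e assume "leibniz_conformal E.scale e \<and>
     (\<forall>a\<in>V. \<forall>b\<in>V. e (a, 0) (b, 0) = ppair (br a b) 0) \<and>
     e (0, 1) (0, 1) = ppair (flag_Q F) (flag_P F) \<and>
     (\<forall>a\<in>V. e (a, 0) (0, 1) = ppair (flag_D F a) (flag_h F a) \<and>
        e (0, 1) (a, 0) = ppair (flag_T F a) (- flip (flag_h F a)))"
    then show "e = fb2 F"
      by (intro extension_eq_on_gens L) (auto simp: gens_def flag_bracket_gens[OF F])
  qed (simp add: L flag_bracket_gens[OF F])
qed

text \<open>Every isomorphism fixing R is a shear by \<open>shear_eqI\<close>, and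
  \<open>shear_iso_iff\<close> says which shears qualify.\<close>

lemma flag_bracket_ext_equiv_iff:
  assumes F: "conf_flag F k" "flag_bracket s br F k \<in> extensions s (*) br"
    and F': "conf_flag F' k'" "flag_bracket s br F' k' \<in> extensions s (*) br"
  shows "(flag_bracket s br F k, flag_bracket s br F' k') \<in> ext_equiv s (*) br \<longleftrightarrow>
      (\<exists>u \<beta>. \<beta> \<noteq> 0 \<and> flag_rel u \<beta> F k F' k')"
    and "(flag_bracket s br F k, flag_bracket s br F' k') \<in> ext_cohom s (*) br \<longleftrightarrow>
      (\<exists>u. flag_rel u 1 F k F' k')"
proof -
  let ?iso = "leibniz_iso E.scale (flag_bracket s br F k) (flag_bracket s br F' k')"
  note iff = shear_iso_iff[OF F(1) F'(1)]
  have R: "shear u \<beta> (a, 0) = (a, 0)" for u \<beta> a by (simp add: shear_def)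
  have shear: "\<exists>u \<beta>. \<beta> \<noteq> 0 \<and> \<phi> = shear u \<beta>" if "?iso \<phi>" "\<forall>a. \<phi> (a, 0) = (a, 0)" for \<phi>
    using shear_eqI[of \<phi>] that by (metis leibniz_iso_def)
  show "(flag_bracket s br F k, flag_bracket s br F' k') \<in> ext_equiv s (*) br \<longleftrightarrow>
      (\<exists>u \<beta>. \<beta> \<noteq> 0 \<and> flag_rel u \<beta> F k F' k')"
  proof
    assume "(flag_bracket s br F k, flag_bracket s br F' k') \<in> ext_equiv s (*) br"
    then obtain \<phi> where \<phi>: "?iso \<phi>" "\<forall>a. \<phi> (a, 0) = (a, 0)"
      unfolding ext_equiv_def by blast
    from shear[OF this] obtain u \<beta> where "\<beta> \<noteq> 0" "\<phi> = shear u \<beta>" by blast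
    with \<phi>(1) show "\<exists>u \<beta>. \<beta> \<noteq> 0 \<and> flag_rel u \<beta> F k F' k'" using iff by blast
  next
    assume "\<exists>u \<beta>. \<beta> \<noteq> 0 \<and> flag_rel u \<beta> F k F' k'"
    then obtain u \<beta> where "?iso (shear u \<beta>)" using iff by blast
    then show "(flag_bracket s br F k, flag_bracket s br F' k') \<in> ext_equiv s (*) br"
      unfolding ext_equiv_def using F(2) F'(2) R by blast
  qed
  show "(flag_bracket s br F k, flag_bracket s br F' k') \<in> ext_cohom s (*) br \<longleftrightarrow>
      (\<exists>u. flag_rel u 1 F k F' k')"
  proof
    assume "(flag_bracket s br F k, flag_bracket s br F' k') \<in> ext_cohom s (*) br"
    then obtain \<phi> where \<phi>: "?iso \<phi>" "\<forall>a. \<phi> (a, 0) = (a, 0)" "snd \<circ> \<phi> = snd"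
      unfolding ext_cohom_def by blast
    from shear[OF \<phi>(1,2)] obtain u \<beta> where u: "\<phi> = shear u \<beta>" by blast
    \<comment> \<open>The Q-component of the image of x is \<beta>, and the projection condition
      makes it 1.\<close>
    have "\<beta> = 1"
      using fun_cong[OF \<phi>(3), of "(0, 1)"] by (simp add: u shear_def one_pCons)
    with \<phi>(1) u show "\<exists>u. flag_rel u 1 F k F' k'" using iff[of 1] by auto
  next
    assume "\<exists>u. flag_rel u 1 F k F' k'"
    then obtain u where "?iso (shear u 1)" using iff[of 1] by auto
    moreover have "snd \<circ> shear u 1 = snd" by (auto simp: shear_def)
    ultimately show "(flag_bracket s br F k, flag_bracket s br F' k') \<in> ext_cohom s (*) br"
      unfolding ext_cohom_def using F(2) F'(2) R by blast
  qed
qed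

lemma flag_rel_1: "flag_rel u \<beta> F (\<lambda>_. 0) F' (\<lambda>_. 0) \<longleftrightarrow>
    flag_h F = flag_h F' \<and> flag_transform1 s br u \<beta> F F'"
proof -
  have "act1 s 0 [:u:] = 0" by (simp add: eq_ev)
  then show ?thesis by (simp add: flag_rel_def flag_transform1_def)
qed

text \<open>Equal h gives equal k, and with k = -flip h the term subtracted in the equation for T
  turns into the added term with h at index -\<lambda>-\<partial>.\<close>

lemma flag_rel_2: "flag_rel u \<beta> F (\<lambda>a. - flip (flag_h F a)) F' (\<lambda>a. - flip (flag_h F' a)) \<longleftrightarrow>
    flag_h F = flag_h F' \<and> flag_transform2 s br u \<beta> F F'"
proof -
  have "act1 s (- p) [:u:] = - act1 s p [:u:]" for p by (simp add: eq_ev)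
  then show ?thesis by (auto simp: flag_rel_def flag_transform2_def)
qed

lemma flag_pullbacks:
  "flag1_equiv s br V = pullback_rel (flag1 s br V) (FC1 s br V) (ext_equiv s (*) br)"
  "flag2_equiv s br V = pullback_rel (flag2 s br V) (FC2 s br V) (ext_equiv s (*) br)"
  "flag1_cohom s br V = pullback_rel (flag1 s br V) (FC1 s br V) (ext_cohom s (*) br)"
  "flag2_cohom s br V = pullback_rel (flag2 s br V) (FC2 s br V) (ext_cohom s (*) br)"
proof -
  have "(FC1 s br V F, FC1 s br V F') \<in> ext_equiv s (*) br \<longleftrightarrow>
      flag_h F = flag_h F' \<and> (\<exists>u \<beta>. \<beta> \<noteq> 0 \<and> flag_transform1 s br u \<beta> F F')"
    "(FC1 s br V F, FC1 s br V F') \<in> ext_cohom s (*) br \<longleftrightarrow>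
      flag_h F = flag_h F' \<and> (\<exists>u. flag_transform1 s br u 1 F F')"
    if "F \<in> flag1 s br V" "F' \<in> flag1 s br V" for F F'
    using that by (auto simp: FC1_eq flag1_iff_ids flag_bracket_ext_equiv_iff flag_bracket_extension flag_rel_1)
  then show "flag1_equiv s br V = pullback_rel (flag1 s br V) (FC1 s br V) (ext_equiv s (*) br)"
    "flag1_cohom s br V = pullback_rel (flag1 s br V) (FC1 s br V) (ext_cohom s (*) br)"
    unfolding flag1_equiv_def flag1_cohom_def pullback_rel_def by blast+
next
  have "(FC2 s br V F, FC2 s br V F') \<in> ext_equiv s (*) br \<longleftrightarrow>
      flag_h F = flag_h F' \<and> (\<exists>u \<beta>. \<beta> \<noteq> 0 \<and> flag_transform2 s br u \<beta> F F')"
    "(FC2 s br V F, FC2 s br V F') \<in> ext_cohom s (*) br \<longleftrightarrow>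
      flag_h F = flag_h F' \<and> (\<exists>u. flag_transform2 s br u 1 F F')"
    if "F \<in> flag2 s br V" "F' \<in> flag2 s br V" for F F'
    using that by (auto simp: FC2_eq flag2_iff_ids flag_bracket_ext_equiv_iff flag_bracket_extension flag_rel_2)
  then show "flag2_equiv s br V = pullback_rel (flag2 s br V) (FC2 s br V) (ext_equiv s (*) br)"
    "flag2_cohom s br V = pullback_rel (flag2 s br V) (FC2 s br V) (ext_cohom s (*) br)"
    unfolding flag2_equiv_def flag2_cohom_def pullback_rel_def by blast+
qed

text \<open>Equivalent flag brackets have the same k. It is 0 for the first kind and nonzero for the
  second, as \<open>flip\<close> is injective and h is nonzero.\<close>

lemma kinds_disjoint:
  assumes F: "F \<in> flag1 s br V" and F': "F' \<in> flag2 s br V"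
  shows "(FC1 s br V F, FC2 s br V F') \<notin> ext_equiv s (*) br"
    "(FC1 s br V F, FC2 s br V F') \<notin> ext_cohom s (*) br"
proof -
  have "\<not> flag_rel u \<beta> F (\<lambda>_. 0) F' (\<lambda>a. - flip (flag_h F' a))" for u \<beta>
  proof
    assume "flag_rel u \<beta> F (\<lambda>_. 0) F' (\<lambda>a. - flip (flag_h F' a))"
    then have "flip (flag_h F' a) = 0" for a by (auto simp: flag_rel_def fun_eq_iff)
    then have "flag_h F' a = 0" for a by (metis flip_flip flip_0)
    with F' show False by (auto simp: flag2_iff_ids)
  qed
  then show "(FC1 s br V F, FC2 s br V F') \<notin> ext_equiv s (*) br"
    "(FC1 s br V F, FC2 s br V F') \<notin> ext_cohom s (*) br"
    using F F' by (simp_all add: FC1_eq FC2_eq flag1_iff_ids flag2_iff_ids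
        flag_bracket_ext_equiv_iff flag_bracket_extension)
qed

lemma FC_images:
  "FC1 s br V ` flag1 s br V \<subseteq> extensions s (*) br"
  "FC2 s br V ` flag2 s br V \<subseteq> extensions s (*) br"
  "extensions s (*) br \<subseteq> FC1 s br V ` flag1 s br V \<union> FC2 s br V ` flag2 s br V"
proof -
  have 1: "FC1 s br V ` flag1 s br V = fb1 ` flag1 s br V" and 2: "FC2 s br V ` flag2 s br V = fb2 ` flag2 s br V"
    by (auto simp: FC1_eq FC2_eq)
  show "FC1 s br V ` flag1 s br V \<subseteq> extensions s (*) br"
    "FC2 s br V ` flag2 s br V \<subseteq> extensions s (*) br"
    "extensions s (*) br \<subseteq> FC1 s br V ` flag1 s br V \<union> FC2 s br V ` flag2 s br V"
    unfolding 1 2 using fb1_extension fb2_extension extension_cases by blast+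
qed

end

end

theorem theorem4p4:
  fixes s :: "complex poly \<Rightarrow> 'r::ab_group_add \<Rightarrow> 'r"
    and br :: "'r \<Rightarrow> 'r \<Rightarrow> 'r poly"
    and V :: "'r set"
  assumes "leibniz_conformal s br"
    and "free_on s V"
  shows
    "(equiv (flag1 s br V) (flag1_equiv s br V) \<and>
      equiv (flag2 s br V) (flag2_equiv s br V) \<and>
      equiv (TCL s (*) br) (TCL_equiv s (*) br) \<and>
      equiv (extensions s (*) br) (ext_equiv s (*) br) \<and>
      (\<exists>f g.
        bij_betw f (LH2_R s (*) br) (CExtd s (*) br) \<and>
        (\<forall>\<Omega>\<in>TCL s (*) br.
           f (TCL_equiv s (*) br `` {\<Omega>}) = ext_equiv s (*) br `` {unified_product br \<Omega>}) \<and>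
        bij_betw g
          (flag1 s br V // flag1_equiv s br V <+> flag2 s br V // flag2_equiv s br V)
          (LH2_R s (*) br) \<and>
        (\<forall>F\<in>flag1 s br V.
           f (g (Inl (flag1_equiv s br V `` {F}))) = ext_equiv s (*) br `` {FC1 s br V F}) \<and>
        (\<forall>F\<in>flag2 s br V.
           f (g (Inr (flag2_equiv s br V `` {F}))) = ext_equiv s (*) br `` {FC2 s br V F})))
     \<and>
     (equiv (flag1 s br V) (flag1_cohom s br V) \<and>
      equiv (flag2 s br V) (flag2_cohom s br V) \<and>
      equiv (TCL s (*) br) (TCL_cohom s (*) br) \<and>
      equiv (extensions s (*) br) (ext_cohom s (*) br) \<and>
      (\<exists>f g.
        bij_betw f (LH2 s (*) br) (CExtd' s (*) br) \<and>
        (\<forall>\<Omega>\<in>TCL s (*) br.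
           f (TCL_cohom s (*) br `` {\<Omega>}) = ext_cohom s (*) br `` {unified_product br \<Omega>}) \<and>
        bij_betw g
          (flag1 s br V // flag1_cohom s br V <+> flag2 s br V // flag2_cohom s br V)
          (LH2 s (*) br) \<and>
        (\<forall>F\<in>flag1 s br V.
           f (g (Inl (flag1_cohom s br V `` {F}))) = ext_cohom s (*) br `` {FC1 s br V F}) \<and>
        (\<forall>F\<in>flag2 s br V.
           f (g (Inr (flag2_cohom s br V `` {F}))) = ext_cohom s (*) br `` {FC2 s br V F})))"
proof -
  interpret leibniz_alg s br by standard (rule assms)
  interpret X: extension_pair s "(*)" br by standard (rule assms)
  have V: "span V = UNIV" by (rule free_on_span) (rule assms)
  note images = X.unified_product_image FC_images[OF V]
  show ?thesis
    \<comment> \<open>The abstract classification is applied twice over the same three maps into the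
      extensions, once for each of the two isomorphism relations.\<close>
    unfolding LH2_R_def LH2_def CExtd_def CExtd'_def
    using classification[OF equiv_ext_equiv images kinds_disjoint(1)[OF V]
        X.TCL_equiv_pullback flag_pullbacks(1,2)[OF V]]
      classification[OF equiv_ext_cohom images kinds_disjoint(2)[OF V]
        X.TCL_cohom_pullback flag_pullbacks(3,4)[OF V]]
    by (rule conjI)
qed

end
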